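(* Let $\kappa$ be a nonzero real number. Let $R_-$ be the right ideal of $SU_\mu(2)$ generated by $$\rho^2,\quad \rho(\sigma-\sigma^* ),\quad \sigma^2+\mu^2(\sigma^* )^2+(1+\mu^2)^2\rho\rho^*-(1+\mu^2)I,\quad (\rho^* )^2,\quad \rho^*(\sigma-\sigma^* ),$$ $$t\rho,\quad t\rho^*,\quad t(\sigma-\sigma^* ),\quad t\left(\mu^2\sigma+\sigma^*-(1+\mu^2)I\right),\qquad\text{where } t=\mu^2\sigma+\sigma^*+\tfrac{1+\mu^4}{\mu}I$$ (the ideal defining the $4D_-$ bicovariant calculus), and let $\tilde R_{0-}\subset\tilde E_\kappa(2)$ be its contraction, in the sense of the context. Then $\tilde R_{0-}$ is the right ideal of $\tilde E_\kappa(2)$ generated by the following elements: $$a_0^2+a_0-a_0^*-I;\qquad (a_0^* )^2+a_0^*-a_0-I;$$ $$(a_0+I)w_0;\quad (a_0^*+I)w_0;\quad (a_0+I)w_0^*;\quad (a_0^*+I)w_0^*;$$ $$w_0^2-\tfrac1\kappa w_0;\qquad (w_0^* )^2+\tfrac1\kappa w_0^*;\qquad w_0w_0^*-\tfrac1\kappa w_0-\tfrac1{\kappa^2}(a_0^*-I).$$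
   Context: $[x,y]=xy-yx$ and $I$ is the unit. The quantum group $SU_\mu(2)$: the unital $*$-algebra generated by $\sigma,\rho$ with relations $\rho\rho^*=\rho^*\rho$, $\mu(\rho-\rho^* )\sigma=\sigma(\rho-\rho^* )$, $\mu(\rho+\rho^* )\sigma=\sigma(\rho+\rho^* )$, $\sigma\sigma^*+\mu^2\rho\rho^*=I$, $\sigma^*\sigma+\rho\rho^*=I$ (and their adjoints). Contraction: put $\mu=e^{1/(\kappa R)}$, where $R$ is the contraction parameter, and write $h=1/R$ (formal, $h^*=h$). Consider $SU_\mu(2)$ over the field $\mathbb C((h))$ with $\mu=e^{h/\kappa}$. Define $a$ and $w$ by $$a=\tfrac12(\sigma+\rho-\mu\rho^*+\sigma^* ),\qquad \tfrac{1}{R}\,w=\tfrac12(-\sigma-\rho-\mu\rho^*+\sigma^* ),$$ equivalently $$\sigma=\tfrac{1}{1+\mu}\left(\mu a+a^*+\tfrac1R(w^*-\mu w)\right),\qquad \rho=\tfrac{1}{1+\mu}\left(a-a^*-\tfrac1R(w+w^* )\right).$$ Let $\mathcal L$ be the $\mathbb C[[h]]$-subalgebra generated by $a,a^*,w,w^*$. The limit $R\to\infty$ of $SU_\mu(2)$ is $\tilde E_\kappa(2)=\mathcal L/h\mathcal L$, and $a_0,a_0^*,w_0,w_0^*$ are the images of $a,a^*,w,w^*$. As an algebra $\tilde E_\kappa(2)$ is generated by $a_0,a_0^*,w_0,w_0^*$ with relations $a_0a_0^*=a_0^*a_0=I$, $[a_0,w_0]=-[a_0,w_0^*]=\frac1{2\kappa}(a_0^2-I)$,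 $[a_0^*,w_0]=-[a_0^*,w_0^*]=\frac1{2\kappa}((a_0^* )^2-I)$, $[w_0,w_0^*]=-\frac1{2\kappa}(a_0+a_0^* )(w_0+w_0^* )$. The contraction of a right ideal $\mathcal I$ of $SU_\mu(2)$ is the set of limits as $R\to\infty$ of elements of $\mathcal I$, i.e. the image of $\mathcal I\cap\mathcal L$ in $\mathcal L/h\mathcal L=\tilde E_\kappa(2)$; it is a right ideal of $\tilde E_\kappa(2)$. *)

theory Defs
  imports
    "HOL-Library.Poly_Mapping"
    "HOL-Computational_Algebra.Formal_Laurent_Series"
    "HOL-Algebra.Algebraic_Closure_Type"
    "HOL-Algebra.QuotRing"
    "HOL-Algebra.Generated_Rings"
begin

section \<open>The free *-algebra on two generators over the formal Laurent series\<close>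

text \<open>The free monoid on the four letters. It is written additively so that
  \<^typ>\<open>'a \<Rightarrow>\<^sub>0 'b\<close>, with its convolution product, becomes the free algebra.\<close>

datatype letter = Sig | Sig_star | Rho | Rho_star

datatype word = Word (letters: "letter list")

instantiation word :: monoid_add
begin
definition zero_word :: word where "0 = Word []"
definition plus_word :: "word \<Rightarrow> word \<Rightarrow> word" where "u + v = Word (letters u @ letters v)"
instance by standard (auto simp: zero_word_def plus_word_def)
end

text \<open>\<^typ>\<open>complex fls\<close> is the field of formal Laurent series in \<open>h = 1/R\<close>.\<close>

type_synonym free_alg = "word \<Rightarrow>\<^sub>0 complex fls"

definition const :: "complex fls \<Rightarrow> free_alg"
  where "const c = Poly_Mapping.single 0 c"

definition gen :: "letter \<Rightarrow> free_alg"
  where "gen l = Poly_Mapping.single (Word [l]) 1"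

fun letter_adj :: "letter \<Rightarrow> letter" where
  "letter_adj Sig = Sig_star"
| "letter_adj Sig_star = Sig"
| "letter_adj Rho = Rho_star"
| "letter_adj Rho_star = Rho"

definition word_adj :: "word \<Rightarrow> word"
  where "word_adj u = Word (rev (map letter_adj (letters u)))"

text \<open>The conjugation of scalars fixes \<open>h\<close>.\<close>

definition fls_conj :: "complex fls \<Rightarrow> complex fls"
  where "fls_conj f = Abs_fls (\<lambda>n. cnj (fls_nth f n))"

lemma fls_conj_nth [simp]: "fls_nth (fls_conj f) n = cnj (fls_nth f n)"
proof -
  have "(\<lambda>n. cnj (fls_nth f n)) \<in> {g. \<forall>\<^sub>\<infinity>n::nat. g (- int n) = 0}"
    using eventually_mono[OF MOST_fls_neg_nth_eq_0[of f]] by simp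
  then show ?thesis by (simp add: fls_conj_def Abs_fls_inverse)
qed

definition adj :: "free_alg \<Rightarrow> free_alg"
  where "adj p = (\<Sum>u\<in>Poly_Mapping.keys p. Poly_Mapping.single (word_adj u) (fls_conj (Poly_Mapping.lookup p u)))"

abbreviation free_ring :: "free_alg ring"
  where "free_ring \<equiv> ring_of_type_algebra"


lemma ring_free_ring: "ring free_ring"
proof -
  have "\<exists>y. x + y = 0" for x :: free_alg
    using add.right_inverse by blast
  then show ?thesis
    unfolding ring_of_type_algebra_def using add.right_inverse
    by unfold_locales (auto simp: algebra_simps Units_def)
qed

lemma fls_conj_simps:
  "fls_conj 0 = 0" "fls_conj 1 = 1" "fls_conj (f + g) = fls_conj f + fls_conj g"
  "fls_conj (fls_conj f) = f" "fls_conj fls_X = fls_X"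
  by (auto simp: fls_eq_iff)

lemma fls_conj_mult: "fls_conj (f * g) = fls_conj f * fls_conj g"
proof -
  have sd: "fls_subdegree (fls_conj f) = fls_subdegree f" for f
  proof (cases "f = 0")
    case False
    then show ?thesis
      by (intro fls_subdegree_eqI) auto
  qed (simp add: fls_conj_simps)
  show ?thesis
    by (simp add: fls_eq_iff fls_times_nth sd)
qed

lemma word_adj_simps: "word_adj 0 = 0" "word_adj (u + v) = word_adj v + word_adj u"
  "word_adj (word_adj u) = u"
proof -
  have "letter_adj (letter_adj l) = l" for l by (cases l) auto
  then show "word_adj (word_adj u) = u"
    by (cases u) (simp add: word_adj_def rev_map o_def)
qed (auto simp: word_adj_def zero_word_def plus_word_def)

lemma adj_eq_Sum_any:
  assumes "finite S" "Poly_Mapping.keys p \<subseteq> S"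
  shows "adj p = (\<Sum>u\<in>S. Poly_Mapping.single (word_adj u) (fls_conj (Poly_Mapping.lookup p u)))"
  unfolding adj_def using assms
  by (intro sum.mono_neutral_left) (auto simp: in_keys_iff fls_conj_simps)

lemma adj_add: "adj (p + q) = adj p + adj q"
proof -
  let ?S = "Poly_Mapping.keys p \<union> Poly_Mapping.keys q"
  have "finite ?S" by simp
  moreover have "Poly_Mapping.keys (p + q) \<subseteq> ?S" by (rule Poly_Mapping.keys_add)
  ultimately show ?thesis
    by (simp add: adj_eq_Sum_any[of ?S] lookup_add fls_conj_simps single_add sum.distrib)
qed

lemma adj_single: "adj (Poly_Mapping.single u c) = Poly_Mapping.single (word_adj u) (fls_conj c)"
  by (subst adj_eq_Sum_any[of "{u}"]) auto

lemma adj_0 [simp]: "adj 0 = 0"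
  by (simp add: adj_def)

lemma adj_sum: "adj (\<Sum>i\<in>I. f i) = (\<Sum>i\<in>I. adj (f i))"
  by (induction I rule: infinite_finite_induct) (auto simp: adj_add)

lemma free_alg_expand: "p = (\<Sum>u\<in>Poly_Mapping.keys p. Poly_Mapping.single u (Poly_Mapping.lookup p u))"
  for p :: free_alg
proof (rule poly_mapping_eqI)
  fix k
  show "Poly_Mapping.lookup p k = Poly_Mapping.lookup
      (\<Sum>u\<in>Poly_Mapping.keys p. Poly_Mapping.single u (Poly_Mapping.lookup p u)) k"
    by (simp add: lookup_sum lookup_single when_def in_keys_iff)
qed

lemma adj_mult: "adj (p * q) = adj q * adj p"
proof -
  have "p * q = (\<Sum>u\<in>Poly_Mapping.keys p. \<Sum>v\<in>Poly_Mapping.keys q.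
      Poly_Mapping.single (u + v) (Poly_Mapping.lookup p u * Poly_Mapping.lookup q v))"
    unfolding mult_single[symmetric] sum_product[symmetric]
    by (simp flip: free_alg_expand)
  then have "adj (p * q) = (\<Sum>u\<in>Poly_Mapping.keys p. \<Sum>v\<in>Poly_Mapping.keys q.
      Poly_Mapping.single (word_adj v + word_adj u)
        (fls_conj (Poly_Mapping.lookup q v) * fls_conj (Poly_Mapping.lookup p u)))"
    by (simp add: adj_sum adj_single word_adj_simps fls_conj_mult mult.commute)
  also have "\<dots> = adj q * adj p"
    unfolding adj_def by (subst sum.swap) (simp add: sum_product mult_single)
  finally show ?thesis .
qed

lemma adj_adj [simp]: "adj (adj p) = p"
proof -
  have "adj (adj p) = (\<Sum>u\<in>Poly_Mapping.keys p. Poly_Mapping.single u (Poly_Mapping.lookup p u))"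
    by (simp add: adj_def[of p] adj_sum adj_single word_adj_simps fls_conj_simps)
  then show ?thesis by (simp flip: free_alg_expand)
qed

section \<open>Right ideals\<close>

definition right_ideal :: "'a set \<Rightarrow> ('a, 'b) ring_scheme \<Rightarrow> bool"
  where "right_ideal I R \<longleftrightarrow>
    additive_subgroup I R \<and> (\<forall>x\<in>I. \<forall>r\<in>carrier R. x \<otimes>\<^bsub>R\<^esub> r \<in> I)"

definition gen_right_ideal :: "('a, 'b) ring_scheme \<Rightarrow> 'a set \<Rightarrow> 'a set"
  where "gen_right_ideal R S = \<Inter>{I. right_ideal I R \<and> S \<subseteq> I}"


section \<open>The quantum group $SU_\mu(2)$\<close>

definition mu :: "real \<Rightarrow> complex fls"
  where "mu \<kappa> = fps_to_fls (fps_exp (complex_of_real (1 / \<kappa>)))"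

abbreviation sigma :: free_alg where "sigma \<equiv> gen Sig"
abbreviation sigma' :: free_alg where "sigma' \<equiv> adj sigma"
abbreviation rho :: free_alg where "rho \<equiv> gen Rho"
abbreviation rho' :: free_alg where "rho' \<equiv> adj rho"

text \<open>A relation \<open>x = y\<close> is recorded as the element \<open>x - y\<close>.\<close>

definition SU_relations :: "real \<Rightarrow> free_alg set"
  where "SU_relations \<kappa> = (let m = const (mu \<kappa>) in
    { rho * rho' - rho' * rho,
      m * (rho - rho') * sigma - sigma * (rho - rho'),
      m * (rho + rho') * sigma - sigma * (rho + rho'),
      sigma * sigma' + m\<^sup>2 * rho * rho' - 1,
      sigma' * sigma + rho * rho' - 1 })"

definition SU_ideal :: "real \<Rightarrow> free_alg set"
  where "SU_ideal \<kappa> = Idl\<^bsub>free_ring\<^esub> (SU_relations \<kappa> \<union> adj ` SU_relations \<kappa>)"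

definition SU :: "real \<Rightarrow> free_alg set ring"
  where "SU \<kappa> = free_ring Quot SU_ideal \<kappa>"

text \<open>The canonical projection. Since \<^const>\<open>SU_ideal\<close> is generated by a set stable under
  \<^const>\<open>adj\<close>, the adjoint of \<open>SU_class \<kappa> x\<close> is \<open>SU_class \<kappa> (adj x)\<close>.\<close>

definition SU_class :: "real \<Rightarrow> free_alg \<Rightarrow> free_alg set"
  where "SU_class \<kappa> x = SU_ideal \<kappa> +>\<^bsub>free_ring\<^esub> x"


lemma ideal_SU_ideal: "ideal (SU_ideal \<kappa>) free_ring"
  unfolding SU_ideal_def
  by (rule ring.genideal_ideal[OF ring_free_ring]) (simp add: ring_of_type_algebra_def)

lemma ring_SU: "ring (SU \<kappa>)"
  unfolding SU_def by (rule ideal.quotient_is_ring[OF ideal_SU_ideal])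

lemma free_ring_inv: "\<ominus>\<^bsub>free_ring\<^esub> x = - x" for x :: free_alg
proof -
  interpret ring "free_ring :: free_alg ring" by (rule ring_free_ring)
  have "x \<oplus>\<^bsub>free_ring\<^esub> (- x) = \<zero>\<^bsub>free_ring\<^esub>"
    by (simp add: ring_of_type_algebra_def)
  then show ?thesis
    by (intro minus_equality) (simp_all add: ring_of_type_algebra_def)
qed

lemma adj_SU_ideal:
  assumes "x \<in> SU_ideal \<kappa>" shows "adj x \<in> SU_ideal \<kappa>"
proof -
  interpret I: ideal "SU_ideal \<kappa>" free_ring by (rule ideal_SU_ideal)
  note asg = ideal.axioms(1)[OF ideal_SU_ideal[of \<kappa>]]
  let ?J = "adj ` SU_ideal \<kappa>"
  have minus: "- y \<in> SU_ideal \<kappa>" if "y \<in> SU_ideal \<kappa>" for y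
    using I.I_l_closed[OF that, of "- 1"] by (simp add: ring_of_type_algebra_def)
  have adj_minus: "adj (- y) = - adj y" for y
    using adj_add[of y "- y"] by (simp add: minus_unique)
  have "ideal ?J free_ring"
  proof (rule idealI[OF ring_free_ring])
    show "subgroup ?J (add_monoid free_ring)"
    proof (rule group.subgroupI)
      show "Group.group (add_monoid (free_ring :: free_alg ring))"
        by (rule I.add.is_group)
      show "?J \<subseteq> carrier (add_monoid free_ring)"
        by (simp add: ring_of_type_algebra_def)
      show "?J \<noteq> {}"
        using additive_subgroup.zero_closed[OF asg] by (metis empty_iff image_is_empty)
    next
      fix y assume "y \<in> ?J"
      then show "inv\<^bsub>add_monoid free_ring\<^esub> y \<in> ?J"
        using minus adj_minus free_ring_inv[of y] unfolding a_inv_def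
        by (metis (no_types, lifting) imageE image_eqI)
    next
      fix y z assume "y \<in> ?J" "z \<in> ?J"
      then show "y \<otimes>\<^bsub>add_monoid free_ring\<^esub> z \<in> ?J"
        using additive_subgroup.a_closed[OF asg]
        by (fastforce simp: ring_of_type_algebra_def adj_add[symmetric])
    qed
  next
    fix y z assume "y \<in> ?J"
    then obtain u where u: "u \<in> SU_ideal \<kappa>" "y = adj u" by blast
    have "u * adj z \<in> SU_ideal \<kappa>" "adj z * u \<in> SU_ideal \<kappa>"
      using I.I_r_closed[OF u(1), of "adj z"] I.I_l_closed[OF u(1), of "adj z"]
      by (simp_all add: ring_of_type_algebra_def)
    then have "adj (u * adj z) \<in> ?J" "adj (adj z * u) \<in> ?J"
      by simp_all
    then have "z * y \<in> ?J" "y * z \<in> ?J"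
      by (simp_all only: adj_mult adj_adj u(2))
    then show "z \<otimes>\<^bsub>free_ring\<^esub> y \<in> ?J" "y \<otimes>\<^bsub>free_ring\<^esub> z \<in> ?J"
      by (simp_all add: ring_of_type_algebra_def)
  qed
  moreover have "SU_relations \<kappa> \<union> adj ` SU_relations \<kappa> \<subseteq> ?J"
  proof -
    have "SU_relations \<kappa> \<union> adj ` SU_relations \<kappa> \<subseteq> SU_ideal \<kappa>"
      unfolding SU_ideal_def
      by (rule ring.genideal_self[OF ring_free_ring]) (simp add: ring_of_type_algebra_def)
    then have "adj ` (SU_relations \<kappa> \<union> adj ` SU_relations \<kappa>) \<subseteq> ?J" by (rule image_mono)
    moreover have "adj ` (SU_relations \<kappa> \<union> adj ` SU_relations \<kappa>) =
        SU_relations \<kappa> \<union> adj ` SU_relations \<kappa>"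
      by (simp add: image_Un image_image Un_commute)
    ultimately show ?thesis by simp
  qed
  ultimately have "SU_ideal \<kappa> \<subseteq> ?J"
    using ring.genideal_minimal[OF ring_free_ring] SU_ideal_def by metis
  then show ?thesis using assms by force
qed

lemma adj_SU_class: "adj ` SU_class \<kappa> x = SU_class \<kappa> (adj x)"
proof -
  have *: "SU_class \<kappa> x = (\<lambda>i. i + x) ` SU_ideal \<kappa>" for x
    by (auto simp: SU_class_def a_r_coset_def r_coset_def ring_of_type_algebra_def)
  have "adj ` SU_ideal \<kappa> = SU_ideal \<kappa>"
  proof
    show "SU_ideal \<kappa> \<subseteq> adj ` SU_ideal \<kappa>"
    proof
      fix y assume "y \<in> SU_ideal \<kappa>"
      then show "y \<in> adj ` SU_ideal \<kappa>"
        using adj_SU_ideal by (intro image_eqI[of _ _ "adj y"]) auto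
    qed
  qed (use adj_SU_ideal in blast)
  moreover have "adj ` (\<lambda>i. i + x) ` SU_ideal \<kappa> = (\<lambda>i. i + adj x) ` adj ` SU_ideal \<kappa>"
    by (simp add: image_image adj_add)
  ultimately show ?thesis
    by (simp add: *)
qed


section \<open>The contraction\<close>

definition elem_a :: "real \<Rightarrow> free_alg"
  where "elem_a \<kappa> = const (1/2) * (sigma + rho - const (mu \<kappa>) * rho' + sigma')"

text \<open>\<^const>\<open>fls_X_inv\<close> is \<open>1/h = R\<close>.\<close>

definition elem_w :: "real \<Rightarrow> free_alg"
  where "elem_w \<kappa> = const (fls_X_inv / 2) * (- sigma - rho - const (mu \<kappa>) * rho' + sigma')"

text \<open>The subalgebra over the formal power series generated by \<open>a, a*, w, w*\<close>: the subring
  generated by these elements together with the power series scalars.\<close>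

definition lattice_L :: "real \<Rightarrow> free_alg set set"
  where "lattice_L \<kappa> = generate_ring (SU \<kappa>) (SU_class \<kappa> `
    (range (\<lambda>f. const (fps_to_fls f)) \<union>
     {elem_a \<kappa>, adj (elem_a \<kappa>), elem_w \<kappa>, adj (elem_w \<kappa>)}))"

definition L_ring :: "real \<Rightarrow> free_alg set ring"
  where "L_ring \<kappa> = (SU \<kappa>)\<lparr>carrier := lattice_L \<kappa>\<rparr>"

definition hL :: "real \<Rightarrow> free_alg set set"
  where "hL \<kappa> = (\<lambda>x. SU_class \<kappa> (const fls_X) \<otimes>\<^bsub>SU \<kappa>\<^esub> x) ` lattice_L \<kappa>"

definition E_kappa :: "real \<Rightarrow> free_alg set set ring"
  where "E_kappa \<kappa> = L_ring \<kappa> Quot hL \<kappa>"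

lemma SU_class_hom: "SU_class \<kappa> \<in> ring_hom free_ring (SU \<kappa>)"
  unfolding SU_def SU_class_def by (rule ideal.rcos_ring_hom[OF ideal_SU_ideal])

lemma SU_class_simps:
  "SU_class \<kappa> x \<in> carrier (SU \<kappa>)"
  "SU_class \<kappa> (x * y) = SU_class \<kappa> x \<otimes>\<^bsub>SU \<kappa>\<^esub> SU_class \<kappa> y"
  "SU_class \<kappa> (x + y) = SU_class \<kappa> x \<oplus>\<^bsub>SU \<kappa>\<^esub> SU_class \<kappa> y"
  "SU_class \<kappa> 1 = \<one>\<^bsub>SU \<kappa>\<^esub>"
  using ring_hom_memE[OF SU_class_hom[of \<kappa>]] by (simp_all add: ring_of_type_algebra_def)

lemma carrier_SU: "carrier (SU \<kappa>) = range (SU_class \<kappa>)"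
  by (auto simp: SU_def FactRing_def A_RCOSETS_def' SU_class_def ring_of_type_algebra_def)

lemma const_commute: "const c * x = x * const c"
proof -
  have "const c * Poly_Mapping.single u d = Poly_Mapping.single u d * const c" for u d
    by (simp add: const_def mult_single mult.commute)
  then show ?thesis
    using free_alg_expand[of x] by (metis (no_types, lifting) sum.cong sum_distrib_left sum_distrib_right)
qed

lemma subring_lattice_L: "subring (lattice_L \<kappa>) (SU \<kappa>)"
  unfolding lattice_L_def
  by (rule ring.generate_ring_is_subring[OF ring_SU]) (auto simp: SU_class_simps)

lemma ring_L: "ring (L_ring \<kappa>)"
  unfolding L_ring_def by (rule ring.subring_is_ring[OF ring_SU subring_lattice_L])

lemma ideal_hL: "ideal (hL \<kappa>) (L_ring \<kappa>)"
proof -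
  interpret S: ring "SU \<kappa>" by (rule ring_SU)
  interpret L: ring "L_ring \<kappa>" by (rule ring_L)
  note sub = subringE[OF subring_lattice_L[of \<kappa>]]
  define t where "t = SU_class \<kappa> (const fls_X)"
  have t: "t \<in> carrier (SU \<kappa>)" by (simp add: t_def SU_class_simps)
  have tL: "t \<in> lattice_L \<kappa>"
    unfolding lattice_L_def t_def
    by (rule generate_ring.incl) (metis UnI1 fps_X_to_fls image_eqI rangeI)
  have comm: "t \<otimes>\<^bsub>SU \<kappa>\<^esub> x = x \<otimes>\<^bsub>SU \<kappa>\<^esub> t" if x: "x \<in> carrier (SU \<kappa>)" for x
  proof -
    obtain y where y: "x = SU_class \<kappa> y" using x by (auto simp: carrier_SU)
    have "SU_class \<kappa> (const fls_X * y) = SU_class \<kappa> (y * const fls_X)"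
      by (rule arg_cong[OF const_commute])
    then show ?thesis
      unfolding y t_def SU_class_simps(2) .
  qed
  have car: "x \<in> carrier (SU \<kappa>)" if "x \<in> lattice_L \<kappa>" for x
    using that sub(1) by blast
  have hL: "hL \<kappa> = (\<lambda>x. t \<otimes>\<^bsub>SU \<kappa>\<^esub> x) ` lattice_L \<kappa>"
    by (simp add: hL_def t_def)
  have sg: "subgroup (hL \<kappa>) (add_monoid (SU \<kappa>))"
  proof (rule S.add.subgroupI)
    show "hL \<kappa> \<subseteq> carrier (SU \<kappa>)" using car t by (auto simp: hL)
    show "hL \<kappa> \<noteq> {}" using sub(2) by (auto simp: hL)
  next
    fix y assume "y \<in> hL \<kappa>"
    then obtain x where x: "x \<in> lattice_L \<kappa>" "y = t \<otimes>\<^bsub>SU \<kappa>\<^esub> x" by (auto simp: hL)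
    then have "\<ominus>\<^bsub>SU \<kappa>\<^esub> y = t \<otimes>\<^bsub>SU \<kappa>\<^esub> (\<ominus>\<^bsub>SU \<kappa>\<^esub> x)" using t car S.r_minus by simp
    then show "\<ominus>\<^bsub>SU \<kappa>\<^esub> y \<in> hL \<kappa>" using sub(5) x by (auto simp: hL)
  next
    fix y z assume "y \<in> hL \<kappa>" "z \<in> hL \<kappa>"
    then show "y \<oplus>\<^bsub>SU \<kappa>\<^esub> z \<in> hL \<kappa>"
      using sub(7) t car by (auto simp: hL simp flip: S.r_distr)
  qed
  have hL_sub: "hL \<kappa> \<subseteq> lattice_L \<kappa>" using sub(6) tL by (auto simp: hL)
  show ?thesis
  proof (rule idealI[OF ring_L])
    show "subgroup (hL \<kappa>) (add_monoid (L_ring \<kappa>))"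
      using S.add.subgroup_incl[OF sg _ hL_sub] subring.axioms(1)[OF subring_lattice_L[of \<kappa>]]
      by (simp add: L_ring_def)
  next
    fix y x assume "y \<in> hL \<kappa>" "x \<in> carrier (L_ring \<kappa>)"
    then obtain z where z: "z \<in> lattice_L \<kappa>" "y = t \<otimes>\<^bsub>SU \<kappa>\<^esub> z" and x: "x \<in> lattice_L \<kappa>"
      by (auto simp: hL L_ring_def)
    have "y \<otimes>\<^bsub>SU \<kappa>\<^esub> x = t \<otimes>\<^bsub>SU \<kappa>\<^esub> (z \<otimes>\<^bsub>SU \<kappa>\<^esub> x)"
      using z x t car S.m_assoc by simp
    moreover have "x \<otimes>\<^bsub>SU \<kappa>\<^esub> y = t \<otimes>\<^bsub>SU \<kappa>\<^esub> (x \<otimes>\<^bsub>SU \<kappa>\<^esub> z)"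
      using z x t car S.m_assoc comm by metis
    ultimately show "x \<otimes>\<^bsub>L_ring \<kappa>\<^esub> y \<in> hL \<kappa>" "y \<otimes>\<^bsub>L_ring \<kappa>\<^esub> x \<in> hL \<kappa>"
      using sub(6) z x by (auto simp: hL L_ring_def)
  qed
qed

lemma ring_E_kappa: "ring (E_kappa \<kappa>)"
  unfolding E_kappa_def by (rule ideal.quotient_is_ring[OF ideal_hL])

definition limit :: "real \<Rightarrow> free_alg set \<Rightarrow> free_alg set set"
  where "limit \<kappa> x = hL \<kappa> +>\<^bsub>L_ring \<kappa>\<^esub> x"

definition contraction :: "real \<Rightarrow> free_alg set set \<Rightarrow> free_alg set set set"
  where "contraction \<kappa> I = limit \<kappa> ` (I \<inter> lattice_L \<kappa>)"

definition a0 :: "real \<Rightarrow> free_alg set set"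
  where "a0 \<kappa> = limit \<kappa> (SU_class \<kappa> (elem_a \<kappa>))"
definition a0' :: "real \<Rightarrow> free_alg set set"
  where "a0' \<kappa> = limit \<kappa> (SU_class \<kappa> (adj (elem_a \<kappa>)))"
definition w0 :: "real \<Rightarrow> free_alg set set"
  where "w0 \<kappa> = limit \<kappa> (SU_class \<kappa> (elem_w \<kappa>))"
definition w0' :: "real \<Rightarrow> free_alg set set"
  where "w0' \<kappa> = limit \<kappa> (SU_class \<kappa> (adj (elem_w \<kappa>)))"

definition scalar0 :: "real \<Rightarrow> complex \<Rightarrow> free_alg set set"
  where "scalar0 \<kappa> c = limit \<kappa> (SU_class \<kappa> (const (fls_const c)))"


section \<open>The right ideals\<close>

definition R_minus_generators :: "real \<Rightarrow> free_alg set"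
  where "R_minus_generators \<kappa> =
   (let m = const (mu \<kappa>);
        t = m\<^sup>2 * sigma + sigma' + const ((1 + mu \<kappa> ^ 4) / mu \<kappa>)
    in { rho\<^sup>2,
         rho * (sigma - sigma'),
         sigma\<^sup>2 + m\<^sup>2 * sigma'\<^sup>2 + (1 + m\<^sup>2)\<^sup>2 * rho * rho' - (1 + m\<^sup>2),
         rho'\<^sup>2,
         rho' * (sigma - sigma'),
         t * rho,
         t * rho',
         t * (sigma - sigma'),
         t * (m\<^sup>2 * sigma + sigma' - (1 + m\<^sup>2)) })"

definition R_minus :: "real \<Rightarrow> free_alg set set"
  where "R_minus \<kappa> = gen_right_ideal (SU \<kappa>) (SU_class \<kappa> ` R_minus_generators \<kappa>)"

context
  fixes E :: "('e, 'm) ring_scheme" (structure)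
begin

text \<open>Here \<open>s\<close> embeds the complex scalars into \<open>E\<close>.\<close>

definition limit_generators ::
  "(complex \<Rightarrow> 'e) \<Rightarrow> real \<Rightarrow> 'e \<Rightarrow> 'e \<Rightarrow> 'e \<Rightarrow> 'e \<Rightarrow> 'e set"
  where "limit_generators s \<kappa> a a' w w' =
    { a \<otimes> a \<oplus> a \<ominus> a' \<ominus> \<one>,
      a' \<otimes> a' \<oplus> a' \<ominus> a \<ominus> \<one>,
      (a \<oplus> \<one>) \<otimes> w,
      (a' \<oplus> \<one>) \<otimes> w,
      (a \<oplus> \<one>) \<otimes> w',
      (a' \<oplus> \<one>) \<otimes> w',
      w \<otimes> w \<ominus> s (1 / \<kappa>) \<otimes> w,
      w' \<otimes> w' \<oplus> s (1 / \<kappa>) \<otimes> w',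
      w \<otimes> w' \<ominus> s (1 / \<kappa>) \<otimes> w \<ominus> s (1 / \<kappa>\<^sup>2) \<otimes> (a' \<ominus> \<one>) }"

end

end

theory Submission
  imports Defs "HOL-Library.Product_Plus"
begin

text \<open>
  Write \<open>q\<close> for \<open>\<mu>\<close> and work over the field of Laurent series in \<open>h\<close>. The quotient of the
  quantum group by the right ideal \<open>R\<^sub>-\<close> has the five classes of
  \<open>1, \<sigma>, \<sigma>\<^sup>*, \<rho>, \<rho>\<^sup>*\<close> as a basis. This is shown by making the five-dimensional space into
  a right module: \<open>act\<close> gives the action of the four letters, \<open>act_relations\<close> says that it respects
  the relations of the quantum group, and \<open>R_minus_eq_kernel\<close> says that \<open>R\<^sub>-\<close> is exactly the
  annihilator of the first basis vector \<open>e\<close>. One inclusion evaluates the nine generators on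
  \<open>e\<close>; the other one uses that every product of two letters is a linear combination of the basis
  modulo \<open>R\<^sub>-\<close> (\<open>R_minus_products\<close>).

  The contraction needs a lattice. Put \<open>S = (\<sigma> - \<sigma>\<^sup>*)/(q - 1)\<close> and
  \<open>P = (\<rho> + \<rho>\<^sup>*)/(q - 1)\<close>. As \<open>(q - 1)/h\<close> is an invertible power series, the lattice
  \<open>L\<close> is also generated over the power series by \<open>\<sigma>, \<rho>, S, P\<close>
  (\<open>elem_lattice_elem\<close>, \<open>lattice_gen_lift_L\<close>). In the basis
  \<open>1, \<sigma>, \<rho>, S, P\<close> these generators act by matrices with power series entries
  (\<open>act_lattice_vec\<close>, \<open>lattice_act_series_ring\<close>), so \<open>x \<mapsto> e x\<close> maps \<open>L\<close>
  onto the vectors with power series entries. Let \<open>\<theta>(x)\<close> be the vector of constant terms of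
  \<open>e x\<close> in this basis. If \<open>\<theta>(x) = 0\<close>, then \<open>e x = h (e y)\<close> for some \<open>y\<close> in
  \<open>L\<close>, hence \<open>x - h y\<close> lies in \<open>R\<^sub>-\<close> and has the same limit as \<open>x\<close>. Thus the contraction
  consists of the limits of the kernel of \<open>\<theta>\<close>.

  It remains to identify this kernel with the right ideal \<open>J\<close> generated by the nine given elements.
  They lie in the kernel by evaluation (\<open>theta_generators\<close>). Conversely, the commutation relations
  of the limit (\<open>limit_relations\<close>) and the nine generators express every product of two
  elements of \<open>{\<sigma>, \<rho>, S, P}\<close> modulo \<open>J\<close> as a combination of
  \<open>1, \<sigma>, \<rho>, S, P\<close> (\<open>reduction_table\<close>). So every element of the limit is such a
  combination modulo \<open>J\<close>; as \<open>\<theta>\<close> is injective on these combinations, its kernel is contained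
  in \<open>J\<close> (\<open>lift_J_eq\<close>).

  All computations take place in the free algebra, and the quantum group and its limit are reached
  through the maps \<open>SU_class\<close> and \<open>limit_map\<close>.
\<close>

section \<open>A five-dimensional right module\<close>

text \<open>Coordinate vectors with respect to the basis \<open>1, \<sigma>, \<sigma>\<^sup>*, \<rho>, \<rho>\<^sup>*\<close>, or to the basis
  \<open>1, \<sigma>, \<rho>, S, P\<close> introduced below. The field is arbitrary: the action is needed over the
  Laurent series and, at \<open>q = 1\<close>, over the complex numbers.\<close>

type_synonym 'k vec5 = "'k \<times> 'k \<times> 'k \<times> 'k \<times> 'k"

fun scale :: "'k::field \<Rightarrow> 'k vec5 \<Rightarrow> 'k vec5" where
  "scale c (v0, v1, v2, v3, v4) = (c * v0, c * v1, c * v2, c * v3, c * v4)"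

lemma vec5_zero: "(0 :: 'k::field vec5) = (0, 0, 0, 0, 0)"
  by (simp add: zero_prod_def)

lemma scale_simps [simp]:
  "scale c (u + v) = scale c u + scale c v"
  "scale (c + e) v = scale c v + scale e v"
  "scale c (scale e v) = scale (c * e) v"
  "scale 1 v = v" "scale 0 v = 0" "scale c 0 = 0" "scale c (- v) = - scale c v"
  "scale c (u - v) = scale c u - scale c v"
  by (cases u; cases v; simp add: algebra_simps vec5_zero)+

text \<open>The next three vectors are the reductions of \<open>\<sigma>\<^sup>2\<close>, \<open>(\<sigma>\<^sup>*)\<^sup>2\<close> and
  \<open>\<rho>\<rho>\<^sup>*\<close> modulo \<open>R\<^sub>-\<close>. By the relations of the quantum group, the third, the
  eighth and the ninth generator of \<open>R\<^sub>-\<close> are linear equations for them.\<close>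

definition red_sq :: "'k::field \<Rightarrow> 'k vec5" where
  "red_sq q = scale (1 / (q * (1 - q + q^2)))
     (1 - q + q^2 - q^3 + q^4, - (1 - q + 2 * q^2 - 2 * q^3 + q^4), q, 0, 0)"

definition red_sq' :: "'k::field \<Rightarrow> 'k vec5" where
  "red_sq' q = scale (1 / (q * (1 - q + q^2)))
     (1 - q + q^2 - q^3 + q^4, q^3, - (1 - 2 * q + 2 * q^2 - q^3 + q^4), 0, 0)"

definition red_rr :: "'k::field \<Rightarrow> 'k vec5" where
  "red_rr q = scale ((1 - q) / (q * (1 - q + q^2))) (q - 1, 1, - q, 0, 0)"

text \<open>With a name \<open>i\<close> for the inverse of the common denominator, the identities below become
  polynomial identities modulo \<open>i q (1 - q + q\<^sup>2) = 1\<close>, which a Groebner basis decides. The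
  method has to be qualified, as there is another one of this name for the locales of rings.\<close>

lemma red_eq:
  fixes q :: "'k::field"
  assumes "q \<noteq> 0" "1 - q + q^2 \<noteq> 0" and "i = 1 / (q * (1 - q + q^2))"
  shows "i * (q * (1 - q + q^2)) = 1" "x / q = i * (1 - q + q^2) * x"
    "red_sq q = scale i (1 - q + q^2 - q^3 + q^4, - (1 - q + 2 * q^2 - 2 * q^3 + q^4), q, 0, 0)"
    "red_sq' q = scale i (1 - q + q^2 - q^3 + q^4, q^3, - (1 - 2 * q + 2 * q^2 - q^3 + q^4), 0, 0)"
    "red_rr q = scale ((1 - q) * i) (q - 1, 1, - q, 0, 0)"
  using assms(1,2) by (simp_all add: assms(3) red_sq_def red_sq'_def red_rr_def)

text \<open>The right action of the four letters on the quotient by \<open>R\<^sub>-\<close>: the coordinates of \<open>v l\<close>,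
  read off from the reductions of all products of two letters, such as
  \<open>\<rho>\<sigma> = - \<rho>\<close> and \<open>\<sigma>\<rho> = q \<rho>\<sigma> = - q \<rho>\<close>.\<close>

fun act :: "'k::field \<Rightarrow> letter \<Rightarrow> 'k vec5 \<Rightarrow> 'k vec5" where
  "act q Sig (v0, v1, v2, v3, v4) =
     scale v1 (red_sq q) + scale v2 ((1, 0, 0, 0, 0) - red_rr q) + (0, v0, 0, - v3, - v4)"
| "act q Sig_star (v0, v1, v2, v3, v4) =
     scale v1 ((1, 0, 0, 0, 0) - scale (q^2) (red_rr q)) + scale v2 (red_sq' q) + (0, 0, v0, - v3, - v4)"
| "act q Rho (v0, v1, v2, v3, v4) = scale v4 (red_rr q) + (0, 0, 0, v0 - q * v1 - v2 / q, 0)"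
| "act q Rho_star (v0, v1, v2, v3, v4) = scale v3 (red_rr q) + (0, 0, 0, 0, v0 - q * v1 - v2 / q)"

lemma act_linear:
  "act q l (u + v) = act q l u + act q l v" "act q l (scale c v) = scale c (act q l v)"
  "act q l 0 = 0"
  by (cases u; cases v; cases l; simp add: algebra_simps vec5_zero red_sq_def red_sq'_def red_rr_def
      diff_divide_distrib add_divide_distrib)+

lemma act_diff: "act q l (u - v) = act q l u - act q l v"
proof -
  have "act q l (u - v) + act q l v = act q l u"
    by (simp flip: act_linear(1))
  then show ?thesis by (simp add: eq_diff_eq)
qed

text \<open>The action satisfies the relations of the quantum group. A product \<open>x y\<close> acts by \<open>x\<close> first,
  so the order of the maps is reversed.\<close>

lemma act_relations:
  fixes q :: "'k::field"
  assumes "q \<noteq> 0" "1 - q + q^2 \<noteq> 0"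
  shows "act q Rho_star (act q Rho v) = act q Rho (act q Rho_star v)"
    "act q Rho (act q Sig v) = scale q (act q Sig (act q Rho v))"
    "act q Rho_star (act q Sig v) = scale q (act q Sig (act q Rho_star v))"
    "scale q (act q Rho (act q Sig_star v)) = act q Sig_star (act q Rho v)"
    "scale q (act q Rho_star (act q Sig_star v)) = act q Sig_star (act q Rho_star v)"
    "act q Sig_star (act q Sig v) + scale (q^2) (act q Rho_star (act q Rho v)) = v"
    "act q Sig (act q Sig_star v) + act q Rho_star (act q Rho v) = v"
proof -
  obtain v0 v1 v2 v3 v4 where v: "v = (v0, v1, v2, v3, v4)" by (cases v)
  define i where "i = 1 / (q * (1 - q + q^2))"
  note i = red_eq(1)[OF assms(1,2) i_def] and d = red_eq(3-5)[OF assms(1,2) i_def]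
  note r = red_eq(2)[OF assms(1,2) i_def]
  show "act q Rho_star (act q Rho v) = act q Rho (act q Rho_star v)"
    by (simp add: v d r zero_prod_def,
        (intro conjI)?; (use i in Groebner_Basis.algebra)?)
  show "act q Rho (act q Sig v) = scale q (act q Sig (act q Rho v))"
    by (simp add: v d r zero_prod_def,
        (intro conjI)?; (use i in Groebner_Basis.algebra)?)
  show "act q Rho_star (act q Sig v) = scale q (act q Sig (act q Rho_star v))"
    by (simp add: v d r zero_prod_def,
        (intro conjI)?; (use i in Groebner_Basis.algebra)?)
  show "scale q (act q Rho (act q Sig_star v)) = act q Sig_star (act q Rho v)"
    by (simp add: v d r zero_prod_def,
        (intro conjI)?; (use i in Groebner_Basis.algebra)?)
  show "scale q (act q Rho_star (act q Sig_star v)) = act q Sig_star (act q Rho_star v)"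
    by (simp add: v d r zero_prod_def,
        (intro conjI)?; (use i in Groebner_Basis.algebra)?)
  show "act q Sig_star (act q Sig v) + scale (q^2) (act q Rho_star (act q Rho v)) = v"
    by (simp add: v d r zero_prod_def,
        (intro conjI)?; (use i in Groebner_Basis.algebra)?)
  show "act q Sig (act q Sig_star v) + act q Rho_star (act q Rho v) = v"
    by (simp add: v d r zero_prod_def,
        (intro conjI)?; (use i in Groebner_Basis.algebra)?)
qed

text \<open>The nine generators of \<open>R\<^sub>-\<close> annihilate \<open>e\<close>; here \<open>t\<close> is \<open>e\<close> times the element
  \<open>t\<close> that occurs in four of them.\<close>

lemma act_R_minus_generators:
  fixes q :: "'k::field"
  assumes "q \<noteq> 0" "1 - q + q^2 \<noteq> 0"
  defines "e \<equiv> (1, 0, 0, 0, 0) :: 'k vec5"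
  defines "t \<equiv> scale (q^2) (act q Sig e) + act q Sig_star e + scale ((1 + q^4) / q) e"
  shows "act q Rho (act q Rho e) = 0" "act q Rho_star (act q Rho_star e) = 0"
    "act q Sig (act q Rho e) = act q Sig_star (act q Rho e)"
    "act q Sig (act q Rho_star e) = act q Sig_star (act q Rho_star e)"
    "act q Sig (act q Sig e) + scale (q^2) (act q Sig_star (act q Sig_star e))
      + scale ((1 + q^2)^2) (act q Rho_star (act q Rho e)) = scale (1 + q^2) e"
    "act q Rho t = 0" "act q Rho_star t = 0" "act q Sig t = act q Sig_star t"
    "scale (q^2) (act q Sig t) + act q Sig_star t = scale (1 + q^2) t"
proof -
  define i where "i = 1 / (q * (1 - q + q^2))"
  note i = red_eq(1)[OF assms(1,2) i_def] and d = red_eq(3-5)[OF assms(1,2) i_def]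
  note r = red_eq(2)[OF assms(1,2) i_def]
  show "act q Rho (act q Rho e) = 0" "act q Rho_star (act q Rho_star e) = 0"
    "act q Sig (act q Rho e) = act q Sig_star (act q Rho e)"
    "act q Sig (act q Rho_star e) = act q Sig_star (act q Rho_star e)"
    by (simp_all add: e_def d zero_prod_def)
  show "act q Sig (act q Sig e) + scale (q^2) (act q Sig_star (act q Sig_star e))
      + scale ((1 + q^2)^2) (act q Rho_star (act q Rho e)) = scale (1 + q^2) e"
    by (simp add: e_def d r zero_prod_def,
        (intro conjI)?; (use i in Groebner_Basis.algebra | simp add: algebra_simps power_numeral_reduce)?)
  show "act q Rho t = 0" "act q Rho_star t = 0"
    by (simp_all add: t_def e_def d r zero_prod_def;
        (use i in Groebner_Basis.algebra | simp add: algebra_simps power_numeral_reduce))+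
  show "act q Sig t = act q Sig_star t"
    by (simp add: t_def e_def d r zero_prod_def,
        (intro conjI)?; (use i in Groebner_Basis.algebra | simp add: algebra_simps power_numeral_reduce)?)
  show "scale (q^2) (act q Sig t) + act q Sig_star t = scale (1 + q^2) t"
    by (simp add: t_def e_def d r zero_prod_def,
        (intro conjI)?; (use i in Groebner_Basis.algebra | simp add: algebra_simps power_numeral_reduce)?)
qed

section \<open>Right ideals\<close>

lemma right_idealI:
  assumes "ring R" "I \<subseteq> carrier R" "\<zero>\<^bsub>R\<^esub> \<in> I"
    and "\<And>x y. x \<in> I \<Longrightarrow> y \<in> I \<Longrightarrow> x \<oplus>\<^bsub>R\<^esub> y \<in> I"
    and "\<And>x r. x \<in> I \<Longrightarrow> r \<in> carrier R \<Longrightarrow> x \<otimes>\<^bsub>R\<^esub> r \<in> I"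
  shows "right_ideal I R"
proof -
  interpret ring R by fact
  have "\<ominus>\<^bsub>R\<^esub> x \<in> I" if "x \<in> I" for x
  proof -
    have "x \<otimes>\<^bsub>R\<^esub> (\<ominus>\<^bsub>R\<^esub> \<one>\<^bsub>R\<^esub>) \<in> I" using assms(5)[OF that] by simp
    then show ?thesis using assms(2) that r_minus[of x "\<one>\<^bsub>R\<^esub>"] by auto
  qed
  then have "subgroup I (add_monoid R)"
    using assms by (intro add.subgroupI) auto
  then show ?thesis
    using assms(5) by (simp add: right_ideal_def additive_subgroup_def)
qed

lemma right_idealD:
  assumes "right_ideal I R"
  shows "I \<subseteq> carrier R" "\<zero>\<^bsub>R\<^esub> \<in> I"
    "\<And>x y. x \<in> I \<Longrightarrow> y \<in> I \<Longrightarrow> x \<oplus>\<^bsub>R\<^esub> y \<in> I"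
    "\<And>x r. x \<in> I \<Longrightarrow> r \<in> carrier R \<Longrightarrow> x \<otimes>\<^bsub>R\<^esub> r \<in> I"
  using assms additive_subgroup.a_subset additive_subgroup.zero_closed additive_subgroup.a_closed
  unfolding right_ideal_def by metis+

lemma gen_right_ideal_minimal: "right_ideal I R \<Longrightarrow> S \<subseteq> I \<Longrightarrow> gen_right_ideal R S \<subseteq> I"
  unfolding gen_right_ideal_def by blast

lemma gen_right_ideal_incl: "S \<subseteq> gen_right_ideal R S"
  unfolding gen_right_ideal_def by blast

lemma right_ideal_gen_right_ideal:
  assumes "ring R" "S \<subseteq> carrier R"
  shows "right_ideal (gen_right_ideal R S) R"
proof (rule right_idealI)
  have "right_ideal (carrier R) R"
    using assms(1) by (intro right_idealI) (auto simp: ring.ring_simprules)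
  then show "gen_right_ideal R S \<subseteq> carrier R"
    using assms(2) by (rule gen_right_ideal_minimal)
qed (auto simp: gen_right_ideal_def assms right_idealD)

section \<open>The free algebra\<close>

lemma free_ring_simps [simp]:
  "carrier (free_ring :: free_alg ring) = UNIV"
  "x \<otimes>\<^bsub>free_ring\<^esub> y = x * y" "x \<oplus>\<^bsub>free_ring\<^esub> y = x + y"
  "\<one>\<^bsub>free_ring\<^esub> = (1 :: free_alg)" "\<zero>\<^bsub>free_ring\<^esub> = (0 :: free_alg)"
  for x y :: free_alg
  by (simp_all add: ring_of_type_algebra_def)

lemma const_simps:
  "const (c + d) = const c + const d" "const (c * d) = const c * const d"
  "const (- c) = - const c" "const (c - d) = const c - const d" "const (c ^ n) = const c ^ n"
  "const 0 = 0" "const 1 = 1" "const (numeral k) = numeral k"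
proof -
  show add: "const (c + d) = const c + const d" for c d
    by (simp add: const_def single_add)
  show zero: "const 0 = 0" by (simp add: const_def)
  show neg: "const (- c) = - const c" for c
    using add[of c "- c"] zero by (simp add: minus_unique)
  show "const (c - d) = const c - const d"
    using add[of c "- d"] neg by simp
  show one: "const 1 = 1" by (simp add: const_def)
  show mult: "const (c * d) = const c * const d" for c d
    by (simp add: const_def mult_single)
  show "const (c ^ n) = const c ^ n"
    by (induction n) (simp_all add: one mult)
  show "const (numeral k) = numeral k"
    by (simp add: const_def single_numeral)
qed

lemma const_inverse: "c \<noteq> 0 \<Longrightarrow> const (1 / c) * const c = 1"
  by (simp flip: const_simps)

lemma gen_const:
  "gen l * const c = const c * gen l" "gen l * (const c * x) = const c * (gen l * x)"
proof -
  show "gen l * const c = const c * gen l" by (rule const_commute[symmetric])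
  then show "gen l * (const c * x) = const c * (gen l * x)" by (simp flip: mult.assoc)
qed

text \<open>Induction by appending letters on the right, which suits right modules.\<close>

lemma free_alg_induct [case_names const mult_gen add]:
  assumes "\<And>c. P (const c)" "\<And>p l. P p \<Longrightarrow> P (p * gen l)" "\<And>p q. P p \<Longrightarrow> P q \<Longrightarrow> P (p + q)"
  shows "P p"
proof -
  have single: "P (Poly_Mapping.single (Word ls) c)" for ls c
  proof (induction ls rule: rev_induct)
    case Nil
    then show ?case using assms(1)[of c] by (simp add: const_def zero_word_def)
  next
    case (snoc l ls)
    have "Poly_Mapping.single (Word (ls @ [l])) c = Poly_Mapping.single (Word ls) c * gen l"
      by (simp add: gen_def mult_single plus_word_def)
    then show ?case using assms(2)[OF snoc] by simp
  qed
  have "P (\<Sum>u\<in>S. Poly_Mapping.single u (Poly_Mapping.lookup p u))" if "finite S" for S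
    using that
  proof induction
    case empty
    show ?case using assms(1)[of 0] by (simp add: const_simps)
  next
    case (insert u S)
    then show ?case using assms(3) single[of "letters u"] by simp
  qed
  then show ?thesis
    using free_alg_expand[of p] by (metis finite_keys)
qed

lemma adj_simps:
  "adj (gen l) = gen (letter_adj l)" "adj (const c) = const (fls_conj c)"
  "adj 1 = 1" "adj (- x) = - adj x" "adj (x - y) = adj x - adj y" "adj (x\<^sup>2) = (adj x)\<^sup>2"
proof -
  show "adj (gen l) = gen (letter_adj l)"
    by (simp add: gen_def adj_single word_adj_def fls_conj_simps)
  show "adj (const c) = const (fls_conj c)" for c
    by (simp add: const_def adj_single word_adj_simps)
  from this[of 1] show "adj 1 = 1" by (simp add: const_simps fls_conj_simps)
  show neg: "adj (- x) = - adj x" for x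
    using adj_add[of x "- x"] by (simp add: minus_unique)
  show "adj (x - y) = adj x - adj y"
    using adj_add[of x "- y"] neg by simp
  show "adj (x\<^sup>2) = (adj x)\<^sup>2"
    by (simp add: power2_eq_square adj_mult)
qed

lemma fls_conj_mu: "fls_conj (mu \<kappa>) = mu \<kappa>"
  by (simp add: fls_eq_iff mu_def)

section \<open>The module as a right module over the free algebra\<close>

text \<open>The vector \<open>v p\<close> for an element \<open>p\<close> of the free algebra: the linear extension of the action
  of words, which are read from the left to the right.\<close>

definition module_act :: "complex fls \<Rightarrow> complex fls vec5 \<Rightarrow> free_alg \<Rightarrow> complex fls vec5" where
  "module_act q v p =
    (\<Sum>w\<in>Poly_Mapping.keys p. scale (Poly_Mapping.lookup p w) (fold (act q) (letters w) v))"

lemma module_act_superset: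
  assumes "finite S" "Poly_Mapping.keys p \<subseteq> S"
  shows "module_act q v p = (\<Sum>w\<in>S. scale (Poly_Mapping.lookup p w) (fold (act q) (letters w) v))"
  unfolding module_act_def using assms
  by (intro sum.mono_neutral_left) (auto simp: in_keys_iff)

lemma module_act_add: "module_act q v (x + y) = module_act q v x + module_act q v y"
proof -
  let ?S = "Poly_Mapping.keys x \<union> Poly_Mapping.keys y"
  have "Poly_Mapping.keys (x + y) \<subseteq> ?S" by (rule Poly_Mapping.keys_add)
  then show ?thesis
    by (simp add: module_act_superset[of ?S] lookup_add sum.distrib)
qed

lemma module_act_single:
  "module_act q v (Poly_Mapping.single w c) = scale c (fold (act q) (letters w) v)"
  by (subst module_act_superset[of "{w}"]) auto

lemma module_act_mult_gen: "module_act q v (x * gen l) = act q l (module_act q v x)"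
proof -
  have *: "module_act q v (Poly_Mapping.single w c * gen l) =
      act q l (module_act q v (Poly_Mapping.single w c))" for w c
    by (simp add: gen_def mult_single module_act_single plus_word_def act_linear)
  have zero: "module_act q v 0 = 0" by (simp add: module_act_def)
  have "module_act q v ((\<Sum>u\<in>S. Poly_Mapping.single u (Poly_Mapping.lookup x u)) * gen l) =
      act q l (module_act q v (\<Sum>u\<in>S. Poly_Mapping.single u (Poly_Mapping.lookup x u)))"
    if "finite S" for S
    using that by induction (simp_all add: zero act_linear module_act_add * distrib_right)
  then show ?thesis
    using free_alg_expand[of x] by (metis finite_keys)
qed

lemma module_act_const: "module_act q v (const c) = scale c v"
  by (simp add: const_def module_act_single zero_word_def)

lemma module_act_mult_const: "module_act q v (x * const c) = scale c (module_act q v x)"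
proof (induction x rule: free_alg_induct)
  case (const d)
  then show ?case by (simp add: module_act_const mult.commute flip: const_simps)
next
  case (mult_gen p l)
  have "p * gen l * const c = p * const c * gen l" by (simp add: gen_const mult.assoc)
  then show ?case using mult_gen by (simp add: module_act_mult_gen act_linear)
next
  case (add p q)
  then show ?case by (simp add: module_act_add distrib_right)
qed

lemma module_act_mult: "module_act q v (x * y) = module_act q (module_act q v x) y"
  by (induction y rule: free_alg_induct)
    (simp_all add: module_act_mult_gen module_act_mult_const module_act_const module_act_add
      distrib_left flip: mult.assoc)

lemma module_act_minus: "module_act q v (- x) = - module_act q v x"
  using module_act_add[of q v x "- x"] module_act_add[of q v 0 0] by (simp add: minus_unique)

lemma module_act_simps:
  "module_act q v (gen l) = act q l v" "module_act q v 1 = v" "module_act q v 0 = 0"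
  "module_act q v (x - y) = module_act q v x - module_act q v y"
  "module_act q v (const c * x) = scale c (module_act q v x)"
proof -
  show one: "module_act q v 1 = v" using module_act_const[of q v 1] by (simp add: const_simps)
  show "module_act q v (gen l) = act q l v" using module_act_mult_gen[of q v 1] one by simp
  show "module_act q v 0 = 0" using module_act_const[of q v 0] by (simp add: const_simps)
  show "module_act q v (x - y) = module_act q v x - module_act q v y"
    using module_act_add[of q v x "- y"] by (simp add: module_act_minus)
  show "module_act q v (const c * x) = scale c (module_act q v x)"
    by (simp add: const_commute module_act_mult_const)
qed

lemma module_act_linear:
  "module_act q (u + v) x = module_act q u x + module_act q v x"
  "module_act q (scale c v) x = scale c (module_act q v x)"
  "module_act q 0 x = 0"
proof -
  show "module_act q (u + v) x = module_act q u x + module_act q v x"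
    by (induction x rule: free_alg_induct)
      (simp_all add: module_act_const module_act_mult_gen module_act_add act_linear)
  show *: "module_act q (scale c v) x = scale c (module_act q v x)" for c v
    by (induction x rule: free_alg_induct)
      (simp_all add: module_act_const module_act_mult_gen module_act_add act_linear mult.commute)
  show "module_act q 0 x = 0" using *[of 0 0] by simp
qed

section \<open>Relations of the quantum group\<close>

lemma SU_ideal_closed:
  "0 \<in> SU_ideal \<kappa>" "x \<in> SU_ideal \<kappa> \<Longrightarrow> y \<in> SU_ideal \<kappa> \<Longrightarrow> x + y \<in> SU_ideal \<kappa>"
  "x \<in> SU_ideal \<kappa> \<Longrightarrow> z * x \<in> SU_ideal \<kappa>" "x \<in> SU_ideal \<kappa> \<Longrightarrow> x * z \<in> SU_ideal \<kappa>"
proof -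
  interpret ideal "SU_ideal \<kappa>" free_ring by (rule ideal_SU_ideal)
  show "0 \<in> SU_ideal \<kappa>" using additive_subgroup.zero_closed[OF ideal.axioms(1)[OF ideal_SU_ideal]] by simp
  show "x + y \<in> SU_ideal \<kappa>" if "x \<in> SU_ideal \<kappa>" "y \<in> SU_ideal \<kappa>"
    using additive_subgroup.a_closed[OF ideal.axioms(1)[OF ideal_SU_ideal] that] by simp
  show "z * x \<in> SU_ideal \<kappa>" if "x \<in> SU_ideal \<kappa>" using I_l_closed[OF that, of z] by simp
  show "x * z \<in> SU_ideal \<kappa>" if "x \<in> SU_ideal \<kappa>" using I_r_closed[OF that, of z] by simp
qed

lemma SU_ideal_diff: "x \<in> SU_ideal \<kappa> \<Longrightarrow> y \<in> SU_ideal \<kappa> \<Longrightarrow> x - y \<in> SU_ideal \<kappa>"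
  using SU_ideal_closed(2)[of x \<kappa> "- 1 * y"] SU_ideal_closed(3)[of y \<kappa> "- 1"] by simp

lemma SU_ideal_minimal:
  assumes "SU_relations \<kappa> \<union> adj ` SU_relations \<kappa> \<subseteq> K" "0 \<in> K"
    "\<And>x y. x \<in> K \<Longrightarrow> y \<in> K \<Longrightarrow> x + y \<in> K"
    "\<And>x z. x \<in> K \<Longrightarrow> z * x \<in> K" "\<And>x z. x \<in> K \<Longrightarrow> x * z \<in> K"
  shows "SU_ideal \<kappa> \<subseteq> K"
proof -
  interpret ring "free_ring :: free_alg ring" by (rule ring_free_ring)
  have "right_ideal K free_ring"
    by (rule right_idealI[OF ring_free_ring]) (use assms in auto)
  then have "ideal K free_ring"
    by (intro idealI[OF ring_free_ring])
      (use assms in \<open>auto simp: right_ideal_def additive_subgroup_def\<close>)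
  then show ?thesis
    unfolding SU_ideal_def using assms(1) by (rule genideal_minimal)
qed

lemma SU_class_eq_iff: "SU_class \<kappa> x = SU_class \<kappa> y \<longleftrightarrow> x - y \<in> SU_ideal \<kappa>"
proof -
  interpret ideal "SU_ideal \<kappa>" free_ring by (rule ideal_SU_ideal)
  have "SU_class \<kappa> x = SU_class \<kappa> y \<longleftrightarrow> x \<ominus>\<^bsub>free_ring\<^esub> y \<in> SU_ideal \<kappa>"
    unfolding SU_class_def by (rule quotient_eq_iff_same_a_r_cos[symmetric]) (rule ideal_SU_ideal, auto)
  then show ?thesis by (simp add: a_minus_def free_ring_inv)
qed

lemma SU_class_0: "SU_class \<kappa> 0 = \<zero>\<^bsub>SU \<kappa>\<^esub>"
  using ring_hom_zero[OF SU_class_hom ring_free_ring ring_SU, of \<kappa>] by simp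

lemma SU_ideal_half: "x + x \<in> SU_ideal \<kappa> \<Longrightarrow> x \<in> SU_ideal \<kappa>"
proof -
  assume "x + x \<in> SU_ideal \<kappa>"
  then have "const (1 / 2) * (x + x) \<in> SU_ideal \<kappa>" by (rule SU_ideal_closed)
  moreover have "const (1 / 2) * (x + x) = const (1 / 2) * const 2 * x"
    by (simp only: const_simps) (simp add: mult.assoc mult_2)
  ultimately show ?thesis using const_inverse[of 2] by simp
qed

text \<open>The relations and their adjoints, solved for the single products: the sum and the difference of
  the second and third relation are twice the commutation rules for \<open>\<rho>\<close> and \<open>\<rho>\<^sup>*\<close> with
  \<open>\<sigma>\<close>.\<close>

lemma SU_relations_mem:
  "gen Rho * gen Rho_star - gen Rho_star * gen Rho \<in> SU_ideal \<kappa>"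
  "const (mu \<kappa>) * (gen Rho * gen Sig) - gen Sig * gen Rho \<in> SU_ideal \<kappa>"
  "const (mu \<kappa>) * (gen Rho_star * gen Sig) - gen Sig * gen Rho_star \<in> SU_ideal \<kappa>"
  "const (mu \<kappa>) * (gen Sig_star * gen Rho) - gen Rho * gen Sig_star \<in> SU_ideal \<kappa>"
  "const (mu \<kappa>) * (gen Sig_star * gen Rho_star) - gen Rho_star * gen Sig_star \<in> SU_ideal \<kappa>"
  "gen Sig * gen Sig_star + (const (mu \<kappa>))\<^sup>2 * (gen Rho * gen Rho_star) - 1 \<in> SU_ideal \<kappa>"
  "gen Sig_star * gen Sig + gen Rho * gen Rho_star - 1 \<in> SU_ideal \<kappa>"
proof -
  let ?s = "gen Sig" and ?s' = "gen Sig_star" and ?r = "gen Rho" and ?r' = "gen Rho_star"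
  have sub: "SU_relations \<kappa> \<union> adj ` SU_relations \<kappa> \<subseteq> SU_ideal \<kappa>"
    unfolding SU_ideal_def by (rule ring.genideal_self[OF ring_free_ring]) simp
  have 1: "?r * ?r' - ?r' * ?r \<in> SU_ideal \<kappa>" "const (mu \<kappa>) * (?r - ?r') * ?s - ?s * (?r - ?r') \<in> SU_ideal \<kappa>"
    "const (mu \<kappa>) * (?r + ?r') * ?s - ?s * (?r + ?r') \<in> SU_ideal \<kappa>"
    "?s * ?s' + (const (mu \<kappa>))\<^sup>2 * ?r * ?r' - 1 \<in> SU_ideal \<kappa>" "?s' * ?s + ?r * ?r' - 1 \<in> SU_ideal \<kappa>"
    using sub by (simp_all add: SU_relations_def Let_def adj_simps)
  then show "?r * ?r' - ?r' * ?r \<in> SU_ideal \<kappa>"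
    "?s * ?s' + (const (mu \<kappa>))\<^sup>2 * (?r * ?r') - 1 \<in> SU_ideal \<kappa>"
    "?s' * ?s + ?r * ?r' - 1 \<in> SU_ideal \<kappa>"
    by (simp_all add: mult.assoc)
  have 2: "?s' * ((?r' - ?r) * const (mu \<kappa>)) - (?r' - ?r) * ?s' \<in> SU_ideal \<kappa>"
    "?s' * ((?r' + ?r) * const (mu \<kappa>)) - (?r' + ?r) * ?s' \<in> SU_ideal \<kappa>"
    using sub by (simp_all add: SU_relations_def Let_def adj_simps adj_add adj_mult fls_conj_mu)
  show "const (mu \<kappa>) * (?r * ?s) - ?s * ?r \<in> SU_ideal \<kappa>"
    by (rule SU_ideal_half, use SU_ideal_closed(2)[OF 1(2,3)] in \<open>simp add: algebra_simps\<close>)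
  show "const (mu \<kappa>) * (?r' * ?s) - ?s * ?r' \<in> SU_ideal \<kappa>"
    by (rule SU_ideal_half, use SU_ideal_diff[OF 1(3,2)] in \<open>simp add: algebra_simps\<close>)
  show "const (mu \<kappa>) * (?s' * ?r) - ?r * ?s' \<in> SU_ideal \<kappa>"
    by (rule SU_ideal_half, use SU_ideal_diff[OF 2(2,1)] in \<open>simp add: algebra_simps gen_const\<close>)
  show "const (mu \<kappa>) * (?s' * ?r') - ?r' * ?s' \<in> SU_ideal \<kappa>"
    by (rule SU_ideal_half, use SU_ideal_closed(2)[OF 2] in \<open>simp add: algebra_simps gen_const\<close>)
qed

lemma mu_nth [simp]: "fls_nth (mu \<kappa>) 0 = 1"
  by (simp add: mu_def)

text \<open>All these polynomials in \<open>\<mu>\<close> have a nonzero constant term, as \<open>\<mu> = 1\<close> at \<open>h = 0\<close>.\<close>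

lemma mu_poly_nonzero:
  "mu \<kappa> \<noteq> 0" "1 - mu \<kappa> + (mu \<kappa>)\<^sup>2 \<noteq> 0" "1 + (mu \<kappa>)\<^sup>2 \<noteq> 0" "1 + mu \<kappa> ^ 4 \<noteq> 0"
  "1 + mu \<kappa> + (mu \<kappa>)\<^sup>2 \<noteq> 0"
  unfolding mu_def fps_to_fls_power[symmetric] fps_one_to_fls[symmetric] fps_to_fls_plus[symmetric] fps_to_fls_minus[symmetric]
  by (simp_all only: fps_to_fls_eq_0_iff, auto simp: fps_eq_iff power2_eq_square power4_eq_xxxx intro!: exI[of _ 0])

lemma mu_neq_1: "\<kappa> \<noteq> 0 \<Longrightarrow> mu \<kappa> \<noteq> 1"
proof
  assume "\<kappa> \<noteq> 0" "mu \<kappa> = 1"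
  then have "fls_nth (mu \<kappa>) 1 = 0" by simp
  then show False using \<open>\<kappa> \<noteq> 0\<close> by (simp add: mu_def)
qed

lemma SU_ideal_acts_zero:
  assumes "x \<in> SU_ideal \<kappa>"
  shows "module_act (mu \<kappa>) v x = 0"
proof -
  let ?K = "{x. \<forall>v. module_act (mu \<kappa>) v x = 0}"
  note rel = act_relations[OF mu_poly_nonzero(1,2)[of \<kappa>]]
  note solved = rel(1-3) rel(4,5)[symmetric] rel(6,7)[folded eq_diff_eq]
  note eval = adj_simps adj_add adj_mult fls_conj_mu module_act_simps module_act_mult module_act_add
    module_act_const act_linear act_diff power2_eq_square
  have "module_act (mu \<kappa>) v x = 0" if "x \<in> SU_relations \<kappa>" for x v
    using that unfolding SU_relations_def Let_def by (auto simp: eval solved)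
  moreover have "module_act (mu \<kappa>) v (adj x) = 0" if "x \<in> SU_relations \<kappa>" for x v
    using that unfolding SU_relations_def Let_def by (auto simp: eval solved)
  ultimately have "SU_ideal \<kappa> \<subseteq> ?K"
    by (intro SU_ideal_minimal) (auto simp: module_act_simps module_act_mult module_act_add
        module_act_linear simp del: split_paired_All)
  then show ?thesis using assms by blast
qed

section \<open>The right ideal as the annihilator of a vector\<close>

text \<open>The element of the free algebra with the given coordinates.\<close>

fun lin :: "complex fls vec5 \<Rightarrow> free_alg" where
  "lin (v0, v1, v2, v3, v4) = const v0 + const v1 * gen Sig + const v2 * gen Sig_star
     + const v3 * gen Rho + const v4 * gen Rho_star"

lemma lin_linear:
  "lin (u + v) = lin u + lin v" "lin (scale c v) = const c * lin v" "lin (- v) = - lin v"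
  "lin (u - v) = lin u - lin v"
proof -
  obtain u0 u1 u2 u3 u4 v0 v1 v2 v3 v4 where uv: "u = (u0, u1, u2, u3, u4)" "v = (v0, v1, v2, v3, v4)"
    by (cases u, cases v)
  show "lin (u + v) = lin u + lin v"  by (simp add: uv const_simps distrib_right)
  show "lin (scale c v) = const c * lin v" by (simp add: uv const_simps distrib_left mult.assoc)
  show "lin (- v) = - lin v" by (simp add: uv const_simps)
  show "lin (u - v) = lin u - lin v" by (simp add: uv const_simps left_diff_distrib)
qed

text \<open>The preimage of \<open>R\<^sub>-\<close> in the free algebra.\<close>

definition lift_R :: "real \<Rightarrow> free_alg set" where
  "lift_R \<kappa> = {x. SU_class \<kappa> x \<in> R_minus \<kappa>}"

lemma right_ideal_R_minus: "right_ideal (R_minus \<kappa>) (SU \<kappa>)"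
  unfolding R_minus_def
  by (rule right_ideal_gen_right_ideal[OF ring_SU]) (auto simp: SU_class_simps)

lemma lift_R_closed:
  "x \<in> SU_ideal \<kappa> \<Longrightarrow> x \<in> lift_R \<kappa>" "x \<in> R_minus_generators \<kappa> \<Longrightarrow> x \<in> lift_R \<kappa>"
  "x \<in> lift_R \<kappa> \<Longrightarrow> y \<in> lift_R \<kappa> \<Longrightarrow> x + y \<in> lift_R \<kappa>"
  "x \<in> lift_R \<kappa> \<Longrightarrow> x * z \<in> lift_R \<kappa>"
  "x \<in> lift_R \<kappa> \<Longrightarrow> const c * x \<in> lift_R \<kappa>"
proof -
  note I = right_idealD[OF right_ideal_R_minus[of \<kappa>]]
  show mult: "x * z \<in> lift_R \<kappa>" if "x \<in> lift_R \<kappa>" for z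
    using that I(4) by (simp add: lift_R_def SU_class_simps)
  then show "const c * x \<in> lift_R \<kappa>" if "x \<in> lift_R \<kappa>"
    using that by (simp add: const_commute)
  show "x + y \<in> lift_R \<kappa>" if "x \<in> lift_R \<kappa>" "y \<in> lift_R \<kappa>"
    using that I(3) by (simp add: lift_R_def SU_class_simps)
  show "x \<in> lift_R \<kappa>" if "x \<in> SU_ideal \<kappa>"
  proof -
    have "SU_class \<kappa> x = SU_class \<kappa> 0" using that by (simp add: SU_class_eq_iff)
    then show ?thesis using I(2) by (simp add: lift_R_def SU_class_0)
  qed
  show "x \<in> lift_R \<kappa>" if "x \<in> R_minus_generators \<kappa>"
    unfolding lift_R_def R_minus_def mem_Collect_eq
    by (rule subsetD[OF gen_right_ideal_incl]) (rule imageI[OF that])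
qed

lemma lift_R_diff: "x \<in> lift_R \<kappa> \<Longrightarrow> y \<in> lift_R \<kappa> \<Longrightarrow> x - y \<in> lift_R \<kappa>"
  using lift_R_closed(3)[of x \<kappa> "const (- 1) * y"] lift_R_closed(5)[of y \<kappa> "- 1"]
  by (simp add: const_simps)

lemma lift_R_cancel:
  assumes "const c * x \<in> lift_R \<kappa>" "c \<noteq> 0"
  shows "x \<in> lift_R \<kappa>"
  using lift_R_closed(5)[OF assms(1), of "1 / c"] const_inverse[OF assms(2)]
  by (simp flip: mult.assoc)

text \<open>The essential products of two letters are linear modulo \<open>R\<^sub>-\<close>. With the element \<open>t\<close> of the
  generators, \<open>R\<^sub>-\<close> contains \<open>t\<rho>\<close>, \<open>t\<rho>\<^sup>*\<close> and, as
  \<open>(\<sigma> - \<sigma>\<^sup>*) + (\<mu>\<^sup>2\<sigma> + \<sigma>\<^sup>* - (1 + \<mu>\<^sup>2)) = (1 + \<mu>\<^sup>2)(\<sigma> - 1)\<close>, also \<open>t(\<sigma> - 1)\<close> and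
  \<open>t(\<sigma>\<^sup>* - 1)\<close>. The first two give \<open>\<rho>\<sigma> = - \<rho>\<close> and
  \<open>\<rho>\<^sup>*\<sigma> = - \<rho>\<^sup>*\<close>. The last two and the third generator are three linear equations for
  \<open>\<sigma>\<^sup>2\<close>, \<open>(\<sigma>\<^sup>*)\<^sup>2\<close> and \<open>\<rho>\<rho>\<^sup>*\<close>.\<close>

lemma R_minus_products:
  "gen Rho * gen Sig + gen Rho \<in> lift_R \<kappa>" "gen Rho_star * gen Sig + gen Rho_star \<in> lift_R \<kappa>"
  "gen Rho * gen Sig_star + gen Rho \<in> lift_R \<kappa>" "gen Rho_star * gen Sig_star + gen Rho_star \<in> lift_R \<kappa>"
  "gen Rho * gen Rho \<in> lift_R \<kappa>" "gen Rho_star * gen Rho_star \<in> lift_R \<kappa>"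
  "gen Rho * gen Rho_star - lin (red_rr (mu \<kappa>)) \<in> lift_R \<kappa>"
  "gen Sig * gen Sig - lin (red_sq (mu \<kappa>)) \<in> lift_R \<kappa>"
  "gen Sig_star * gen Sig_star - lin (red_sq' (mu \<kappa>)) \<in> lift_R \<kappa>"
proof -
  let ?s = "gen Sig" and ?s' = "gen Sig_star" and ?r = "gen Rho" and ?r' = "gen Rho_star"
  define q where "q = mu \<kappa>"
  define M where "M = const q"
  have comm: "gen l * M = M * gen l" "gen l * (M * x) = M * (gen l * x)" for l x
    by (simp_all add: M_def gen_const)
  define t where "t = M\<^sup>2 * ?s + ?s' + const ((1 + q ^ 4) / q)"
  note nz = mu_poly_nonzero[of \<kappa>, folded q_def]
  have tM: "M * t = M^3 * ?s + M * ?s' + (1 + M^4)"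
  proof -
    have "M * const ((1 + q ^ 4) / q) = 1 + M^4"
      using nz(1) by (simp add: M_def flip: const_simps)
    then show ?thesis by (simp add: t_def algebra_simps power_numeral_reduce)
  qed
  note N = SU_relations_mem[of \<kappa>, folded q_def, folded M_def, THEN lift_R_closed(1)]
  have gens: "x \<in> lift_R \<kappa>" if "x \<in> {?r\<^sup>2, ?r * (?s - ?s'),
      ?s\<^sup>2 + M\<^sup>2 * ?s'\<^sup>2 + (1 + M\<^sup>2)\<^sup>2 * ?r * ?r' - (1 + M\<^sup>2),
      ?r'\<^sup>2, ?r' * (?s - ?s'), t * ?r, t * ?r', t * (?s - ?s'), t * (M\<^sup>2 * ?s + ?s' - (1 + M\<^sup>2))}" for x
    by (rule lift_R_closed(2), use that in
      \<open>simp only: R_minus_generators_def Let_def adj_simps letter_adj.simps t_def M_def q_def\<close>)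
  show "?r * ?r \<in> lift_R \<kappa>" "?r' * ?r' \<in> lift_R \<kappa>"
    using gens[of "?r\<^sup>2"] gens[of "?r'\<^sup>2"] by (simp_all add: power2_eq_square)
  have diffs: "?r * ?s - ?r * ?s' \<in> lift_R \<kappa>" "?r' * ?s - ?r' * ?s' \<in> lift_R \<kappa>"
    using gens[of "?r * (?s - ?s')"] gens[of "?r' * (?s - ?s')"] by (simp_all add: algebra_simps)
  have Mm: "M * x \<in> lift_R \<kappa>" if "x \<in> lift_R \<kappa>" for x
    using lift_R_closed(5)[OF that] by (simp add: M_def)
  have sigma_r: "y * ?s + y \<in> lift_R \<kappa>"
    if y: "t * y \<in> lift_R \<kappa>" "M * (y * ?s) - ?s * y \<in> lift_R \<kappa>" "M * (?s' * y) - y * ?s' \<in> lift_R \<kappa>"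
      "y * ?s - y * ?s' \<in> lift_R \<kappa>" for y
  proof (rule lift_R_cancel)
    have "const (1 + q ^ 4) * (y * ?s + y) = M * t * y + M * (M * (M * (M * (y * ?s) - ?s * y)))
       - (M * (?s' * y) - y * ?s') + (y * ?s - y * ?s')"
      unfolding tM const_simps M_def[symmetric] by (simp add: algebra_simps power_numeral_reduce)
    also have "\<dots> \<in> lift_R \<kappa>"
      unfolding mult.assoc
      by (rule lift_R_closed(3)[OF lift_R_diff[OF lift_R_closed(3)[OF Mm[OF y(1)] Mm[OF Mm[OF Mm[OF y(2)]]]] y(3)] y(4)])
    finally show "const (1 + q ^ 4) * (y * ?s + y) \<in> lift_R \<kappa>" .
  qed (rule nz)
  show rs: "?r * ?s + ?r \<in> lift_R \<kappa>"
    using gens[of "t * ?r"] diffs N by (intro sigma_r) simp_all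
  show rs': "?r' * ?s + ?r' \<in> lift_R \<kappa>"
    using gens[of "t * ?r'"] diffs N by (intro sigma_r) simp_all
  show "?r * ?s' + ?r \<in> lift_R \<kappa>" "?r' * ?s' + ?r' \<in> lift_R \<kappa>"
    using lift_R_diff[OF rs diffs(1)] lift_R_diff[OF rs' diffs(2)] by (simp_all add: add.commute)
  have t1: "t * (?s - 1) \<in> lift_R \<kappa>"
  proof (rule lift_R_cancel)
    have "const (1 + q\<^sup>2) * (t * (?s - 1)) = t * (?s - ?s') + t * (M\<^sup>2 * ?s + ?s' - (1 + M\<^sup>2))"
    proof -
      have "t * M = M * t" unfolding M_def by (rule const_commute[symmetric])
      moreover from this have "t * (M * x) = M * (t * x)" for x by (simp flip: mult.assoc)
      ultimately show ?thesis
        unfolding const_simps M_def[symmetric]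
        by (simp add: algebra_simps power2_eq_square)
    qed
    then show "const (1 + q\<^sup>2) * (t * (?s - 1)) \<in> lift_R \<kappa>"
      using gens by (auto intro!: lift_R_closed(3))
  qed (rule nz)
  have t2: "t * (?s' - 1) \<in> lift_R \<kappa>"
  proof -
    have "t * (?s' - 1) = t * (?s - 1) - t * (?s - ?s')" by (simp add: algebra_simps)
    then show ?thesis using t1 gens lift_R_diff by simp
  qed
  \<comment> \<open>\<open>A1\<close> and \<open>A2\<close> are \<open>\<mu> t (\<sigma> - 1)\<close> and \<open>\<mu> t (\<sigma>\<^sup>* - 1)\<close> with \<open>\<sigma>\<sigma>\<^sup>*\<close> and
    \<open>\<sigma>\<^sup>*\<sigma>\<close> replaced by means of \<open>\<rho>\<rho>\<^sup>*\<close>; \<open>A3\<close> is the third generator.\<close>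
  define A1 where "A1 = M^3 * (?s * ?s) - M * (?r * ?r') + (1 + M^4 - M^3) * ?s - M * ?s' + M - 1 - M^4"
  define A2 where "A2 = M * (?s' * ?s') - M^5 * (?r * ?r') + (1 + M^4 - M) * ?s' - M^3 * ?s + M^3 - 1 - M^4"
  have A1: "A1 \<in> lift_R \<kappa>"
  proof -
    have "A1 = M * t * (?s - 1) - M * (?s' * ?s + ?r * ?r' - 1)"
      unfolding tM A1_def by (simp add: algebra_simps power_numeral_reduce)
    then show ?thesis using t1 N by (simp only: mult.assoc Mm lift_R_diff)
  qed
  have A2: "A2 \<in> lift_R \<kappa>"
  proof -
    have "A2 = M * t * (?s' - 1) - M * (M * (M * (?s * ?s' + M\<^sup>2 * (?r * ?r') - 1)))"
      unfolding tM A2_def by (simp add: algebra_simps power_numeral_reduce)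
    then show ?thesis using t2 N by (simp only: mult.assoc Mm lift_R_diff)
  qed
  define A3 where "A3 = ?s\<^sup>2 + M\<^sup>2 * ?s'\<^sup>2 + (1 + M\<^sup>2)\<^sup>2 * ?r * ?r' - (1 + M\<^sup>2)"
  have A3: "A3 \<in> lift_R \<kappa>" unfolding A3_def by (rule gens) simp
  define p where "p = q * (1 - q + q\<^sup>2)"
  have p: "p \<noteq> 0" using nz by (simp add: p_def)
  have reds: "const p * lin (red_rr q) = (1 - M) * (M - 1 + ?s - M * ?s')"
    "const p * lin (red_sq q) = (1 - M + M^2 - M^3 + M^4) - (1 - M + 2 * M^2 - 2 * M^3 + M^4) * ?s + M * ?s'"
    "const p * lin (red_sq' q) = (1 - M + M^2 - M^3 + M^4) + M^3 * ?s - (1 - 2 * M + 2 * M^2 - M^3 + M^4) * ?s'"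
  proof -
    have "scale p (red_rr q) = scale (1 - q) (q - 1, 1, - q, 0, 0)"
      "scale p (red_sq q) = (1 - q + q^2 - q^3 + q^4, - (1 - q + 2 * q^2 - 2 * q^3 + q^4), q, 0, 0)"
      "scale p (red_sq' q) = (1 - q + q^2 - q^3 + q^4, q^3, - (1 - 2 * q + 2 * q^2 - q^3 + q^4), 0, 0)"
      using p unfolding red_rr_def red_sq_def red_sq'_def p_def[symmetric] scale_simps(3)
      by simp_all
    note this[THEN arg_cong[of _ _ lin], unfolded lin_linear(2)]
    then show "const p * lin (red_rr q) = (1 - M) * (M - 1 + ?s - M * ?s')"
      "const p * lin (red_sq q) = (1 - M + M^2 - M^3 + M^4) - (1 - M + 2 * M^2 - 2 * M^3 + M^4) * ?s + M * ?s'"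
      "const p * lin (red_sq' q) = (1 - M + M^2 - M^3 + M^4) + M^3 * ?s - (1 - 2 * M + 2 * M^2 - M^3 + M^4) * ?s'"
      by (simp_all add: const_simps M_def[symmetric]) (simp_all add: algebra_simps)
  qed
  show rr: "?r * ?r' - lin (red_rr (mu \<kappa>)) \<in> lift_R \<kappa>"
  proof (rule lift_R_cancel)
    \<comment> \<open>This combination eliminates \<open>\<sigma>\<^sup>2\<close> and \<open>(\<sigma>\<^sup>*)\<^sup>2\<close>.\<close>
    have "const ((1 + q ^ 4) * (1 + q + q\<^sup>2)) * (const p * (?r * ?r' - lin (red_rr q)))
      = M * (M * (M * A3)) - A1 - M * (M * (M * (M * A2)))"
      unfolding A3_def A1_def A2_def right_diff_distrib reds
      unfolding p_def const_simps M_def[symmetric]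
      by (simp add: algebra_simps power_numeral_reduce comm mult_2 mult_2_right)
    also have "\<dots> \<in> lift_R \<kappa>" using A1 A2 A3 by (intro lift_R_diff Mm)
    finally show "const ((1 + q ^ 4) * (1 + q + q\<^sup>2) * p) * (?r * ?r' - lin (red_rr (mu \<kappa>))) \<in> lift_R \<kappa>"
      by (simp add: const_simps mult.assoc q_def)
  qed (use nz p in simp)
  show "?s * ?s - lin (red_sq (mu \<kappa>)) \<in> lift_R \<kappa>"
  proof (rule lift_R_cancel)
    have "const (q^3) * (const p * (?s * ?s - lin (red_sq q))) = const p * A1 + M * (const p * (?r * ?r' - lin (red_rr q)))"
      unfolding A1_def right_diff_distrib reds
      unfolding p_def const_simps M_def[symmetric]
      by (simp add: algebra_simps power_numeral_reduce comm mult_2 mult_2_right)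
    also have "\<dots> \<in> lift_R \<kappa>"
      using A1 rr[folded q_def] by (intro lift_R_closed(3,5) Mm)
    finally show "const (q^3 * p) * (?s * ?s - lin (red_sq (mu \<kappa>))) \<in> lift_R \<kappa>"
      by (simp add: const_simps mult.assoc q_def)
  qed (use nz p in simp)
  show "?s' * ?s' - lin (red_sq' (mu \<kappa>)) \<in> lift_R \<kappa>"
  proof (rule lift_R_cancel)
    have "const q * (const p * (?s' * ?s' - lin (red_sq' q))) = const p * A2 + M * (M * (M * (M * (M * (const p * (?r * ?r' - lin (red_rr q)))))))"
      unfolding A2_def right_diff_distrib reds
      unfolding p_def const_simps M_def[symmetric]
      by (simp add: algebra_simps power_numeral_reduce comm mult_2 mult_2_right)
    also have "\<dots> \<in> lift_R \<kappa>"
      using A2 rr[folded q_def] by (intro lift_R_closed(3,5) Mm)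
    finally show "const (q * p) * (?s' * ?s' - lin (red_sq' (mu \<kappa>))) \<in> lift_R \<kappa>"
      by (simp add: const_simps mult.assoc q_def)
  qed (use nz p in simp)
qed

text \<open>The coordinates of a letter.\<close>

fun unit_vec :: "letter \<Rightarrow> 'k::field vec5" where
  "unit_vec Sig = (0, 1, 0, 0, 0)"
| "unit_vec Sig_star = (0, 0, 1, 0, 0)"
| "unit_vec Rho = (0, 0, 0, 1, 0)"
| "unit_vec Rho_star = (0, 0, 0, 0, 1)"

lemma lin_unit_vec: "lin (unit_vec l) = gen l" "lin (1, 0, 0, 0, 0) = 1"
  by (cases l; simp add: const_simps)+

lemma act_one: "act q l (1, 0, 0, 0, 0) = unit_vec l"
  by (cases l; simp add: vec5_zero)

lemma letter_product:
  "gen k * gen l - lin (act (mu \<kappa>) l (unit_vec k)) \<in> lift_R \<kappa>"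
proof -
  let ?s = "gen Sig" and ?s' = "gen Sig_star" and ?r = "gen Rho" and ?r' = "gen Rho_star"
  define q where "q = mu \<kappa>"
  note nz = mu_poly_nonzero[of \<kappa>, folded q_def]
  note P = R_minus_products[of \<kappa>, folded q_def]
  note N = SU_relations_mem[of \<kappa>, folded q_def, THEN lift_R_closed(1)]
  have "?s * ?s' - (1 - const (q\<^sup>2) * lin (red_rr q)) \<in> lift_R \<kappa>"
    using lift_R_diff[OF N(6) lift_R_closed(5)[OF P(7), of "q\<^sup>2"]]
    by (simp add: const_simps algebra_simps)
  moreover have "?s' * ?s - (1 - lin (red_rr q)) \<in> lift_R \<kappa>"
    using lift_R_diff[OF N(7) P(7)] by (simp add: algebra_simps)
  moreover have "?r' * ?r - lin (red_rr q) \<in> lift_R \<kappa>"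
    using lift_R_diff[OF P(7) N(1)] by (simp add: algebra_simps)
  moreover have "?s * ?r + const q * ?r \<in> lift_R \<kappa>"
    using lift_R_diff[OF lift_R_closed(5)[OF P(1), of q] N(2)] by (simp add: algebra_simps)
  moreover have "?s * ?r' + const q * ?r' \<in> lift_R \<kappa>"
    using lift_R_diff[OF lift_R_closed(5)[OF P(2), of q] N(3)] by (simp add: algebra_simps)
  moreover have "?s' * ?r + const (1 / q) * ?r \<in> lift_R \<kappa>"
    by (rule lift_R_cancel[OF _ nz(1)], use lift_R_closed(3)[OF N(4) P(3)] nz in
      \<open>simp add: distrib_left mult.assoc[symmetric] const_simps(2)[symmetric] const_simps(7)\<close>)
  moreover have "?s' * ?r' + const (1 / q) * ?r' \<in> lift_R \<kappa>"
    by (rule lift_R_cancel[OF _ nz(1)], use lift_R_closed(3)[OF N(5) P(4)] nz in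
      \<open>simp add: distrib_left mult.assoc[symmetric] const_simps(2)[symmetric] const_simps(7)\<close>)
  ultimately show ?thesis
    unfolding q_def[symmetric] using P
    by (cases k; cases l; simp add: lin_linear zero_prod_def del: lin.simps scale_simps)
      (simp_all add: const_simps)
qed

lemma lift_R_reduce_gen: "lin v * gen l - lin (act (mu \<kappa>) l v) \<in> lift_R \<kappa>"
proof -
  obtain v0 v1 v2 v3 v4 where "v = (v0, v1, v2, v3, v4)" by (cases v)
  then have v: "v = scale v0 (1, 0, 0, 0, 0) + scale v1 (unit_vec Sig)
     + scale v2 (unit_vec Sig_star) + scale v3 (unit_vec Rho) + scale v4 (unit_vec Rho_star)" by simp
  let ?p = "\<lambda>k. gen k * gen l - lin (act (mu \<kappa>) l (unit_vec k))"
  have "lin v * gen l - lin (act (mu \<kappa>) l v) = const v1 * ?p Sig + const v2 * ?p Sig_star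
      + const v3 * ?p Rho + const v4 * ?p Rho_star"
    unfolding v act_linear lin_linear act_one lin_unit_vec
    by (simp add: right_diff_distrib distrib_right mult.assoc)
  also have "\<dots> \<in> lift_R \<kappa>"
    by (intro lift_R_closed(3,5) letter_product)
  finally show ?thesis .
qed

text \<open>Every element is congruent to the linear element with the coordinates \<open>e x\<close>.\<close>

lemma lift_R_reduce: "x - lin (module_act (mu \<kappa>) (1, 0, 0, 0, 0) x) \<in> lift_R \<kappa>"
proof (induction x rule: free_alg_induct)
  case (const c)
  have "lin (scale c (1, 0, 0, 0, 0)) = const c"
    unfolding lin_linear lin_unit_vec by simp
  then show ?case using lift_R_closed(1)[OF SU_ideal_closed(1)]
    by (simp add: module_act_const)
next
  case (mult_gen p l)
  then show ?case
    using lift_R_closed(3)[OF lift_R_closed(4)[OF mult_gen, of "gen l"]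
        lift_R_reduce_gen[of "module_act (mu \<kappa>) (1, 0, 0, 0, 0) p" l]]
    by (simp add: module_act_mult_gen left_diff_distrib)
next
  case (add x y)
  then show ?case
    using lift_R_closed(3)[OF add] by (simp add: module_act_add lin_linear(1) add_diff_add)
qed

text \<open>\<open>R\<^sub>-\<close> is the annihilator of \<open>e = (1, 0, 0, 0, 0)\<close>.\<close>

theorem R_minus_eq_kernel:
  "SU_class \<kappa> x \<in> R_minus \<kappa> \<longleftrightarrow> module_act (mu \<kappa>) (1, 0, 0, 0, 0) x = 0"
proof
  define q where "q = mu \<kappa>"
  define e :: "complex fls vec5" where "e = (1, 0, 0, 0, 0)"
  let ?\<phi> = "module_act (mu \<kappa>) (1, 0, 0, 0, 0)"
  define t where "t = (const q)\<^sup>2 * gen Sig + gen Sig_star + const ((1 + q ^ 4) / q)"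
  note eval = module_act_simps module_act_mult module_act_add module_act_const act_linear act_diff
    module_act_linear const_simps(5)[symmetric]
  have t: "module_act q e t = scale (q^2) (act q Sig e) + act q Sig_star e + scale ((1 + q ^ 4) / q) e"
    by (simp add: t_def eval)
  note gens = act_R_minus_generators[OF mu_poly_nonzero(1,2)[of \<kappa>], folded q_def e_def, folded t]
  have "right_ideal (SU_class \<kappa> ` {x. ?\<phi> x = 0}) (SU \<kappa>)"
  proof (rule right_idealI[OF ring_SU])
    show "\<zero>\<^bsub>SU \<kappa>\<^esub> \<in> SU_class \<kappa> ` {x. ?\<phi> x = 0}"
      by (rule image_eqI[of _ _ 0]) (simp_all add: SU_class_0 module_act_simps)
  next
    fix x y assume "x \<in> SU_class \<kappa> ` {x. ?\<phi> x = 0}" "y \<in> SU_class \<kappa> ` {x. ?\<phi> x = 0}"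
    then obtain u v where "x = SU_class \<kappa> u" "?\<phi> u = 0" "y = SU_class \<kappa> v" "?\<phi> v = 0" by blast
    then show "x \<oplus>\<^bsub>SU \<kappa>\<^esub> y \<in> SU_class \<kappa> ` {x. ?\<phi> x = 0}"
      by (intro image_eqI[of _ _ "u + v"]) (simp_all add: SU_class_simps module_act_add)
  next
    fix x r assume "x \<in> SU_class \<kappa> ` {x. ?\<phi> x = 0}" "r \<in> carrier (SU \<kappa>)"
    then obtain u v where "x = SU_class \<kappa> u" "?\<phi> u = 0" "r = SU_class \<kappa> v"
      by (auto simp: carrier_SU)
    then show "x \<otimes>\<^bsub>SU \<kappa>\<^esub> r \<in> SU_class \<kappa> ` {x. ?\<phi> x = 0}"
      by (intro image_eqI[of _ _ "u * v"])
        (simp_all add: SU_class_simps module_act_mult module_act_linear)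
  qed (auto simp: SU_class_simps)
  moreover have "module_act q e x = 0" if "x \<in> R_minus_generators \<kappa>" for x
  proof -
    have M: "module_act q v ((const q)\<^sup>2) = scale (q\<^sup>2) v"
      "module_act q v ((1 + (const q)\<^sup>2)\<^sup>2) = scale ((1 + q\<^sup>2)\<^sup>2) v" for v
      by (simp_all only: module_act_const flip: const_simps)
    show ?thesis
      using that unfolding R_minus_generators_def Let_def adj_simps letter_adj.simps
        q_def[symmetric] t_def[symmetric] power2_eq_square[of "gen _"]
      by (elim insertE emptyE)
        (simp_all only: eval(1-4) module_act_mult module_act_add M act_linear(2) gens(1-8)[unfolded scale_simps(2,4)]
          gens(9)[unfolded scale_simps(2,4) gens(8)] diff_self)
  qed
  ultimately have sub: "R_minus \<kappa> \<subseteq> SU_class \<kappa> ` {x. ?\<phi> x = 0}"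
    unfolding R_minus_def q_def e_def by (intro gen_right_ideal_minimal) auto
  assume "SU_class \<kappa> x \<in> R_minus \<kappa>"
  then obtain y where y: "SU_class \<kappa> x = SU_class \<kappa> y" "?\<phi> y = 0" using sub by auto
  then have "?\<phi> (x - y) = 0" by (intro SU_ideal_acts_zero) (simp flip: SU_class_eq_iff)
  then show "?\<phi> x = 0" using y(2) by (simp add: module_act_simps)
next
  assume "module_act (mu \<kappa>) (1, 0, 0, 0, 0) x = 0"
  then have "x - lin 0 \<in> lift_R \<kappa>" using lift_R_reduce[of x \<kappa>] by simp
  moreover have "lin 0 = 0" by (simp add: vec5_zero const_simps)
  ultimately show "SU_class \<kappa> x \<in> R_minus \<kappa>" by (simp add: lift_R_def)
qed

section \<open>Formal power series inside the Laurent series\<close>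

text \<open>The power series as a subring of the Laurent series, and the constant term \<open>ct\<close>. The constant
  term is multiplicative on power series only.\<close>

definition series_ring :: "complex fls set" where "series_ring = range fps_to_fls"

abbreviation ct :: "complex fls \<Rightarrow> complex" where "ct x \<equiv> fls_nth x 0"

lemma series_ring_basic [simp]:
  "fps_to_fls f \<in> series_ring" "0 \<in> series_ring" "1 \<in> series_ring" "numeral n \<in> series_ring"
  "fls_const c \<in> series_ring" "fls_X \<in> series_ring"
  unfolding series_ring_def
  by (metis rangeI fps_zero_to_fls fps_one_to_fls fps_to_fls_numeral fps_const_to_fls fps_X_to_fls)+

lemma series_ring_arith [simp]:
  assumes "x \<in> series_ring" "y \<in> series_ring"
  shows "x + y \<in> series_ring" "x - y \<in> series_ring" "x * y \<in> series_ring"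
    "ct (x * y) = ct x * ct y"
proof -
  obtain f g where fg: "x = fps_to_fls f" "y = fps_to_fls g"
    using assms by (auto simp: series_ring_def)
  show "x + y \<in> series_ring" "x - y \<in> series_ring"
    unfolding fg by (simp_all flip: fps_to_fls_plus fps_to_fls_minus)
  show "x * y \<in> series_ring" "ct (x * y) = ct x * ct y"
    unfolding fg by (simp_all flip: fls_times_fps_to_fls)
qed

lemma series_ring_uminus [simp]: "x \<in> series_ring \<Longrightarrow> - x \<in> series_ring"
  using series_ring_arith(2)[of 0 x] by simp

lemma series_ring_power [simp]:
  assumes "x \<in> series_ring"
  shows "x ^ n \<in> series_ring" "ct (x ^ n) = ct x ^ n"
proof -
  have "x ^ n \<in> series_ring \<and> ct (x ^ n) = ct x ^ n"
    using assms by (induction n) auto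
  then show "x ^ n \<in> series_ring" "ct (x ^ n) = ct x ^ n" by auto
qed

lemma series_ring_divide [simp]:
  assumes "x \<in> series_ring" "y \<in> series_ring" "ct y \<noteq> 0"
  shows "x / y \<in> series_ring" "ct (x / y) = ct x / ct y"
proof -
  obtain f g where fg: "x = fps_to_fls f" "y = fps_to_fls g" "ct y = fps_nth g 0"
    using assms by (auto simp: series_ring_def)
  have "subdegree g = 0" using assms(3) fg by simp
  then have q: "x / y = fps_to_fls (f * inverse g)"
    by (simp add: fg divide_inverse fls_inverse_fps_to_fls fls_times_fps_to_fls)
  then show "x / y \<in> series_ring" by simp
  show "ct (x / y) = ct x / ct y"
    unfolding q using assms(3) fg by (simp add: divide_inverse)
qed

lemma series_ring_eq_X_times:
  assumes "x \<in> series_ring" "ct x = 0"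
  obtains y where "y \<in> series_ring" "x = fls_X * y"
proof -
  obtain f where f: "x = fps_to_fls f" "fps_nth f 0 = 0"
    using assms by (auto simp: series_ring_def)
  have "f = fps_X * fps_shift 1 f"
    using f(2) by (simp add: fps_eq_iff)
  then have "x = fls_X * fps_to_fls (fps_shift 1 f)"
    using f(1) by (metis fls_times_fps_to_fls fps_X_to_fls)
  then show ?thesis by (rule that[OF series_ring_basic(1)])
qed

lemma mu_series_ring [simp]: "mu \<kappa> \<in> series_ring"
  by (simp add: mu_def)

text \<open>\<open>\<nu> = (\<mu> - 1)/h\<close> is a power series with the constant term \<open>1/\<kappa>\<close>. It is invertible as a
  power series when \<open>\<kappa>\<close> is not zero, so that division by \<open>h\<close> may be replaced by division by
  \<open>\<mu> - 1\<close>.\<close>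

definition nu :: "real \<Rightarrow> complex fls" where "nu \<kappa> = fls_X_inv * (mu \<kappa> - 1)"

lemma nu_props:
  "nu \<kappa> \<in> series_ring" "ct (nu \<kappa>) = 1 / \<kappa>" "mu \<kappa> - 1 = fls_X * nu \<kappa>"
proof -
  obtain y where y: "y \<in> series_ring" "mu \<kappa> - 1 = fls_X * y"
    by (rule series_ring_eq_X_times[of "mu \<kappa> - 1"]) auto
  have "nu \<kappa> = y"
    using y(2) by (simp add: nu_def flip: mult.assoc fls_inverse_X)
  then show "nu \<kappa> \<in> series_ring" "mu \<kappa> - 1 = fls_X * nu \<kappa>" using y by auto
  show "ct (nu \<kappa>) = 1 / \<kappa>"
    by (simp add: nu_def mu_def fls_X_inv_times_conv_shift)
qed

text \<open>The coordinatewise application of a function, used to take constant terms of vectors.\<close>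

fun vmap :: "('a \<Rightarrow> 'b) \<Rightarrow> 'a \<times> 'a \<times> 'a \<times> 'a \<times> 'a \<Rightarrow> 'b \<times> 'b \<times> 'b \<times> 'b \<times> 'b" where
  "vmap f (a, b, c, d, e) = (f a, f b, f c, f d, f e)"

text \<open>The vectors with power series entries.\<close>

abbreviation int_vec :: "complex fls vec5 set" where
  "int_vec \<equiv> series_ring \<times> series_ring \<times> series_ring \<times> series_ring \<times> series_ring"

lemma int_vec_linear:
  "u \<in> int_vec \<Longrightarrow> v \<in> int_vec \<Longrightarrow> u + v \<in> int_vec"
  "u \<in> int_vec \<Longrightarrow> - u \<in> int_vec"
  "c \<in> series_ring \<Longrightarrow> u \<in> int_vec \<Longrightarrow> scale c u \<in> int_vec"
  "vmap ct (u + v) = vmap ct u + vmap ct v"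
  "vmap ct (- u) = - vmap ct u"
  "c \<in> series_ring \<Longrightarrow> u \<in> int_vec \<Longrightarrow> vmap ct (scale c u) = scale (ct c) (vmap ct u)"
  by (cases u; cases v; force)+

section \<open>A basis adapted to the contraction\<close>

text \<open>\<open>lattice_vec\<close> turns coordinates with respect to \<open>1, \<sigma>, \<rho>, S, P\<close>, where
  \<open>S = (\<sigma> - \<sigma>\<^sup>*)/(q - 1)\<close> and \<open>P = (\<rho> + \<rho>\<^sup>*)/(q - 1)\<close>, into coordinates with respect to
  \<open>1, \<sigma>, \<sigma>\<^sup>*, \<rho>, \<rho>\<^sup>*\<close>.\<close>

fun lattice_vec :: "'k::field \<Rightarrow> 'k vec5 \<Rightarrow> 'k vec5" where
  "lattice_vec q (z0, z1, z2, z3, z4) =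
     (z0, z1 + z3 / (q - 1), - z3 / (q - 1), z2 + z4 / (q - 1), z4 / (q - 1))"

text \<open>Names for \<open>\<sigma>\<close>, \<open>\<rho>\<close>, the difference quotient \<open>S\<close> and the sum quotient \<open>P\<close>, in this
  order.\<close>

datatype lattice_letter = LS | LR | LD | LP

text \<open>The right action of \<open>\<sigma>, \<rho>, S, P\<close> in the basis \<open>1, \<sigma>, \<rho>, S, P\<close>. The denominators
  do not vanish at \<open>q = 1\<close>: the factors \<open>1/(q - 1)\<close> have cancelled.\<close>

fun lattice_act :: "'k::field \<Rightarrow> lattice_letter \<Rightarrow> 'k vec5 \<Rightarrow> 'k vec5" where
  "lattice_act q LS (z0, z1, z2, z3, z4) = (let i = 1 / (q * (1 - q + q^2)) in
     (i * (z1 * (1 - q + q^2 - q^3 + q^4) + z3 * q^2 * (q - 1)),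
      z0 - i * (z1 * (q - 1)^2 * (1 + q^2) + z3 * q^2 * (q - 1)),
      - z2, - i * q * (z1 * (q - 1) + z3 * q), - z4))"
| "lattice_act q LR (z0, z1, z2, z3, z4) = (let i = 1 / (q * (1 - q + q^2)); t = i * z4 * (q - 1) in
     (- t, t, z0 - q * z1 - (1 + 1 / q) * z3, - q * t, 0))"
| "lattice_act q LD (z0, z1, z2, z3, z4) = (let i = 1 / (q * (1 - q + q^2));
       t = i * (z1 * (q - 1) + z3 * (1 + q^2)) in
     (t, - t, 0, z0 + i * (z1 * q * (- 1 + q^2 - q^3) + z3 * (q - 1)), 0))"
| "lattice_act q LP (z0, z1, z2, z3, z4) = (let i = 1 / (q * (1 - q + q^2)); t = i * (z2 * (q - 1) + 2 * z4) in
     (- t, t, 0, - q * t, z0 - q * z1 - (1 + 1 / q) * z3))"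

lemma act_lattice_vec:
  fixes q :: "'k::field"
  assumes "q \<noteq> 0" "1 - q + q^2 \<noteq> 0" "q \<noteq> 1"
  shows "act q Sig (lattice_vec q z) = lattice_vec q (lattice_act q LS z)"
    "act q Rho (lattice_vec q z) = lattice_vec q (lattice_act q LR z)"
    "scale (1 / (q - 1)) (act q Sig (lattice_vec q z) - act q Sig_star (lattice_vec q z)) = lattice_vec q (lattice_act q LD z)"
    "scale (1 / (q - 1)) (act q Rho (lattice_vec q z) + act q Rho_star (lattice_vec q z)) = lattice_vec q (lattice_act q LP z)"
proof -
  obtain z0 z1 z2 z3 z4 where z: "z = (z0, z1, z2, z3, z4)" by (cases z)
  define i where "i = 1 / (q * (1 - q + q^2))"
  note i = red_eq(1)[OF assms(1,2) i_def] and d = red_eq(3-5)[OF assms(1,2) i_def]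
  define e where "e = 1 / (q - 1)"
  have e: "e * (q - 1) = 1" using assms by (simp add: e_def)
  have "x / (q - 1) = e * x" for x by (simp add: e_def)
  note r = red_eq(2)[OF assms(1,2) i_def] this
  show "act q Sig (lattice_vec q z) = lattice_vec q (lattice_act q LS z)"
    by (simp add: z d r Let_def i_def[symmetric] zero_prod_def,
        (intro conjI)?; (use i e in Groebner_Basis.algebra | simp add: algebra_simps)?)
  show "act q Rho (lattice_vec q z) = lattice_vec q (lattice_act q LR z)"
    by (simp add: z d r Let_def i_def[symmetric] zero_prod_def,
        (intro conjI)?; (use i e in Groebner_Basis.algebra | simp add: algebra_simps)?)
  show "scale (1 / (q - 1)) (act q Sig (lattice_vec q z) - act q Sig_star (lattice_vec q z)) = lattice_vec q (lattice_act q LD z)"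
    by (simp add: z d r Let_def i_def[symmetric] zero_prod_def,
        (intro conjI)?; (use i e in Groebner_Basis.algebra | simp add: algebra_simps)?)
  show "scale (1 / (q - 1)) (act q Rho (lattice_vec q z) + act q Rho_star (lattice_vec q z)) = lattice_vec q (lattice_act q LP z)"
    by (simp add: z d r Let_def i_def[symmetric] zero_prod_def,
        (intro conjI)?; (use i e in Groebner_Basis.algebra | simp add: algebra_simps)?)
qed

text \<open>The elements \<open>\<sigma>, \<rho>, S, P\<close> of the free algebra.\<close>

definition lattice_gen :: "real \<Rightarrow> lattice_letter \<Rightarrow> free_alg" where
  "lattice_gen \<kappa> g = (case g of LS \<Rightarrow> gen Sig | LR \<Rightarrow> gen Rho
     | LD \<Rightarrow> const (1 / (mu \<kappa> - 1)) * (gen Sig - gen Sig_star)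
     | LP \<Rightarrow> const (1 / (mu \<kappa> - 1)) * (gen Rho + gen Rho_star))"

text \<open>The combination of \<open>1, \<sigma>, \<rho>, S, P\<close> with the given coefficients.\<close>

definition lattice_elem :: "real \<Rightarrow> complex fls vec5 \<Rightarrow> free_alg" where
  "lattice_elem \<kappa> z = lin (lattice_vec (mu \<kappa>) z)"

lemma lattice_vec_linear:
  "lattice_vec q (u + v) = lattice_vec q u + lattice_vec q v"
  "lattice_vec q (u - v) = lattice_vec q u - lattice_vec q v"
  "lattice_vec q (scale c v) = scale c (lattice_vec q v)"
  by (cases u; cases v; simp add: add_divide_distrib diff_divide_distrib algebra_simps)+

lemma lattice_elem_linear:
  "lattice_elem \<kappa> (u + v) = lattice_elem \<kappa> u + lattice_elem \<kappa> v"
  "lattice_elem \<kappa> (u - v) = lattice_elem \<kappa> u - lattice_elem \<kappa> v"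
  "lattice_elem \<kappa> (scale c v) = const c * lattice_elem \<kappa> v"
  by (simp_all only: lattice_elem_def lattice_vec_linear lin_linear)

lemma lattice_elem_unit:
  "lattice_elem \<kappa> (1, 0, 0, 0, 0) = 1"
  "lattice_elem \<kappa> (0, 1, 0, 0, 0) = lattice_gen \<kappa> LS" "lattice_elem \<kappa> (0, 0, 1, 0, 0) = lattice_gen \<kappa> LR"
  "lattice_elem \<kappa> (0, 0, 0, 1, 0) = lattice_gen \<kappa> LD" "lattice_elem \<kappa> (0, 0, 0, 0, 1) = lattice_gen \<kappa> LP"
  by (simp_all add: lattice_elem_def lattice_gen_def const_simps right_diff_distrib distrib_left)

lemma lattice_elem_eq:
  "lattice_elem \<kappa> (z0, z1, z2, z3, z4) = const z0 + const z1 * lattice_gen \<kappa> LS + const z2 * lattice_gen \<kappa> LR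
     + const z3 * lattice_gen \<kappa> LD + const z4 * lattice_gen \<kappa> LP"
proof -
  have "(z0, z1, z2, z3, z4) = scale z0 (1, 0, 0, 0, 0) + scale z1 (0, 1, 0, 0, 0)
     + scale z2 (0, 0, 1, 0, 0) + scale z3 (0, 0, 0, 1, 0) + scale z4 (0, 0, 0, 0, 1)" by simp
  then show ?thesis by (simp only: lattice_elem_linear lattice_elem_unit mult_1_right)
qed

lemma fls_conj_half: "fls_conj (x / 2) = fls_conj x / 2"
proof -
  have "fls_conj x = fls_conj (1 + 1) * fls_conj (x / 2)"
    by (simp flip: fls_conj_mult)
  then show ?thesis by (simp only: fls_conj_simps) simp
qed

lemma adj_lin:
  "adj (lin (v0, v1, v2, v3, v4)) =
    lin (fls_conj v0, fls_conj v2, fls_conj v1, fls_conj v4, fls_conj v3)"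
  by (simp add: adj_add adj_mult adj_simps gen_const add_ac)

lemma elem_lattice_elem:
  assumes "\<kappa> \<noteq> 0"
  defines "q \<equiv> mu \<kappa>" and "n \<equiv> nu \<kappa>"
  shows "elem_a \<kappa> = lattice_elem \<kappa> (0, 1, (1 + q) / 2, - (q - 1) / 2, - q * (q - 1) / 2)"
    "adj (elem_a \<kappa>) = lattice_elem \<kappa> (0, 1, - (1 + q) / 2, - (q - 1) / 2, (q - 1) / 2)"
    "elem_w \<kappa> = lattice_elem \<kappa> (0, 0, n / 2, - n / 2, - n * q / 2)"
    "adj (elem_w \<kappa>) = lattice_elem \<kappa> (0, 0, - n / 2, n / 2, - n / 2)"
proof -
  have q1: "q - 1 \<noteq> 0" using mu_neq_1[OF assms(1)] by (simp add: q_def)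
  have n: "n / (q - 1) = fls_X_inv" "n = fls_X_inv * (q - 1)" using q1 by (simp_all add: n_def q_def nu_def)
  have conj: "fls_conj (1 / 2) = 1 / 2" "fls_conj (fls_X_inv / 2) = fls_X_inv / 2" "fls_conj q = q"
    "fls_conj (- c) = - fls_conj c" for c
  proof -
    have "fls_conj fls_X_inv = fls_X_inv" by (simp add: fls_eq_iff)
    then show "fls_conj (1 / 2) = 1 / 2" "fls_conj (fls_X_inv / 2) = fls_X_inv / 2"
      by (simp_all add: fls_conj_half fls_conj_simps)
    show "fls_conj q = q" by (simp add: q_def fls_conj_mu)
    show "fls_conj (- c) = - fls_conj c" by (simp add: fls_eq_iff)
  qed
  have "elem_a \<kappa> = const (1 / 2) * lin (0, 1, 1, 1, - q)"
    "elem_w \<kappa> = const (fls_X_inv / 2) * lin (0, - 1, 1, - 1, - q)"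
    by (simp_all add: elem_a_def elem_w_def adj_simps const_simps q_def)
      (simp_all only: diff_conv_add_uminus add_ac)
  then have elem: "elem_a \<kappa> = lin (scale (1 / 2) (0, 1, 1, 1, - q))"
    "elem_w \<kappa> = lin (scale (fls_X_inv / 2) (0, - 1, 1, - 1, - q))"
    by (simp_all only: lin_linear)
  then have elem': "adj (elem_a \<kappa>) = lin (scale (1 / 2) (0, 1, 1, - q, 1))"
    "adj (elem_w \<kappa>) = lin (scale (fls_X_inv / 2) (0, 1, - 1, - q, - 1))"
    by (simp_all only: scale.simps adj_lin fls_conj_mult conj fls_conj_simps)
  show "elem_a \<kappa> = lattice_elem \<kappa> (0, 1, (1 + q) / 2, - (q - 1) / 2, - q * (q - 1) / 2)"
    "adj (elem_a \<kappa>) = lattice_elem \<kappa> (0, 1, - (1 + q) / 2, - (q - 1) / 2, (q - 1) / 2)"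
    "elem_w \<kappa> = lattice_elem \<kappa> (0, 0, n / 2, - n / 2, - n * q / 2)"
    "adj (elem_w \<kappa>) = lattice_elem \<kappa> (0, 0, - n / 2, n / 2, - n / 2)"
    using q1 unfolding elem' unfolding elem lattice_elem_def q_def[symmetric] n(2)
    by (intro arg_cong[of _ _ lin], simp add: field_simps)+
qed

section \<open>The lattice\<close>

text \<open>A lift of the lattice to the free algebra; \<open>SU_class\<close> maps it onto the lattice
  (\<open>lattice_L_eq\<close>).\<close>

definition lift_L :: "real \<Rightarrow> free_alg set" where
  "lift_L \<kappa> = generate_ring free_ring (range (\<lambda>f. const (fps_to_fls f)) \<union>
     {elem_a \<kappa>, adj (elem_a \<kappa>), elem_w \<kappa>, adj (elem_w \<kappa>)})"

lemma lift_L_closed: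
  "x \<in> lift_L \<kappa> \<Longrightarrow> y \<in> lift_L \<kappa> \<Longrightarrow> x + y \<in> lift_L \<kappa>"
  "x \<in> lift_L \<kappa> \<Longrightarrow> - x \<in> lift_L \<kappa>"
  "x \<in> lift_L \<kappa> \<Longrightarrow> y \<in> lift_L \<kappa> \<Longrightarrow> x * y \<in> lift_L \<kappa>"
  "x \<in> lift_L \<kappa> \<Longrightarrow> y \<in> lift_L \<kappa> \<Longrightarrow> x - y \<in> lift_L \<kappa>"
  "c \<in> series_ring \<Longrightarrow> const c \<in> lift_L \<kappa>"
  "0 \<in> lift_L \<kappa>" "1 \<in> lift_L \<kappa>" "numeral k \<in> lift_L \<kappa>"
  "elem_a \<kappa> \<in> lift_L \<kappa>" "adj (elem_a \<kappa>) \<in> lift_L \<kappa>"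
  "elem_w \<kappa> \<in> lift_L \<kappa>" "adj (elem_w \<kappa>) \<in> lift_L \<kappa>"
proof -
  show add: "x + y \<in> lift_L \<kappa>" if "x \<in> lift_L \<kappa>" "y \<in> lift_L \<kappa>" for x y
    using generate_ring.eng_add[OF that[unfolded lift_L_def]] by (simp add: lift_L_def)
  show uminus: "- x \<in> lift_L \<kappa>" if "x \<in> lift_L \<kappa>" for x
    using generate_ring.a_inv[OF that[unfolded lift_L_def]] by (simp add: lift_L_def free_ring_inv)
  show "x * y \<in> lift_L \<kappa>" if "x \<in> lift_L \<kappa>" "y \<in> lift_L \<kappa>"
    using generate_ring.eng_mult[OF that[unfolded lift_L_def]] by (simp add: lift_L_def)
  show "x - y \<in> lift_L \<kappa>" if "x \<in> lift_L \<kappa>" "y \<in> lift_L \<kappa>"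
    using add[OF that(1) uminus[OF that(2)]] by simp
  show const: "const c \<in> lift_L \<kappa>" if "c \<in> series_ring" for c
    using that unfolding lift_L_def series_ring_def by (auto intro: generate_ring.incl)
  show "0 \<in> lift_L \<kappa>" "1 \<in> lift_L \<kappa>" "numeral k \<in> lift_L \<kappa>"
    using const[of 0] const[of 1] const[of "numeral k"] by (simp_all add: const_simps)
  show "elem_a \<kappa> \<in> lift_L \<kappa>" "adj (elem_a \<kappa>) \<in> lift_L \<kappa>"
    "elem_w \<kappa> \<in> lift_L \<kappa>" "adj (elem_w \<kappa>) \<in> lift_L \<kappa>"
    unfolding lift_L_def by (auto intro: generate_ring.incl)
qed

lemma SU_class_uminus: "\<ominus>\<^bsub>SU \<kappa>\<^esub> SU_class \<kappa> x = SU_class \<kappa> (- x)"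
proof -
  interpret ring "SU \<kappa>" by (rule ring_SU)
  have "SU_class \<kappa> (- x) \<oplus>\<^bsub>SU \<kappa>\<^esub> SU_class \<kappa> x = \<zero>\<^bsub>SU \<kappa>\<^esub>"
    by (simp add: SU_class_0 flip: SU_class_simps)
  then show ?thesis by (intro minus_equality) (simp_all add: SU_class_simps)
qed

lemma lattice_L_eq: "lattice_L \<kappa> = SU_class \<kappa> ` lift_L \<kappa>"
proof
  show "lattice_L \<kappa> \<subseteq> SU_class \<kappa> ` lift_L \<kappa>"
  proof
    fix x assume "x \<in> lattice_L \<kappa>"
    then show "x \<in> SU_class \<kappa> ` lift_L \<kappa>"
      unfolding lattice_L_def
    proof induction
      case one
      show ?case by (metis SU_class_simps(4) imageI lift_L_closed(7))
    next
      case (incl x)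
      then show ?case
        unfolding lift_L_def by (elim imageE) (intro image_eqI generate_ring.incl)
    next
      case (a_inv x)
      then obtain u where "x = SU_class \<kappa> u" "u \<in> lift_L \<kappa>" by blast
      then show ?case
        by (intro image_eqI[of _ _ "- u"]) (simp_all add: SU_class_uminus lift_L_closed)
    next
      case (eng_add x y)
      then obtain u v where "x = SU_class \<kappa> u" "u \<in> lift_L \<kappa>" "y = SU_class \<kappa> v" "v \<in> lift_L \<kappa>"
        by blast
      then show ?case
        by (intro image_eqI[of _ _ "u + v"]) (simp_all add: SU_class_simps lift_L_closed)
    next
      case (eng_mult x y)
      then obtain u v where "x = SU_class \<kappa> u" "u \<in> lift_L \<kappa>" "y = SU_class \<kappa> v" "v \<in> lift_L \<kappa>"
        by blast
      then show ?case
        by (intro image_eqI[of _ _ "u * v"]) (simp_all add: SU_class_simps lift_L_closed)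
    qed
  qed
  show "SU_class \<kappa> ` lift_L \<kappa> \<subseteq> lattice_L \<kappa>"
  proof
    fix y assume "y \<in> SU_class \<kappa> ` lift_L \<kappa>"
    then obtain x where y: "y = SU_class \<kappa> x" and "x \<in> lift_L \<kappa>" by blast
    from this(2) show "y \<in> lattice_L \<kappa>"
      unfolding y lift_L_def lattice_L_def
    proof induction
      case one
      show ?case using generate_ring.one by (metis SU_class_simps(4) free_ring_simps(4))
    next
      case (incl x)
      then show ?case by (intro generate_ring.incl imageI)
    next
      case (a_inv x)
      then show ?case
        unfolding free_ring_inv SU_class_uminus[symmetric] by (intro generate_ring.a_inv)
    next
      case (eng_add x y)
      then show ?case
        unfolding free_ring_simps SU_class_simps by (intro generate_ring.eng_add)
    next
      case (eng_mult x y)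
      then show ?case
        unfolding free_ring_simps SU_class_simps by (intro generate_ring.eng_mult)
    qed
  qed
qed

lemma lattice_gen_lift_L:
  assumes "\<kappa> \<noteq> 0"
  shows "lattice_gen \<kappa> g \<in> lift_L \<kappa>"
proof -
  define q n where "q = mu \<kappa>" and "n = nu \<kappa>"
  note el = elem_lattice_elem[OF assms, folded q_def n_def]
  have q: "q \<in> series_ring" "ct q = 1" by (simp_all add: q_def)
  have n: "n \<in> series_ring" "ct n \<noteq> 0" using nu_props[of \<kappa>] assms by (simp_all add: n_def)
  have nz: "n \<noteq> 0" "1 + q \<noteq> 0"
  proof -
    show "n \<noteq> 0" using n(2) by auto
    show "1 + q \<noteq> 0"
    proof
      assume "1 + q = 0"
      then have "ct (1 + q) = 0" by simp
      then show False using q(2) by simp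
    qed
  qed
  have P: "lattice_gen \<kappa> LP \<in> lift_L \<kappa>"
  proof -
    have sum: "- n * q / 2 + - n / 2 = - ((1 + q) * n) / 2"
      by (simp add: algebra_simps diff_divide_distrib add_divide_distrib)
    have "- 2 / ((1 + q) * n) * (- n * q / 2 + - n / 2) = 1" using nz unfolding sum by simp
    then have "lattice_gen \<kappa> LP = const (- 2 / ((1 + q) * n)) * (elem_w \<kappa> + adj (elem_w \<kappa>))"
      unfolding el(2,4) unfolding el(1,3) lattice_elem_linear[symmetric] lattice_elem_unit[symmetric]
      by (intro arg_cong[of _ _ "lattice_elem \<kappa>"]) (simp only: scale.simps add_Pair, simp)
    also have "\<dots> \<in> lift_L \<kappa>"
      using q n by (intro lift_L_closed) simp_all
    finally show ?thesis .
  qed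
  have R: "lattice_gen \<kappa> LR \<in> lift_L \<kappa>"
  proof -
    have "lattice_gen \<kappa> LR = const (1 / (1 + q)) * (elem_a \<kappa> - adj (elem_a \<kappa>)) + const ((q - 1) / 2) * lattice_gen \<kappa> LP"
      unfolding el(2,4) unfolding el(1,3) lattice_elem_linear[symmetric] lattice_elem_unit[symmetric]
      using nz mult_left_cancel[of 4 "1 + q" 0]
      by (intro arg_cong[of _ _ "lattice_elem \<kappa>"]) (simp add: field_simps)
    also have "\<dots> \<in> lift_L \<kappa>"
      using q n by (intro lift_L_closed P) simp_all
    finally show ?thesis .
  qed
  have D: "lattice_gen \<kappa> LD \<in> lift_L \<kappa>"
  proof -
    have "lattice_gen \<kappa> LD = const (2 / n) * adj (elem_w \<kappa>) + lattice_gen \<kappa> LP + lattice_gen \<kappa> LR"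
      unfolding el(2,4) unfolding el(1,3) lattice_elem_linear[symmetric] lattice_elem_unit[symmetric]
      using nz by (intro arg_cong[of _ _ "lattice_elem \<kappa>"]) (simp add: field_simps)
    also have "\<dots> \<in> lift_L \<kappa>"
      using q n by (intro lift_L_closed P R) simp_all
    finally show ?thesis .
  qed
  have "lattice_gen \<kappa> LS = elem_a \<kappa> - const ((1 + q) / 2) * lattice_gen \<kappa> LR + const ((q - 1) / 2) * lattice_gen \<kappa> LD
      + const (q * (q - 1) / 2) * lattice_gen \<kappa> LP"
    unfolding el(2,4) unfolding el(1,3) lattice_elem_linear[symmetric] lattice_elem_unit[symmetric]
    using nz by (intro arg_cong[of _ _ "lattice_elem \<kappa>"]) (simp add: field_simps)
  also have "\<dots> \<in> lift_L \<kappa>"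
    using q n by (intro lift_L_closed P R D) simp_all
  finally show ?thesis using P R D by (cases g) simp_all
qed

text \<open>A set that is closed under addition and under right multiplication by power series and by
  \<open>\<sigma>, \<rho>, S, P\<close> is closed under right multiplication by the whole lattice.\<close>

lemma lift_L_right_induct:
  assumes "\<kappa> \<noteq> 0" "y \<in> lift_L \<kappa>" "x \<in> T"
    and add: "\<And>x y. x \<in> T \<Longrightarrow> y \<in> T \<Longrightarrow> x + y \<in> T"
    and const: "\<And>x c. x \<in> T \<Longrightarrow> c \<in> series_ring \<Longrightarrow> x * const c \<in> T"
    and lattice_gen: "\<And>x g. x \<in> T \<Longrightarrow> x * lattice_gen \<kappa> g \<in> T"
  shows "x * y \<in> T"
proof -
  have lat: "x * lattice_elem \<kappa> (z0, z1, z2, z3, z4) \<in> T"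
    if "x \<in> T" "z0 \<in> series_ring" "z1 \<in> series_ring" "z2 \<in> series_ring" "z3 \<in> series_ring" "z4 \<in> series_ring"
    for x z0 z1 z2 z3 z4
    unfolding lattice_elem_eq distrib_left mult.assoc[symmetric] using that by (intro add const lattice_gen)
  have "mu \<kappa> \<in> series_ring" "nu \<kappa> \<in> series_ring" by (simp_all add: nu_props)
  then have elems: "x * elem_a \<kappa> \<in> T" "x * adj (elem_a \<kappa>) \<in> T" "x * elem_w \<kappa> \<in> T"
    "x * adj (elem_w \<kappa>) \<in> T" if "x \<in> T" for x
    unfolding elem_lattice_elem(2,4)[OF assms(1)] unfolding elem_lattice_elem(1,3)[OF assms(1)]
    using that by (intro lat; simp)+
  from assms(2,3) show ?thesis
    unfolding lift_L_def
  proof (induction y arbitrary: x)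
    case one
    then show ?case by simp
  next
    case (incl y)
    then show ?case
      using const elems by auto
  next
    case (a_inv y)
    have "x * y * const (- 1) \<in> T" using a_inv by (intro const) simp_all
    then show ?case by (simp add: free_ring_inv const_simps)
  next
    case (eng_add y z)
    then show ?case by (simp add: distrib_left add)
  next
    case (eng_mult y z)
    then show ?case by (simp flip: mult.assoc)
  qed
qed

section \<open>Integrality of the action and its reduction modulo the parameter\<close>

text \<open>The matrices have power series entries, and their constant terms are the matrices at \<open>q = 1\<close>.\<close>

lemma lattice_act_series_ring:
  assumes "q \<in> series_ring" "ct q = 1" "z \<in> int_vec"
  shows "lattice_act q g z \<in> int_vec" "vmap ct (lattice_act q g z) = lattice_act 1 g (vmap ct z)"
proof -
  obtain z0 z1 z2 z3 z4 where z: "z = (z0, z1, z2, z3, z4)" by (cases z)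
  then have zi: "z0 \<in> series_ring" "z1 \<in> series_ring" "z2 \<in> series_ring" "z3 \<in> series_ring" "z4 \<in> series_ring"
    using assms(3) by auto
  define i where "i = 1 / (q * (1 - q + q^2))"
  have i: "i \<in> series_ring" "ct i = 1" using assms(1,2) by (simp_all add: i_def)
  define j where "j = 1 / q"
  have j: "j \<in> series_ring" "ct j = 1" using assms(1,2) by (simp_all add: j_def)
  show "lattice_act q g z \<in> int_vec"
    unfolding z using zi i j assms(1,2) by (cases g) (simp_all add: Let_def flip: i_def j_def)
  show "vmap ct (lattice_act q g z) = lattice_act 1 g (vmap ct z)"
    unfolding z using zi i j assms(1,2) by (cases g) (simp_all add: Let_def flip: i_def j_def)
qed

text \<open>The inverse of \<open>lattice_vec\<close>.\<close>

fun coords :: "'k::field \<Rightarrow> 'k vec5 \<Rightarrow> 'k vec5" where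
  "coords q (u0, u1, u2, u3, u4) = (u0, u1 + u2, u3 - u4, - (q - 1) * u2, (q - 1) * u4)"

lemma coords_lattice_vec: "q \<noteq> 1 \<Longrightarrow> coords q (lattice_vec q z) = z"
  by (cases z) (simp add: divide_simps, simp add: algebra_simps)

lemma coords_linear:
  "coords q (u + v) = coords q u + coords q v" "coords q (u - v) = coords q u - coords q v"
  "coords q (scale c v) = scale c (coords q v)"
  by (cases u; cases v; simp add: algebra_simps)+

text \<open>\<open>Phi\<close> gives the coordinates of \<open>e x\<close> with respect to \<open>1, \<sigma>, \<rho>, S, P\<close>, and \<open>theta\<close> their
  constant terms. On the lattice the coordinates are power series (\<open>Phi_lift_L\<close>).\<close>

definition Phi :: "real \<Rightarrow> free_alg \<Rightarrow> complex fls vec5" where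
  "Phi \<kappa> x = coords (mu \<kappa>) (module_act (mu \<kappa>) (1, 0, 0, 0, 0) x)"

definition theta :: "real \<Rightarrow> free_alg \<Rightarrow> complex vec5" where
  "theta \<kappa> x = vmap ct (Phi \<kappa> x)"

lemma Phi_linear:
  "Phi \<kappa> (x + y) = Phi \<kappa> x + Phi \<kappa> y" "Phi \<kappa> (x - y) = Phi \<kappa> x - Phi \<kappa> y"
  "Phi \<kappa> (const c * x) = scale c (Phi \<kappa> x)"
  by (simp_all add: Phi_def module_act_add module_act_simps coords_linear)

lemma module_act_lattice_gen:
  assumes "\<kappa> \<noteq> 0"
  shows "module_act (mu \<kappa>) (lattice_vec (mu \<kappa>) z) (lattice_gen \<kappa> g) = lattice_vec (mu \<kappa>) (lattice_act (mu \<kappa>) g z)"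
proof (cases g)
qed (use act_lattice_vec[OF mu_poly_nonzero(1,2) mu_neq_1[OF assms], of z] in
  \<open>simp_all only: lattice_gen_def lattice_letter.case module_act_simps module_act_add module_act_linear\<close>)

lemma Phi_lift_L:
  assumes "\<kappa> \<noteq> 0" "x \<in> lift_L \<kappa>"
  shows "Phi \<kappa> x \<in> int_vec"
    "module_act (mu \<kappa>) (1, 0, 0, 0, 0) x = lattice_vec (mu \<kappa>) (Phi \<kappa> x)"
proof -
  let ?T = "{x. module_act (mu \<kappa>) (1, 0, 0, 0, 0) x \<in> lattice_vec (mu \<kappa>) ` int_vec}"
  have "1 * x \<in> ?T"
  proof (rule lift_L_right_induct[OF assms])
    show "1 \<in> ?T"
      by (intro CollectI image_eqI[of _ _ "(1, 0, 0, 0, 0)"]) (simp_all add: module_act_simps)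
  next
    fix x y assume "x \<in> ?T" "y \<in> ?T"
    then obtain u v where "u \<in> int_vec" "module_act (mu \<kappa>) (1, 0, 0, 0, 0) x = lattice_vec (mu \<kappa>) u"
      "v \<in> int_vec" "module_act (mu \<kappa>) (1, 0, 0, 0, 0) y = lattice_vec (mu \<kappa>) v"
      by (elim CollectE imageE)
    then show "x + y \<in> ?T"
      by (intro CollectI image_eqI[of _ _ "u + v"])
        (simp_all only: module_act_add lattice_vec_linear int_vec_linear)
  next
    fix x c assume "x \<in> ?T" "c \<in> series_ring"
    then obtain u where "u \<in> int_vec" "module_act (mu \<kappa>) (1, 0, 0, 0, 0) x = lattice_vec (mu \<kappa>) u"
      by (elim CollectE imageE)
    then show "x * const c \<in> ?T"
      using \<open>c \<in> series_ring\<close>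
      by (intro CollectI image_eqI[of _ _ "scale c u"])
        (simp_all only: module_act_mult_const lattice_vec_linear int_vec_linear)
  next
    fix x g assume "x \<in> ?T"
    then obtain u where "u \<in> int_vec" "module_act (mu \<kappa>) (1, 0, 0, 0, 0) x = lattice_vec (mu \<kappa>) u"
      by (elim CollectE imageE)
    then show "x * lattice_gen \<kappa> g \<in> ?T"
      by (intro CollectI image_eqI[of _ _ "lattice_act (mu \<kappa>) g u"])
        (simp_all only: module_act_mult module_act_lattice_gen[OF assms(1)] lattice_act_series_ring mu_series_ring mu_nth)
  qed
  then obtain z where z: "z \<in> int_vec" "module_act (mu \<kappa>) (1, 0, 0, 0, 0) x = lattice_vec (mu \<kappa>) z"
    unfolding mult_1_left by (elim CollectE imageE)
  then have "Phi \<kappa> x = z"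
    by (simp only: Phi_def coords_lattice_vec[OF mu_neq_1[OF assms(1)]])
  then show "Phi \<kappa> x \<in> int_vec"
    "module_act (mu \<kappa>) (1, 0, 0, 0, 0) x = lattice_vec (mu \<kappa>) (Phi \<kappa> x)" using z by simp_all
qed

lemma Phi_mult_lattice_gen:
  assumes "\<kappa> \<noteq> 0" "x \<in> lift_L \<kappa>"
  shows "Phi \<kappa> (x * lattice_gen \<kappa> g) = lattice_act (mu \<kappa>) g (Phi \<kappa> x)"
  unfolding Phi_def[of \<kappa> "x * _"] module_act_mult Phi_lift_L(2)[OF assms] module_act_lattice_gen[OF assms(1)]
  by (rule coords_lattice_vec[OF mu_neq_1[OF assms(1)]])

lemma theta_add: "theta \<kappa> (x + y) = theta \<kappa> x + theta \<kappa> y" "theta \<kappa> (x - y) = theta \<kappa> x - theta \<kappa> y"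
proof -
  show *: "theta \<kappa> (x + y) = theta \<kappa> x + theta \<kappa> y" for x y
    by (simp add: theta_def Phi_linear int_vec_linear)
  show "theta \<kappa> (x - y) = theta \<kappa> x - theta \<kappa> y"
    using *[of "x - y" y] by simp
qed

lemma theta_const_mult:
  assumes "\<kappa> \<noteq> 0" "x \<in> lift_L \<kappa>" "c \<in> series_ring"
  shows "theta \<kappa> (const c * x) = scale (ct c) (theta \<kappa> x)"
  using assms by (simp add: theta_def Phi_linear int_vec_linear Phi_lift_L del: mem_Sigma_iff)

lemma theta_mult_lattice_gen:
  assumes "\<kappa> \<noteq> 0" "x \<in> lift_L \<kappa>"
  shows "theta \<kappa> (x * lattice_gen \<kappa> g) = lattice_act 1 g (theta \<kappa> x)"
  using Phi_lift_L(1)[OF assms] unfolding theta_def Phi_mult_lattice_gen[OF assms]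
  by (intro lattice_act_series_ring) simp_all

lemma theta_one: "theta \<kappa> 1 = (1, 0, 0, 0, 0)"
  by (simp add: theta_def Phi_def module_act_simps)

lemma lattice_act_zero: "lattice_act q g 0 = 0"
  by (cases g; simp add: vec5_zero Let_def)

text \<open>The kernel of \<open>theta\<close> in the lattice is closed under right multiplication.\<close>

lemma theta_mult_eq_0:
  assumes "\<kappa> \<noteq> 0" "x \<in> lift_L \<kappa>" "theta \<kappa> x = 0" "y \<in> lift_L \<kappa>"
  shows "theta \<kappa> (x * y) = 0"
proof -
  have "x * y \<in> {x \<in> lift_L \<kappa>. theta \<kappa> x = 0}"
  proof (rule lift_L_right_induct[OF assms(1,4)])
    fix x c assume "x \<in> {x \<in> lift_L \<kappa>. theta \<kappa> x = 0}" "c \<in> series_ring"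
    then show "x * const c \<in> {x \<in> lift_L \<kappa>. theta \<kappa> x = 0}"
      using theta_const_mult[OF assms(1)] lift_L_closed(3,5)
      by (auto simp flip: const_commute)
  qed (use assms in \<open>auto simp: lift_L_closed lattice_gen_lift_L theta_add theta_mult_lattice_gen lattice_act_zero\<close>)
  then show ?thesis by simp
qed

section \<open>The limit algebra\<close>

text \<open>The limit of (the class of) an element of the free algebra; it is meaningful on \<open>lift_L\<close>.\<close>

definition limit_map :: "real \<Rightarrow> free_alg \<Rightarrow> free_alg set set" where
  "limit_map \<kappa> x = limit \<kappa> (SU_class \<kappa> x)"

lemma L_ring_simps:
  "carrier (L_ring \<kappa>) = SU_class \<kappa> ` lift_L \<kappa>"
  "SU_class \<kappa> x \<oplus>\<^bsub>L_ring \<kappa>\<^esub> SU_class \<kappa> y = SU_class \<kappa> (x + y)"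
  "SU_class \<kappa> x \<otimes>\<^bsub>L_ring \<kappa>\<^esub> SU_class \<kappa> y = SU_class \<kappa> (x * y)"
  "\<one>\<^bsub>L_ring \<kappa>\<^esub> = SU_class \<kappa> 1" "\<zero>\<^bsub>L_ring \<kappa>\<^esub> = SU_class \<kappa> 0"
  by (simp_all add: L_ring_def lattice_L_eq SU_class_simps SU_class_0)

lemma limit_map_hom:
  assumes "x \<in> lift_L \<kappa>" "y \<in> lift_L \<kappa>"
  shows "limit_map \<kappa> (x + y) = limit_map \<kappa> x \<oplus>\<^bsub>E_kappa \<kappa>\<^esub> limit_map \<kappa> y"
    "limit_map \<kappa> (x * y) = limit_map \<kappa> x \<otimes>\<^bsub>E_kappa \<kappa>\<^esub> limit_map \<kappa> y"
    "limit_map \<kappa> (x - y) = limit_map \<kappa> x \<ominus>\<^bsub>E_kappa \<kappa>\<^esub> limit_map \<kappa> y"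
    "limit_map \<kappa> 1 = \<one>\<^bsub>E_kappa \<kappa>\<^esub>" "limit_map \<kappa> 0 = \<zero>\<^bsub>E_kappa \<kappa>\<^esub>"
    "limit_map \<kappa> x \<in> carrier (E_kappa \<kappa>)"
proof -
  interpret E: ring "E_kappa \<kappa>" by (rule ring_E_kappa)
  have "limit \<kappa> \<in> ring_hom (L_ring \<kappa>) (E_kappa \<kappa>)"
    using ideal.rcos_ring_hom[OF ideal_hL] unfolding E_kappa_def limit_def[abs_def] .
  note hom = ring_hom_memE[OF this] ring_hom_zero[OF this ring_L ring_E_kappa]
  have car: "limit_map \<kappa> x \<in> carrier (E_kappa \<kappa>)" if "x \<in> lift_L \<kappa>" for x
    using that hom(1) by (simp add: limit_map_def L_ring_simps)
  have add: "limit_map \<kappa> (x + y) = limit_map \<kappa> x \<oplus>\<^bsub>E_kappa \<kappa>\<^esub> limit_map \<kappa> y" if "x \<in> lift_L \<kappa>" "y \<in> lift_L \<kappa>" for x y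
    using that hom(3)[of "SU_class \<kappa> x" "SU_class \<kappa> y"] by (simp add: limit_map_def L_ring_simps)
  show "limit_map \<kappa> (x + y) = limit_map \<kappa> x \<oplus>\<^bsub>E_kappa \<kappa>\<^esub> limit_map \<kappa> y"
    "limit_map \<kappa> x \<in> carrier (E_kappa \<kappa>)" using assms add car by simp_all
  show "limit_map \<kappa> (x * y) = limit_map \<kappa> x \<otimes>\<^bsub>E_kappa \<kappa>\<^esub> limit_map \<kappa> y"
    using assms hom(2)[of "SU_class \<kappa> x" "SU_class \<kappa> y"] by (simp add: limit_map_def L_ring_simps)
  show "limit_map \<kappa> 1 = \<one>\<^bsub>E_kappa \<kappa>\<^esub>" "limit_map \<kappa> 0 = \<zero>\<^bsub>E_kappa \<kappa>\<^esub>"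
    using hom(4,5) by (simp_all add: limit_map_def L_ring_simps)
  have "limit_map \<kappa> (- y) = \<ominus>\<^bsub>E_kappa \<kappa>\<^esub> limit_map \<kappa> y"
  proof (rule E.minus_equality[symmetric])
    show "limit_map \<kappa> (- y) \<oplus>\<^bsub>E_kappa \<kappa>\<^esub> limit_map \<kappa> y = \<zero>\<^bsub>E_kappa \<kappa>\<^esub>"
      using add[of "- y" y] assms hom(5) by (simp add: lift_L_closed limit_map_def L_ring_simps)
  qed (use assms car lift_L_closed in auto)
  then show "limit_map \<kappa> (x - y) = limit_map \<kappa> x \<ominus>\<^bsub>E_kappa \<kappa>\<^esub> limit_map \<kappa> y"
    using add[of x "- y"] assms by (simp add: a_minus_def lift_L_closed)
qed

lemma carrier_E_kappa: "carrier (E_kappa \<kappa>) = limit_map \<kappa> ` lift_L \<kappa>"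
  by (auto simp: E_kappa_def FactRing_def A_RCOSETS_def' L_ring_simps limit_map_def limit_def)

lemma hL_eq: "hL \<kappa> = SU_class \<kappa> ` (\<lambda>y. const fls_X * y) ` lift_L \<kappa>"
  by (simp add: hL_def lattice_L_eq image_image SU_class_simps)

lemma limit_map_eq_iff:
  assumes "x \<in> lift_L \<kappa>" "y \<in> lift_L \<kappa>"
  shows "limit_map \<kappa> x = limit_map \<kappa> y \<longleftrightarrow> (\<exists>z\<in>lift_L \<kappa>. x - y - const fls_X * z \<in> SU_ideal \<kappa>)"
proof -
  interpret L: ring "L_ring \<kappa>" by (rule ring_L)
  have "\<ominus>\<^bsub>L_ring \<kappa>\<^esub> SU_class \<kappa> y = SU_class \<kappa> (- y)"
    by (rule L.minus_equality) (use assms in \<open>auto simp: L_ring_simps lift_L_closed\<close>)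
  then have "SU_class \<kappa> x \<ominus>\<^bsub>L_ring \<kappa>\<^esub> SU_class \<kappa> y = SU_class \<kappa> (x - y)"
    by (simp add: a_minus_def L_ring_simps)
  moreover have "limit_map \<kappa> x = limit_map \<kappa> y \<longleftrightarrow> SU_class \<kappa> x \<ominus>\<^bsub>L_ring \<kappa>\<^esub> SU_class \<kappa> y \<in> hL \<kappa>"
    unfolding limit_map_def limit_def
    by (rule L.quotient_eq_iff_same_a_r_cos[symmetric]) (use assms ideal_hL in \<open>auto simp: L_ring_simps\<close>)
  ultimately show ?thesis
    by (auto simp: hL_eq SU_class_eq_iff)
qed

lemma theta_eq_of_limit_map_eq:
  assumes "\<kappa> \<noteq> 0" "x \<in> lift_L \<kappa>" "y \<in> lift_L \<kappa>" "limit_map \<kappa> x = limit_map \<kappa> y"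
  shows "theta \<kappa> x = theta \<kappa> y"
proof -
  obtain z where z: "z \<in> lift_L \<kappa>" "x - y - const fls_X * z \<in> SU_ideal \<kappa>"
    using assms limit_map_eq_iff by blast
  have "theta \<kappa> (x - y - const fls_X * z) = 0"
    using SU_ideal_acts_zero[OF z(2)] by (simp add: theta_def Phi_def vec5_zero)
  moreover have "theta \<kappa> (const fls_X * z) = 0"
    using theta_const_mult[OF assms(1) z(1), of fls_X] by simp
  ultimately show ?thesis by (simp add: theta_add)
qed

text \<open>Power series vectors without constant terms are divisible by \<open>h\<close>.\<close>

lemma int_vec_eq_X_scale:
  assumes "z \<in> int_vec" "vmap ct z = 0"
  obtains v where "v \<in> int_vec" "z = scale fls_X v"
proof -
  obtain z0 z1 z2 z3 z4 where z: "z = (z0, z1, z2, z3, z4)" by (cases z)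
  then have zi: "z0 \<in> series_ring" "z1 \<in> series_ring" "z2 \<in> series_ring" "z3 \<in> series_ring" "z4 \<in> series_ring"
    "ct z0 = 0" "ct z1 = 0" "ct z2 = 0" "ct z3 = 0" "ct z4 = 0"
    using assms by (simp_all add: vec5_zero)
  obtain v0 where v0: "v0 \<in> series_ring" "z0 = fls_X * v0" using series_ring_eq_X_times zi(1,6) .
  obtain v1 where v1: "v1 \<in> series_ring" "z1 = fls_X * v1" using series_ring_eq_X_times zi(2,7) .
  obtain v2 where v2: "v2 \<in> series_ring" "z2 = fls_X * v2" using series_ring_eq_X_times zi(3,8) .
  obtain v3 where v3: "v3 \<in> series_ring" "z3 = fls_X * v3" using series_ring_eq_X_times zi(4,9) .
  obtain v4 where v4: "v4 \<in> series_ring" "z4 = fls_X * v4" using series_ring_eq_X_times zi(5,10) .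
  show ?thesis
    by (rule that[of "(v0, v1, v2, v3, v4)"]) (simp_all add: z v0 v1 v2 v3 v4)
qed

lemma lattice_elem_lift_L:
  assumes "\<kappa> \<noteq> 0" "z \<in> int_vec"
  shows "lattice_elem \<kappa> z \<in> lift_L \<kappa>"
proof -
  obtain z0 z1 z2 z3 z4 where z: "z = (z0, z1, z2, z3, z4)" by (cases z)
  show ?thesis
    unfolding z lattice_elem_eq using assms(2)[unfolded z]
    by (intro lift_L_closed lattice_gen_lift_L[OF assms(1)]) auto
qed

lemma module_act_lin: "module_act q (1, 0, 0, 0, 0) (lin v) = v"
  by (cases v) (simp add: module_act_add module_act_simps module_act_const act_one vec5_zero)

lemma Phi_lattice_elem: "\<kappa> \<noteq> 0 \<Longrightarrow> Phi \<kappa> (lattice_elem \<kappa> z) = z"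
  unfolding Phi_def lattice_elem_def module_act_lin by (rule coords_lattice_vec[OF mu_neq_1])

lemma lattice_elem_zero: "lattice_elem \<kappa> 0 = 0"
  using lattice_elem_linear(2)[of \<kappa> 0 0] by simp

lemma limit_map_lattice_elem_cong:
  assumes "\<kappa> \<noteq> 0" "u \<in> int_vec" "v \<in> int_vec" "vmap ct u = vmap ct v"
  shows "limit_map \<kappa> (lattice_elem \<kappa> u) = limit_map \<kappa> (lattice_elem \<kappa> v)"
proof -
  have "u + - v \<in> int_vec" "vmap ct (u + - v) = 0"
    using assms by (simp_all only: int_vec_linear) simp
  then obtain z where z: "z \<in> int_vec" "u + - v = scale fls_X z"
    by (rule int_vec_eq_X_scale)
  have "lattice_elem \<kappa> u - lattice_elem \<kappa> v - const fls_X * lattice_elem \<kappa> z = 0"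
    unfolding lattice_elem_linear[symmetric] z(2)[symmetric] by (simp add: lattice_elem_zero)
  then show ?thesis
    using SU_ideal_closed(1) z(1) assms(1-3)
    by (intro iffD2[OF limit_map_eq_iff] bexI[of _ "lattice_elem \<kappa> z"] lattice_elem_lift_L)
      (simp_all only: not_False_eq_True)
qed

lemma limit_map_zeroI:
  assumes "x \<in> lift_L \<kappa>" "y \<in> lift_L \<kappa>" "x - const (mu \<kappa> - 1) * y \<in> SU_ideal \<kappa>"
  shows "limit_map \<kappa> x = limit_map \<kappa> 0"
proof -
  have "x - 0 - const fls_X * (const (nu \<kappa>) * y) \<in> SU_ideal \<kappa>"
    using assms(3) by (simp add: nu_props(3) const_simps mult.assoc)
  moreover have "const (nu \<kappa>) * y \<in> lift_L \<kappa>"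
    using assms(2) by (intro lift_L_closed nu_props)
  ultimately show ?thesis
    using limit_map_eq_iff[OF assms(1) lift_L_closed(6)] by blast
qed

text \<open>The relations of the limit algebra in terms of \<open>\<sigma>, \<rho>, S, P\<close>. Each one is a
  combination of relations of the quantum group, divided by a power of \<open>\<mu> - 1\<close>, up to a multiple
  of \<open>\<mu> - 1\<close>.\<close>

lemma limit_relations:
  fixes \<kappa> :: real
  assumes "\<kappa> \<noteq> 0"
  defines "s \<equiv> lattice_gen \<kappa> LS" and "r \<equiv> lattice_gen \<kappa> LR" and "S \<equiv> lattice_gen \<kappa> LD" and "P \<equiv> lattice_gen \<kappa> LP"
  shows "limit_map \<kappa> (s * r - r * s) = limit_map \<kappa> 0"
    "limit_map \<kappa> (s * P - P * s) = limit_map \<kappa> 0"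
    "limit_map \<kappa> (r * P - P * r) = limit_map \<kappa> 0"
    "limit_map \<kappa> (S * P - P * S - 2 * (P * s)) = limit_map \<kappa> 0"
    "limit_map \<kappa> (S * r - r * S - 2 * (r * s)) = limit_map \<kappa> 0"
    "limit_map \<kappa> (S * s - s * S - 2 * (r * r)) = limit_map \<kappa> 0"
    "limit_map \<kappa> (s * s - r * r - 1) = limit_map \<kappa> 0"
proof -
  define d i where "d = const (mu \<kappa> - 1)" and "i = const (1 / (mu \<kappa> - 1))"
  have id: "i * d = 1" "d * i = 1"
    using mu_neq_1[OF assms(1)] by (simp_all add: d_def i_def flip: const_simps)
  have M: "const (mu \<kappa>) = 1 + d" by (simp add: d_def const_simps)
  have central: "x * d = d * x" "x * i = i * x" for x
    by (simp_all add: d_def i_def const_commute)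
  have atoms: "gen Sig = s" "gen Rho = r" "gen Sig_star = s - d * S" "gen Rho_star = d * P - r"
    using id by (simp_all add: s_def r_def S_def P_def lattice_gen_def flip: i_def mult.assoc)
  have rules: "x * d = d * x" "x * (d * y) = d * (x * y)" "x * i = i * x" "x * (i * y) = i * (x * y)"
    for x y
    using central[of x] by (simp_all flip: mult.assoc)
  have cancel: "i * (d * x) = x" "d * (i * x) = x" for x
    using id by (simp_all flip: mult.assoc)
  note N = SU_relations_mem[of \<kappa>, unfolded atoms M]
  note calc = algebra_simps rules[of s] rules[of r] rules[of S] rules[of P] cancel id power2_eq_square mult_2
  have L: "s \<in> lift_L \<kappa>" "r \<in> lift_L \<kappa>" "S \<in> lift_L \<kappa>" "P \<in> lift_L \<kappa>" "d \<in> lift_L \<kappa>"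
    unfolding s_def r_def S_def P_def d_def by (intro lattice_gen_lift_L assms lift_L_closed; simp)+
  note zero = limit_map_zeroI[where \<kappa> = \<kappa>, folded d_def]
  \<comment> \<open>\<open>NP\<close> is the sum of the commutation rules of \<open>\<rho>\<close> and \<open>\<rho>\<^sup>*\<close> with \<open>\<sigma>\<close>, divided by
    \<open>d\<close>.\<close>
  define Nr NP where "Nr = (1 + d) * (r * s) - s * r" and "NP = (1 + d) * (P * s) - s * P"
  have Nr: "Nr \<in> SU_ideal \<kappa>" using N(2) by (simp add: Nr_def)
  have NP: "NP \<in> SU_ideal \<kappa>"
  proof -
    have "NP = i * ((1 + d) * (r * s) - s * r + ((1 + d) * ((d * P - r) * s) - s * (d * P - r)))"
      by (simp add: calc NP_def)
    then show ?thesis using SU_ideal_closed(3)[OF SU_ideal_closed(2)[OF N(2,3)]] by simp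
  qed
  show "limit_map \<kappa> (s * r - r * s) = limit_map \<kappa> 0"
  proof (rule zero[where y = "r * s"])
    have "s * r - r * s - d * (r * s) = - 1 * Nr" by (simp add: Nr_def calc)
    then show "s * r - r * s - d * (r * s) \<in> SU_ideal \<kappa>"
      using SU_ideal_closed(3)[OF Nr] by (simp only:)
  qed (use L in \<open>auto intro!: lift_L_closed\<close>)
  show "limit_map \<kappa> (s * P - P * s) = limit_map \<kappa> 0"
  proof (rule zero[where y = "P * s"])
    have "s * P - P * s - d * (P * s) = - 1 * NP" by (simp add: NP_def calc)
    then show "s * P - P * s - d * (P * s) \<in> SU_ideal \<kappa>"
      using SU_ideal_closed(3)[OF NP] by (simp only:)
  qed (use L in \<open>auto intro!: lift_L_closed\<close>)
  show "limit_map \<kappa> (r * P - P * r) = limit_map \<kappa> 0"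
  proof (rule zero[where y = 0])
    have "r * P - P * r - d * 0 = i * (r * (d * P - r) - (d * P - r) * r)" by (simp add: calc)
    then show "r * P - P * r - d * 0 \<in> SU_ideal \<kappa>"
      using SU_ideal_closed(3)[OF N(1)] by simp
  qed (use L in \<open>auto intro!: lift_L_closed\<close>)
  show "limit_map \<kappa> (S * P - P * S - 2 * (P * s)) = limit_map \<kappa> 0"
  proof (rule zero[where y = "P * s - S * P"])
    have "S * P - P * S - 2 * (P * s) - d * (P * s - S * P) = - i * (i * ((1 + d) * ((s - d * S) * r) - r * (s - d * S)
      + ((1 + d) * ((s - d * S) * (d * P - r)) - (d * P - r) * (s - d * S)))) - i * (1 + d) * NP"
      by (simp add: calc NP_def)
    also have "\<dots> \<in> SU_ideal \<kappa>" by (intro SU_ideal_closed(2,3) SU_ideal_diff(1) NP N(4,5))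
    finally show "S * P - P * S - 2 * (P * s) - d * (P * s - S * P) \<in> SU_ideal \<kappa>" .
  qed (use L in \<open>auto intro!: lift_L_closed\<close>)
  show "limit_map \<kappa> (S * r - r * S - 2 * (r * s)) = limit_map \<kappa> 0"
  proof (rule zero[where y = "r * s - S * r"])
    have "S * r - r * S - 2 * (r * s) - d * (r * s - S * r) =
      - i * ((1 + d) * ((s - d * S) * r) - r * (s - d * S)) - i * (1 + d) * Nr"
      by (simp add: calc Nr_def)
    also have "\<dots> \<in> SU_ideal \<kappa>" by (intro SU_ideal_closed(2,3) SU_ideal_diff(1) Nr N(4,5))
    finally show "S * r - r * S - 2 * (r * s) - d * (r * s - S * r) \<in> SU_ideal \<kappa>" .
  qed (use L in \<open>auto intro!: lift_L_closed\<close>)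
  show "limit_map \<kappa> (S * s - s * S - 2 * (r * r)) = limit_map \<kappa> 0"
  proof (rule zero[where y = "r * r - (2 + d) * (r * P)"])
    have "S * s - s * S - 2 * (r * r) - d * (r * r - (2 + d) * (r * P)) =
      i * ((s * (s - d * S) + (1 + d)\<^sup>2 * (r * (d * P - r)) - 1) - ((s - d * S) * s + r * (d * P - r) - 1))"
      by (simp add: calc)
    also have "\<dots> \<in> SU_ideal \<kappa>" by (intro SU_ideal_closed(3) SU_ideal_diff N(6,7))
    finally show "S * s - s * S - 2 * (r * r) - d * (r * r - (2 + d) * (r * P)) \<in> SU_ideal \<kappa>" .
  qed (use L in \<open>auto intro!: lift_L_closed\<close>)
  show "limit_map \<kappa> (s * s - r * r - 1) = limit_map \<kappa> 0"
  proof (rule zero[where y = "S * s - r * P"])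
    have "s * s - r * r - 1 - d * (S * s - r * P) = (s - d * S) * s + r * (d * P - r) - 1"
      by (simp add: calc)
    then show "s * s - r * r - 1 - d * (S * s - r * P) \<in> SU_ideal \<kappa>"
      using N(7) by (simp only:)
  qed (use L in \<open>auto intro!: lift_L_closed\<close>)
qed

section \<open>The limit right ideal\<close>

text \<open>If \<open>s, r, S, P\<close> are \<open>\<sigma>, \<rho>, S, P\<close>, then \<open>a, a', w, w'\<close> have the same limits as
  \<open>a, a\<^sup>*, 2\<kappa>w, 2\<kappa>w\<^sup>*\<close>. There are 16 products of two of the
  elements \<open>s, r, S, P\<close>; the seven relations and the nine generators determine all of them modulo
  \<open>J\<close>. The coefficients in the proof solve this linear system. The set \<open>J\<close> need not be closed
  under multiplication, as the relations and generators enter linearly only.\<close>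

lemma reduction_table:
  fixes s r S P :: "'a::ring_1" and J :: "'a set"
  assumes add: "\<And>x y. x \<in> J \<Longrightarrow> y \<in> J \<Longrightarrow> x + y \<in> J"
    and uminus: "\<And>x. x \<in> J \<Longrightarrow> - x \<in> J"
    and quarter: "\<And>x. 4 * x \<in> J \<Longrightarrow> x \<in> J"
  assumes relations: "s * r - r * s \<in> J" "s * P - P * s \<in> J" "r * P - P * r \<in> J"
    "S * P - P * S - 2 * (P * s) \<in> J" "S * r - r * S - 2 * (r * s) \<in> J"
    "S * s - s * S - 2 * (r * r) \<in> J" "s * s - r * r - 1 \<in> J"
  defines "a \<equiv> s + r" and "a' \<equiv> s - r" and "w \<equiv> r - S - P" and "w' \<equiv> S - P - r"
  assumes generators: "a * a + a - a' - 1 \<in> J" "a' * a' + a' - a - 1 \<in> J"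
    "(a + 1) * w \<in> J" "(a' + 1) * w \<in> J" "(a + 1) * w' \<in> J" "(a' + 1) * w' \<in> J"
    "w * w - 2 * w \<in> J" "w' * w' + 2 * w' \<in> J" "w * w' - 2 * w - 4 * (a' - 1) \<in> J"
  shows
    "s * s - 1 \<in> J"
    "r * s + r \<in> J"
    "S * s + S \<in> J"
    "P * s + P \<in> J"
    "s * r + r \<in> J"
    "r * r \<in> J"
    "S * r + 2 * r \<in> J"
    "P * r \<in> J"
    "s * S + S \<in> J"
    "r * S \<in> J"
    "S * S - (2 - 2 * s) \<in> J"
    "P * S \<in> J"
    "s * P + P \<in> J"
    "r * P \<in> J"
    "S * P + 2 * P \<in> J"
    "P * P - (2 * s - 2 * S - 2) \<in> J"
proof -
  define n1 n2 n3 n4 n5 n6 n7 where rel_defs: "n1 = s * r - r * s" "n2 = s * P - P * s" "n3 = r * P - P * r"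
    "n4 = S * P - P * S - 2 * (P * s)" "n5 = S * r - r * S - 2 * (r * s)"
    "n6 = S * s - s * S - 2 * (r * r)" "n7 = s * s - r * r - 1"
  define j1 j2 j3 j4 j5 j6 j7 j8 j9 where gen_defs:
    "j1 = a * a + a - a' - 1" "j2 = a' * a' + a' - a - 1"
    "j3 = (a + 1) * w" "j4 = (a' + 1) * w" "j5 = (a + 1) * w'" "j6 = (a' + 1) * w'"
    "j7 = w * w - 2 * w" "j8 = w' * w' + 2 * w'" "j9 = w * w' - 2 * w - 4 * (a' - 1)"
  note mem = relations[folded rel_defs] generators[folded gen_defs]
  note defs = rel_defs gen_defs a_def a'_def w_def w'_def
  have numerals: "2 * x = x + x" "3 * x = x + x + x" "4 * x = x + x + x + x" for x :: 'a
    by (simp_all only: numeral_Bit0 numeral_Bit1 numeral_One distrib_right mult_1_left add.assoc)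
  have diff: "x - y \<in> J" if "x \<in> J" "y \<in> J" for x y
    using add[OF that(1) uminus[OF that(2)]] by simp
  have multiple: "2 * x \<in> J" "3 * x \<in> J" "4 * x \<in> J" if "x \<in> J" for x
    using that by (simp_all add: numerals add)
  note closed = add diff multiple uminus
  have scaled: "x \<in> J" if "4 * x = y" "y \<in> J" for x y
    using quarter that by simp
  show "s * s - 1 \<in> J"
    by (rule scaled[of _ "j1 + j2 + 2 * n7"],
        simp add: defs numerals algebra_simps, intro closed mem)
  show "r * s + r \<in> J"
    by (rule scaled[of _ "j1 - j2 - 2 * n1"],
        simp add: defs numerals algebra_simps, intro closed mem)
  show "S * s + S \<in> J"
    by (rule scaled[of _ "3 * j1 + j2 + j5 + j6 + 2 * n1 + 4 * n6 - j3 - j4 - 4 * n7"],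
        simp add: defs numerals algebra_simps, intro closed mem)
  show "P * s + P \<in> J"
    by (rule scaled[of _ "- j3 - j4 - j5 - j6 - 4 * n2"],
        simp add: defs numerals algebra_simps, intro closed mem)
  show "s * r + r \<in> J"
    by (rule scaled[of _ "j1 + 2 * n1 - j2"],
        simp add: defs numerals algebra_simps, intro closed mem)
  show "r * r \<in> J"
    by (rule scaled[of _ "j1 + j2 - 2 * n7"],
        simp add: defs numerals algebra_simps, intro closed mem)
  show "S * r + 2 * r \<in> J"
    by (rule scaled[of _ "3 * j1 + j4 + j5 + 4 * n5 - j2 - j3 - j6 - 4 * n1 - 2 * n7"],
        simp add: defs numerals algebra_simps, intro closed mem)
  show "P * r \<in> J"
    by (rule scaled[of _ "j4 + j6 - j3 - j5 - 4 * n3"],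
        simp add: defs numerals algebra_simps, intro closed mem)
  show "s * S + S \<in> J"
    by (rule scaled[of _ "j1 + j5 + j6 + 2 * n1 - j2 - j3 - j4"],
        simp add: defs numerals algebra_simps, intro closed mem)
  show "r * S \<in> J"
    by (rule scaled[of _ "j1 + j2 + j4 + j5 - j3 - j6 - 2 * n7"],
        simp add: defs numerals algebra_simps, intro closed mem)
  show "S * S - (2 - 2 * s) \<in> J"
    by (rule scaled[of _ "3 * j1 + j4 + j5 + j7 + j8 + 2 * n4 + 4 * n5 - j2 - 3 * j3 - 3 * j6 - 2 * j9 - 4 * n1 - 4 * n2 - 2 * n3 - 2 * n7"],
        simp add: defs numerals algebra_simps, intro closed mem)
  show "P * S \<in> J"
    by (rule scaled[of _ "2 * j4 + 2 * j6 + j7 + 4 * n2 - j8 - 2 * n3 - 2 * n4"],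
        simp add: defs numerals algebra_simps, intro closed mem)
  show "s * P + P \<in> J"
    by (rule scaled[of _ "- j3 - j4 - j5 - j6"],
        simp add: defs numerals algebra_simps, intro closed mem)
  show "r * P \<in> J"
    by (rule scaled[of _ "j4 + j6 - j3 - j5"],
        simp add: defs numerals algebra_simps, intro closed mem)
  show "S * P + 2 * P \<in> J"
    by (rule scaled[of _ "j7 + 2 * n4 - 2 * j3 - 2 * j5 - j8 - 4 * n2 - 2 * n3"],
        simp add: defs numerals algebra_simps, intro closed mem)
  show "P * P - (2 * s - 2 * S - 2) \<in> J"
    by (rule scaled[of _ "j3 + j4 + j5 + j6 + j7 + j8 + 2 * j9 + 4 * n2 + 2 * n3 - 2 * n4"],
        simp add: defs numerals algebra_simps, intro closed mem)
qed

lemma limit_map_zero_one: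
  "limit_map \<kappa> 0 = \<zero>\<^bsub>E_kappa \<kappa>\<^esub>" "limit_map \<kappa> 1 = \<one>\<^bsub>E_kappa \<kappa>\<^esub>"
  using limit_map_hom(4,5)[OF lift_L_closed(6,6)] by auto

text \<open>The preimage of a right ideal of the limit algebra in the lift of the lattice.\<close>

definition lift_J :: "real \<Rightarrow> free_alg set set set \<Rightarrow> free_alg set" where
  "lift_J \<kappa> J = {x \<in> lift_L \<kappa>. limit_map \<kappa> x \<in> J}"

lemma lift_J_closed:
  assumes "right_ideal J (E_kappa \<kappa>)"
  shows "x \<in> lift_J \<kappa> J \<Longrightarrow> y \<in> lift_J \<kappa> J \<Longrightarrow> x + y \<in> lift_J \<kappa> J"
    "x \<in> lift_J \<kappa> J \<Longrightarrow> y \<in> lift_L \<kappa> \<Longrightarrow> x * y \<in> lift_J \<kappa> J"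
    "x \<in> lift_J \<kappa> J \<Longrightarrow> c \<in> series_ring \<Longrightarrow> const c * x \<in> lift_J \<kappa> J"
    "x \<in> lift_J \<kappa> J \<Longrightarrow> - x \<in> lift_J \<kappa> J"
    "x \<in> lift_L \<kappa> \<Longrightarrow> limit_map \<kappa> x = limit_map \<kappa> 0 \<Longrightarrow> x \<in> lift_J \<kappa> J"
    "4 * x \<in> lift_J \<kappa> J \<Longrightarrow> x \<in> lift_J \<kappa> J"
proof -
  note J = right_idealD[OF assms]
  show "x + y \<in> lift_J \<kappa> J" if "x \<in> lift_J \<kappa> J" "y \<in> lift_J \<kappa> J"
    using that J(3) by (simp add: lift_J_def lift_L_closed limit_map_hom)
  show mult: "x * y \<in> lift_J \<kappa> J" if "x \<in> lift_J \<kappa> J" "y \<in> lift_L \<kappa>" for x y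
    using that J(4) by (simp add: lift_J_def lift_L_closed limit_map_hom)
  show const: "const c * x \<in> lift_J \<kappa> J" if "x \<in> lift_J \<kappa> J" "c \<in> series_ring" for x c
    unfolding const_commute using that by (intro mult lift_L_closed)
  show "- x \<in> lift_J \<kappa> J" if "x \<in> lift_J \<kappa> J"
    using const[OF that, of "- 1"] by (simp add: const_simps)
  show "x \<in> lift_J \<kappa> J" if "x \<in> lift_L \<kappa>" "limit_map \<kappa> x = limit_map \<kappa> 0"
    using that J(2) by (simp add: lift_J_def limit_map_zero_one)
  show "x \<in> lift_J \<kappa> J" if "4 * x \<in> lift_J \<kappa> J"
  proof -
    have "const (1 / 4) * (4 * x) = x"
      using const_inverse[of 4] by (simp add: const_simps flip: mult.assoc)
    then show ?thesis using const[OF that, of "1 / 4"] by simp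
  qed
qed

text \<open>The given generators as limits of elements of the free algebra. The factor \<open>C = 1/(2\<kappa>)\<close> turns
  the numerical coefficients into those of \<open>reduction_table\<close>.\<close>

lemma limit_generators_eq:
  fixes \<kappa> :: real
  assumes "\<kappa> \<noteq> 0"
  defines "s \<equiv> lattice_gen \<kappa> LS" and "r \<equiv> lattice_gen \<kappa> LR" and "S \<equiv> lattice_gen \<kappa> LD" and "P \<equiv> lattice_gen \<kappa> LP"
  defines "a \<equiv> s + r" and "a' \<equiv> s - r" and "w \<equiv> r - S - P" and "w' \<equiv> S - P - r"
  defines "C \<equiv> const (fls_const (complex_of_real (1 / (2 * \<kappa>))))"
  shows "limit_generators (E_kappa \<kappa>) (scalar0 \<kappa>) \<kappa> (a0 \<kappa>) (a0' \<kappa>) (w0 \<kappa>) (w0' \<kappa>) =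
    limit_map \<kappa> ` {a * a + a - a' - 1, a' * a' + a' - a - 1,
      C * ((a + 1) * w), C * ((a' + 1) * w), C * ((a + 1) * w'), C * ((a' + 1) * w'),
      C * (C * (w * w - 2 * w)), C * (C * (w' * w' + 2 * w')),
      C * (C * (w * w' - 2 * w - 4 * (a' - 1)))}"
proof -
  let ?c = "fls_const (complex_of_real (1 / (2 * \<kappa>)))"
  note lat = lattice_elem_linear[symmetric] lattice_elem_unit[symmetric]
  have lattice: "a = lattice_elem \<kappa> (0, 1, 1, 0, 0)" "a' = lattice_elem \<kappa> (0, 1, - 1, 0, 0)"
    "C * w = lattice_elem \<kappa> (scale ?c (0, 0, 1, - 1, - 1))"
    "C * w' = lattice_elem \<kappa> (scale ?c (0, 0, - 1, 1, - 1))"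
    unfolding a_def a'_def w_def w'_def s_def r_def S_def P_def C_def lat
    by (simp_all add: zero_prod_def)
  have q: "mu \<kappa> \<in> series_ring" "nu \<kappa> \<in> series_ring" "ct (nu \<kappa>) = 1 / \<kappa>" by (simp_all add: nu_props)
  have elems: "a0 \<kappa> = limit_map \<kappa> a" "a0' \<kappa> = limit_map \<kappa> a'"
    "w0 \<kappa> = limit_map \<kappa> (C * w)" "w0' \<kappa> = limit_map \<kappa> (C * w')"
    unfolding a0_def a0'_def w0_def w0'_def limit_map_def[symmetric] lattice
      elem_lattice_elem(2,4)[OF assms(1)]
    unfolding elem_lattice_elem(1,3)[OF assms(1)]
    by (intro limit_map_lattice_elem_cong assms(1); use q in simp)+
  have L: "a \<in> lift_L \<kappa>" "a' \<in> lift_L \<kappa>" "C * w \<in> lift_L \<kappa>" "C * w' \<in> lift_L \<kappa>"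
    unfolding lattice by (intro lattice_elem_lift_L assms(1); simp)+
  define V V' where "V = C * w" and "V' = C * w'"
  have scalars: "C * 2 = const (fls_const (1 / \<kappa>))" "C * (C * 4) = const (fls_const (1 / \<kappa>\<^sup>2))"
    unfolding C_def by (simp_all add: fls_const_mult_const power2_eq_square flip: const_simps(2,8) fls_const_numeral)
  have C: "x * (C * y) = C * (x * y)" "x * C = C * x" for x y
  proof -
    show *: "x * C = C * x" for x unfolding C_def by (rule const_commute[symmetric])
    show "x * (C * y) = C * (x * y)" by (simp add: * flip: mult.assoc)
  qed
  have mult: "C * ((a + 1) * w) = (a + 1) * V" "C * ((a' + 1) * w) = (a' + 1) * V"
    "C * ((a + 1) * w') = (a + 1) * V'" "C * ((a' + 1) * w') = (a' + 1) * V'"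
    by (simp_all add: V_def V'_def C(1)[of "a + 1"] C(1)[of "a' + 1"])
  have mult2: "C * (C * (w * w - 2 * w)) = V * V - (C * 2) * V"
     "C * (C * (w' * w' + 2 * w')) = V' * V' + (C * 2) * V'"
     "C * (C * (w * w' - 2 * w - 4 * (a' - 1))) = V * V' - (C * 2) * V - (C * (C * 4)) * (a' - 1)"
    by (simp_all add: V_def V'_def C(1)[of w] C(1)[of w'] C(1)[of 2] algebra_simps)
  have L': "V \<in> lift_L \<kappa>" "V' \<in> lift_L \<kappa>" "const (fls_const c) \<in> lift_L \<kappa>" for c
    using L by (simp_all add: V_def V'_def lift_L_closed)
  show ?thesis
    unfolding mult mult2 unfolding scalars limit_generators_def elems V_def[symmetric] V'_def[symmetric] scalar0_def limit_map_def[symmetric]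
    by (simp add: limit_map_hom limit_map_zero_one L(1,2) L' lift_L_closed)
qed

lemma theta_generators:
  fixes \<kappa> :: real
  assumes "\<kappa> \<noteq> 0"
  defines "s \<equiv> lattice_gen \<kappa> LS" and "r \<equiv> lattice_gen \<kappa> LR" and "S \<equiv> lattice_gen \<kappa> LD" and "P \<equiv> lattice_gen \<kappa> LP"
  defines "a \<equiv> s + r" and "a' \<equiv> s - r" and "w \<equiv> r - S - P" and "w' \<equiv> S - P - r"
  shows "theta \<kappa> (a * a + a - a' - 1) = 0" "theta \<kappa> (a' * a' + a' - a - 1) = 0"
    "theta \<kappa> ((a + 1) * w) = 0" "theta \<kappa> ((a' + 1) * w) = 0"
    "theta \<kappa> ((a + 1) * w') = 0" "theta \<kappa> ((a' + 1) * w') = 0"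
    "theta \<kappa> (w * w - 2 * w) = 0" "theta \<kappa> (w' * w' + 2 * w') = 0"
    "theta \<kappa> (w * w' - 2 * w - 4 * (a' - 1)) = 0"
proof -
  have one: "1 \<in> lift_L \<kappa>" by (rule lift_L_closed)
  have mult: "theta \<kappa> (x * a) = lattice_act 1 LS (theta \<kappa> x) + lattice_act 1 LR (theta \<kappa> x)"
    "theta \<kappa> (x * a') = lattice_act 1 LS (theta \<kappa> x) - lattice_act 1 LR (theta \<kappa> x)"
    "theta \<kappa> (x * w) = lattice_act 1 LR (theta \<kappa> x) - lattice_act 1 LD (theta \<kappa> x) - lattice_act 1 LP (theta \<kappa> x)"
    "theta \<kappa> (x * w') = lattice_act 1 LD (theta \<kappa> x) - lattice_act 1 LP (theta \<kappa> x) - lattice_act 1 LR (theta \<kappa> x)"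
    if "x \<in> lift_L \<kappa>" for x
    using theta_mult_lattice_gen[OF assms(1) that]
    by (simp_all only: a_def a'_def w_def w'_def s_def r_def S_def P_def distrib_left
        right_diff_distrib theta_add)
  have single: "theta \<kappa> a = (0, 1, 1, 0, 0)" "theta \<kappa> a' = (0, 1, - 1, 0, 0)"
    "theta \<kappa> w = (0, 0, 1, - 1, - 1)" "theta \<kappa> w' = (0, 0, - 1, 1, - 1)"
    using mult[OF one] by (simp_all add: theta_one zero_prod_def)
  have L: "s \<in> lift_L \<kappa>" "r \<in> lift_L \<kappa>" "S \<in> lift_L \<kappa>" "P \<in> lift_L \<kappa>"
    unfolding s_def r_def S_def P_def by (intro lattice_gen_lift_L assms(1))+
  then have aL: "a \<in> lift_L \<kappa>" "a' \<in> lift_L \<kappa>" "w \<in> lift_L \<kappa>" "w' \<in> lift_L \<kappa>"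
    "a + 1 \<in> lift_L \<kappa>" "a' + 1 \<in> lift_L \<kappa>"
    unfolding a_def a'_def w_def w'_def by (simp_all add: lift_L_closed)
  have double: "theta \<kappa> (2 * x) = theta \<kappa> x + theta \<kappa> x"
    "theta \<kappa> (4 * x) = theta \<kappa> x + theta \<kappa> x + theta \<kappa> x + theta \<kappa> x" for x
  proof -
    show d: "theta \<kappa> (2 * x) = theta \<kappa> x + theta \<kappa> x" for x
      by (simp add: mult_2 theta_add)
    have "4 * x = 2 * (2 * x)" by (simp flip: mult.assoc)
    then show "theta \<kappa> (4 * x) = theta \<kappa> x + theta \<kappa> x + theta \<kappa> x + theta \<kappa> x"
      by (simp only: d add.assoc)
  qed
  have four: "theta \<kappa> 4 = (4, 0, 0, 0, 0)"
    using double(2)[of 1] by (simp add: theta_one)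
  note eval = theta_add mult aL single double four theta_one zero_prod_def
  show "theta \<kappa> (a * a + a - a' - 1) = 0" "theta \<kappa> (a' * a' + a' - a - 1) = 0"
    "theta \<kappa> ((a + 1) * w) = 0" "theta \<kappa> ((a' + 1) * w) = 0"
    "theta \<kappa> ((a + 1) * w') = 0" "theta \<kappa> ((a' + 1) * w') = 0"
    "theta \<kappa> (w * w - 2 * w) = 0" "theta \<kappa> (w' * w' + 2 * w') = 0"
    "theta \<kappa> (w * w' - 2 * w - 4 * (a' - 1)) = 0"
    by (simp_all add: eval Let_def)
qed

text \<open>The right ideal \<open>J\<close> on the right-hand side of the theorem.\<close>

abbreviation (input) limit_ideal :: "real \<Rightarrow> free_alg set set set" where
  "limit_ideal \<kappa> \<equiv> gen_right_ideal (E_kappa \<kappa>)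
      (limit_generators (E_kappa \<kappa>) (scalar0 \<kappa>) \<kappa> (a0 \<kappa>) (a0' \<kappa>) (w0 \<kappa>) (w0' \<kappa>))"

lemma generators_lift_L:
  fixes \<kappa> :: real
  assumes "\<kappa> \<noteq> 0"
  shows "limit_generators (E_kappa \<kappa>) (scalar0 \<kappa>) \<kappa> (a0 \<kappa>) (a0' \<kappa>) (w0 \<kappa>) (w0' \<kappa>)
    \<subseteq> limit_map \<kappa> ` {x \<in> lift_L \<kappa>. theta \<kappa> x = 0}"
proof -
  have L: "lattice_gen \<kappa> g \<in> lift_L \<kappa>" for g by (rule lattice_gen_lift_L[OF assms])
  show ?thesis
    unfolding limit_generators_eq[OF assms]
    by (rule image_mono, rule subsetI, elim insertE emptyE)
      (simp_all only: mem_Collect_eq lift_L_closed L series_ring_basic theta_const_mult[OF assms]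
        theta_generators[OF assms] scale_simps simp_thms)
qed

lemma right_ideal_limit_ideal:
  assumes "\<kappa> \<noteq> 0"
  shows "right_ideal (limit_ideal \<kappa>) (E_kappa \<kappa>)"
  using generators_lift_L[OF assms] limit_map_hom(6)
  by (intro right_ideal_gen_right_ideal[OF ring_E_kappa]) blast

lemma limit_ideal_theta:
  assumes "\<kappa> \<noteq> 0" "x \<in> lift_J \<kappa> (limit_ideal \<kappa>)"
  shows "theta \<kappa> x = 0"
proof -
  let ?K = "limit_map \<kappa> ` {x \<in> lift_L \<kappa>. theta \<kappa> x = 0}"
  have "right_ideal ?K (E_kappa \<kappa>)"
  proof (rule right_idealI[OF ring_E_kappa])
    show "?K \<subseteq> carrier (E_kappa \<kappa>)" unfolding carrier_E_kappa by auto
    show "\<zero>\<^bsub>E_kappa \<kappa>\<^esub> \<in> ?K"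
      using theta_add(2)[of \<kappa> 0 0]
      by (intro image_eqI[of _ _ 0]) (simp_all add: limit_map_zero_one lift_L_closed)
  next
    fix x y assume "x \<in> ?K" "y \<in> ?K"
    then obtain u v where "x = limit_map \<kappa> u" "u \<in> lift_L \<kappa>" "theta \<kappa> u = 0"
      "y = limit_map \<kappa> v" "v \<in> lift_L \<kappa>" "theta \<kappa> v = 0" by blast
    then show "x \<oplus>\<^bsub>E_kappa \<kappa>\<^esub> y \<in> ?K"
      by (intro image_eqI[of _ _ "u + v"]) (simp_all add: limit_map_hom lift_L_closed theta_add)
  next
    fix x y assume "x \<in> ?K" "y \<in> carrier (E_kappa \<kappa>)"
    then obtain u v where "x = limit_map \<kappa> u" "u \<in> lift_L \<kappa>" "theta \<kappa> u = 0"
      "y = limit_map \<kappa> v" "v \<in> lift_L \<kappa>" unfolding carrier_E_kappa by blast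
    then show "x \<otimes>\<^bsub>E_kappa \<kappa>\<^esub> y \<in> ?K"
      by (intro image_eqI[of _ _ "u * v"])
        (simp_all add: limit_map_hom lift_L_closed theta_mult_eq_0[OF assms(1)])
  qed
  then have "limit_ideal \<kappa> \<subseteq> ?K"
    using generators_lift_L[OF assms(1)] by (rule gen_right_ideal_minimal)
  then obtain y where y: "limit_map \<kappa> x = limit_map \<kappa> y" "y \<in> lift_L \<kappa>" "theta \<kappa> y = 0" "x \<in> lift_L \<kappa>"
    using assms(2) unfolding lift_J_def by blast
  show ?thesis
    unfolding theta_eq_of_limit_map_eq[OF assms(1) y(4,2,1)] by (rule y(3))
qed

lemma lattice_gen_products:
  fixes \<kappa> :: real
  assumes "\<kappa> \<noteq> 0"
  defines "s \<equiv> lattice_gen \<kappa> LS" and "r \<equiv> lattice_gen \<kappa> LR" and "S \<equiv> lattice_gen \<kappa> LD" and "P \<equiv> lattice_gen \<kappa> LP"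
  shows
    "s * s - 1 \<in> lift_J \<kappa> (limit_ideal \<kappa>)" "r * s + r \<in> lift_J \<kappa> (limit_ideal \<kappa>)"
    "S * s + S \<in> lift_J \<kappa> (limit_ideal \<kappa>)" "P * s + P \<in> lift_J \<kappa> (limit_ideal \<kappa>)"
    "s * r + r \<in> lift_J \<kappa> (limit_ideal \<kappa>)" "r * r \<in> lift_J \<kappa> (limit_ideal \<kappa>)"
    "S * r + 2 * r \<in> lift_J \<kappa> (limit_ideal \<kappa>)" "P * r \<in> lift_J \<kappa> (limit_ideal \<kappa>)"
    "s * S + S \<in> lift_J \<kappa> (limit_ideal \<kappa>)" "r * S \<in> lift_J \<kappa> (limit_ideal \<kappa>)"
    "S * S - (2 - 2 * s) \<in> lift_J \<kappa> (limit_ideal \<kappa>)" "P * S \<in> lift_J \<kappa> (limit_ideal \<kappa>)"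
    "s * P + P \<in> lift_J \<kappa> (limit_ideal \<kappa>)" "r * P \<in> lift_J \<kappa> (limit_ideal \<kappa>)"
    "S * P + 2 * P \<in> lift_J \<kappa> (limit_ideal \<kappa>)" "P * P - (2 * s - 2 * S - 2) \<in> lift_J \<kappa> (limit_ideal \<kappa>)"
proof -
  note closed = lift_J_closed[OF right_ideal_limit_ideal[OF assms(1)]]
  have L: "s \<in> lift_L \<kappa>" "r \<in> lift_L \<kappa>" "S \<in> lift_L \<kappa>" "P \<in> lift_L \<kappa>"
    unfolding s_def r_def S_def P_def by (intro lattice_gen_lift_L assms(1))+
  have rels: "s * r - r * s \<in> lift_J \<kappa> (limit_ideal \<kappa>)" "s * P - P * s \<in> lift_J \<kappa> (limit_ideal \<kappa>)"
    "r * P - P * r \<in> lift_J \<kappa> (limit_ideal \<kappa>)" "S * P - P * S - 2 * (P * s) \<in> lift_J \<kappa> (limit_ideal \<kappa>)"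
    "S * r - r * S - 2 * (r * s) \<in> lift_J \<kappa> (limit_ideal \<kappa>)" "S * s - s * S - 2 * (r * r) \<in> lift_J \<kappa> (limit_ideal \<kappa>)"
    "s * s - r * r - 1 \<in> lift_J \<kappa> (limit_ideal \<kappa>)"
    using limit_relations[OF assms(1), folded s_def r_def S_def P_def] L
    by (simp_all only: closed(5) lift_L_closed)
  note table = reduction_table[where J = "lift_J \<kappa> (limit_ideal \<kappa>)" and s = s and r = r and S = S and P = P]
  define C where "C = const (fls_const (complex_of_real (1 / (2 * \<kappa>))))"
  have cancel: "x \<in> lift_J \<kappa> (limit_ideal \<kappa>)" if "C * x \<in> lift_J \<kappa> (limit_ideal \<kappa>)" for x
  proof -
    have "const (fls_const (2 * \<kappa>)) * (C * x) = const (fls_const (2 * \<kappa>) * fls_const (complex_of_real (1 / (2 * \<kappa>)))) * x"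
      by (simp only: C_def const_simps mult.assoc)
    also have "\<dots> = x" using assms(1) by (simp add: const_simps)
    finally show ?thesis using closed(3)[OF that, of "fls_const (2 * \<kappa>)"] by simp
  qed
  have gens: "x \<in> lift_J \<kappa> (limit_ideal \<kappa>)"
    if "limit_map \<kappa> x \<in> limit_generators (E_kappa \<kappa>) (scalar0 \<kappa>) \<kappa> (a0 \<kappa>) (a0' \<kappa>) (w0 \<kappa>) (w0' \<kappa>)"
      "x \<in> lift_L \<kappa>" for x
    unfolding lift_J_def using that by (intro CollectI conjI subsetD[OF gen_right_ideal_incl])
  have CL: "C \<in> lift_L \<kappa>" unfolding C_def by (intro lift_L_closed series_ring_basic)
  note eq = limit_generators_eq[OF assms(1), folded s_def r_def S_def P_def C_def]
  have g1: "(s + r) * (s + r) + (s + r) - (s - r) - 1 \<in> lift_J \<kappa> (limit_ideal \<kappa>)"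
    "(s - r) * (s - r) + (s - r) - (s + r) - 1 \<in> lift_J \<kappa> (limit_ideal \<kappa>)"
    by (rule gens, subst eq, rule imageI,
        simp only: insert_iff simp_thms, intro lift_L_closed L CL)+
  have g2: "(s + r + 1) * (r - S - P) \<in> lift_J \<kappa> (limit_ideal \<kappa>)" "(s - r + 1) * (r - S - P) \<in> lift_J \<kappa> (limit_ideal \<kappa>)"
    "(s + r + 1) * (S - P - r) \<in> lift_J \<kappa> (limit_ideal \<kappa>)" "(s - r + 1) * (S - P - r) \<in> lift_J \<kappa> (limit_ideal \<kappa>)"
    by (rule cancel, rule gens, subst eq, rule imageI,
        simp only: insert_iff simp_thms, intro lift_L_closed L CL)+
  have g3: "(r - S - P) * (r - S - P) - 2 * (r - S - P) \<in> lift_J \<kappa> (limit_ideal \<kappa>)"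
    "(S - P - r) * (S - P - r) + 2 * (S - P - r) \<in> lift_J \<kappa> (limit_ideal \<kappa>)"
    "(r - S - P) * (S - P - r) - 2 * (r - S - P) - 4 * (s - r - 1) \<in> lift_J \<kappa> (limit_ideal \<kappa>)"
    by (rule cancel, rule cancel, rule gens, subst eq, rule imageI,
        simp only: insert_iff simp_thms, intro lift_L_closed L CL)+
  show
    "s * s - 1 \<in> lift_J \<kappa> (limit_ideal \<kappa>)" "r * s + r \<in> lift_J \<kappa> (limit_ideal \<kappa>)"
    "S * s + S \<in> lift_J \<kappa> (limit_ideal \<kappa>)" "P * s + P \<in> lift_J \<kappa> (limit_ideal \<kappa>)"
    "s * r + r \<in> lift_J \<kappa> (limit_ideal \<kappa>)" "r * r \<in> lift_J \<kappa> (limit_ideal \<kappa>)"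
    "S * r + 2 * r \<in> lift_J \<kappa> (limit_ideal \<kappa>)" "P * r \<in> lift_J \<kappa> (limit_ideal \<kappa>)"
    "s * S + S \<in> lift_J \<kappa> (limit_ideal \<kappa>)" "r * S \<in> lift_J \<kappa> (limit_ideal \<kappa>)"
    "S * S - (2 - 2 * s) \<in> lift_J \<kappa> (limit_ideal \<kappa>)" "P * S \<in> lift_J \<kappa> (limit_ideal \<kappa>)"
    "s * P + P \<in> lift_J \<kappa> (limit_ideal \<kappa>)" "r * P \<in> lift_J \<kappa> (limit_ideal \<kappa>)"
    "S * P + 2 * P \<in> lift_J \<kappa> (limit_ideal \<kappa>)" "P * P - (2 * s - 2 * S - 2) \<in> lift_J \<kappa> (limit_ideal \<kappa>)"
    by (rule table; (fact rels | fact g1 | fact g2 | fact g3 |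
        erule (1) closed(1) | erule closed(4) | erule closed(6)))+
qed

text \<open>Modulo \<open>J\<close>, the span of \<open>1, \<sigma>, \<rho>, S, P\<close> is closed under right multiplication, and the
  multiplication is given by the matrices at \<open>q = 1\<close>.\<close>

lemma lattice_elem_mult_lattice_gen:
  assumes "\<kappa> \<noteq> 0" "z \<in> int_vec"
  shows "lattice_elem \<kappa> z * lattice_gen \<kappa> g - lattice_elem \<kappa> (lattice_act 1 g z) \<in> lift_J \<kappa> (limit_ideal \<kappa>)"
proof -
  obtain z0 z1 z2 z3 z4 where z: "z = (z0, z1, z2, z3, z4)" by (cases z)
  then have zi: "z1 \<in> series_ring" "z2 \<in> series_ring" "z3 \<in> series_ring" "z4 \<in> series_ring"
    using assms(2) by simp_all
  define s r S P where gens: "s = lattice_gen \<kappa> LS" "r = lattice_gen \<kappa> LR" "S = lattice_gen \<kappa> LD" "P = lattice_gen \<kappa> LP"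
  note table = lattice_gen_products[OF assms(1), folded gens]
  note closed = lift_J_closed[OF right_ideal_limit_ideal[OF assms(1)]]
  have two: "const c * 2 = 2 * const c" "const c * (2 * x) = 2 * (const c * x)" for c x
  proof -
    show "const c * 2 = 2 * const c" by (simp add: mult_2 mult_2_right)
    then show "const c * (2 * x) = 2 * (const c * x)" by (simp flip: mult.assoc)
  qed
  have sum: "const z1 * x1 + const z2 * x2 + const z3 * x3 + const z4 * x4 \<in> lift_J \<kappa> (limit_ideal \<kappa>)"
    if "x1 \<in> lift_J \<kappa> (limit_ideal \<kappa>)" "x2 \<in> lift_J \<kappa> (limit_ideal \<kappa>)" "x3 \<in> lift_J \<kappa> (limit_ideal \<kappa>)"
      "x4 \<in> lift_J \<kappa> (limit_ideal \<kappa>)" for x1 x2 x3 x4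
    using that by (intro closed(1,3) zi)
  show ?thesis
  proof (cases g)
    case LS
    have "lattice_elem \<kappa> z * lattice_gen \<kappa> g - lattice_elem \<kappa> (lattice_act 1 g z) =
      const z1 * (s * s - 1) + const z2 * (r * s + r) + const z3 * (S * s + S) + const z4 * (P * s + P)"
      unfolding z LS by (simp add: lattice_elem_eq gens[symmetric] const_simps algebra_simps)
    then show ?thesis using sum table(1-4) by simp
  next
    case LR
    have "lattice_elem \<kappa> z * lattice_gen \<kappa> g - lattice_elem \<kappa> (lattice_act 1 g z) =
      const z1 * (s * r + r) + const z2 * (r * r) + const z3 * (S * r + 2 * r) + const z4 * (P * r)"
      unfolding z LR by (simp add: lattice_elem_eq gens[symmetric] const_simps algebra_simps two Let_def)
    then show ?thesis using sum table(5-8) by simp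
  next
    case LD
    have "lattice_elem \<kappa> z * lattice_gen \<kappa> g - lattice_elem \<kappa> (lattice_act 1 g z) =
      const z1 * (s * S + S) + const z2 * (r * S) + const z3 * (S * S - (2 - 2 * s)) + const z4 * (P * S)"
      unfolding z LD by (simp add: lattice_elem_eq gens[symmetric] const_simps algebra_simps two Let_def)
    then show ?thesis using sum table(9-12) by simp
  next
    case LP
    have "lattice_elem \<kappa> z * lattice_gen \<kappa> g - lattice_elem \<kappa> (lattice_act 1 g z) =
      const z1 * (s * P + P) + const z2 * (r * P) + const z3 * (S * P + 2 * P) + const z4 * (P * P - (2 * s - 2 * S - 2))"
      unfolding z LP by (simp add: lattice_elem_eq gens[symmetric] const_simps algebra_simps two Let_def)
    then show ?thesis using sum table(13-16) by simp
  qed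
qed

lemma lift_J_eq:
  assumes "\<kappa> \<noteq> 0"
  shows "lift_J \<kappa> (limit_ideal \<kappa>) = {x \<in> lift_L \<kappa>. theta \<kappa> x = 0}"
proof (intro equalityI subsetI)
  fix x assume "x \<in> lift_J \<kappa> (limit_ideal \<kappa>)"
  then show "x \<in> {x \<in> lift_L \<kappa>. theta \<kappa> x = 0}"
    using limit_ideal_theta[OF assms] by (simp add: lift_J_def)
next
  note closed = lift_J_closed[OF right_ideal_limit_ideal[OF assms]]
  fix x assume "x \<in> {x \<in> lift_L \<kappa>. theta \<kappa> x = 0}"
  then have x: "x \<in> lift_L \<kappa>" "theta \<kappa> x = 0" by simp_all
  \<comment> \<open>\<open>T\<close> turns out to be the whole lattice.\<close>
  define T where "T = {lattice_elem \<kappa> z + y |z y. z \<in> int_vec \<and> y \<in> lift_J \<kappa> (limit_ideal \<kappa>)}"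
  have TI: "x \<in> T" if "x - lattice_elem \<kappa> z \<in> lift_J \<kappa> (limit_ideal \<kappa>)" "z \<in> int_vec" for x z
    using that unfolding T_def by (intro CollectI exI[of _ z] exI[of _ "x - lattice_elem \<kappa> z"]) simp
  have TE: "thesis" if "x \<in> T" "\<And>z y. x = lattice_elem \<kappa> z + y \<Longrightarrow> z \<in> int_vec \<Longrightarrow> y \<in> lift_J \<kappa> (limit_ideal \<kappa>) \<Longrightarrow> thesis"
    for x thesis
    using that(1) unfolding T_def by (elim CollectE exE conjE) (rule that(2))
  have "1 * x \<in> T"
  proof (rule lift_L_right_induct[OF assms x(1)])
    show "1 \<in> T"
      by (rule TI[of _ "(1, 0, 0, 0, 0)"])
        (simp_all add: lattice_elem_unit closed(5) lift_L_closed)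
  next
    fix x y assume "x \<in> T" "y \<in> T"
    then obtain u i v j where uv: "x = lattice_elem \<kappa> u + i" "u \<in> int_vec" "i \<in> lift_J \<kappa> (limit_ideal \<kappa>)"
      "y = lattice_elem \<kappa> v + j" "v \<in> int_vec" "j \<in> lift_J \<kappa> (limit_ideal \<kappa>)" by (elim TE)
    have "x + y - lattice_elem \<kappa> (u + v) = i + j" by (simp add: uv(1,4) lattice_elem_linear)
    then show "x + y \<in> T" using closed(1)[OF uv(3,6)] int_vec_linear(1)[OF uv(2,5)]
      by (intro TI[of _ "u + v"]) (simp_all only:)
  next
    fix x c assume "x \<in> T" and c: "c \<in> series_ring"
    then obtain u i where uv: "x = lattice_elem \<kappa> u + i" "u \<in> int_vec" "i \<in> lift_J \<kappa> (limit_ideal \<kappa>)" by (elim TE)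
    have "x * const c - lattice_elem \<kappa> (scale c u) = const c * i"
      unfolding const_commute[symmetric] by (simp add: uv(1) lattice_elem_linear distrib_left)
    then show "x * const c \<in> T" using closed(3)[OF uv(3) c] int_vec_linear(3)[OF c uv(2)]
      by (intro TI[of _ "scale c u"]) (simp_all only:)
  next
    fix x g assume "x \<in> T"
    then obtain u i where uv: "x = lattice_elem \<kappa> u + i" "u \<in> int_vec" "i \<in> lift_J \<kappa> (limit_ideal \<kappa>)" by (elim TE)
    have "x * lattice_gen \<kappa> g - lattice_elem \<kappa> (lattice_act 1 g u) =
        (lattice_elem \<kappa> u * lattice_gen \<kappa> g - lattice_elem \<kappa> (lattice_act 1 g u)) + i * lattice_gen \<kappa> g"
      by (simp add: uv(1) distrib_right)
    also have "\<dots> \<in> lift_J \<kappa> (limit_ideal \<kappa>)"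
      by (intro closed(1,2) lattice_elem_mult_lattice_gen assms uv(2,3) lattice_gen_lift_L)
    finally show "x * lattice_gen \<kappa> g \<in> T"
      by (rule TI) (rule lattice_act_series_ring(1)[OF _ _ uv(2)], simp_all)
  qed
  then obtain z y where z: "x = lattice_elem \<kappa> z + y" "z \<in> int_vec" "y \<in> lift_J \<kappa> (limit_ideal \<kappa>)"
    unfolding mult_1_left by (elim TE)
  have "theta \<kappa> (lattice_elem \<kappa> z) = 0"
    using x(2) limit_ideal_theta[OF assms z(3)] by (simp add: z(1) theta_add)
  then have "vmap ct z = vmap ct 0"
    by (simp add: theta_def Phi_lattice_elem[OF assms] vec5_zero)
  then have "limit_map \<kappa> (lattice_elem \<kappa> z) = limit_map \<kappa> (lattice_elem \<kappa> 0)"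
    using z(2) by (intro limit_map_lattice_elem_cong[OF assms]) (simp_all add: vec5_zero)
  then have "lattice_elem \<kappa> z \<in> lift_J \<kappa> (limit_ideal \<kappa>)"
    using lattice_elem_lift_L[OF assms z(2)] by (intro closed(5)) (simp_all only: lattice_elem_zero)
  then show "x \<in> lift_J \<kappa> (limit_ideal \<kappa>)" unfolding z(1) by (intro closed(1) z(3))
qed

theorem theorem4:
  fixes \<kappa> :: real
  assumes "\<kappa> \<noteq> 0"
  shows "contraction \<kappa> (R_minus \<kappa>) =
    gen_right_ideal (E_kappa \<kappa>)
      (limit_generators (E_kappa \<kappa>) (scalar0 \<kappa>) \<kappa> (a0 \<kappa>) (a0' \<kappa>) (w0 \<kappa>) (w0' \<kappa>))"
proof -
  have "contraction \<kappa> (R_minus \<kappa>) =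
      limit_map \<kappa> ` {x \<in> lift_L \<kappa>. module_act (mu \<kappa>) (1, 0, 0, 0, 0) x = 0}"
    unfolding contraction_def lattice_L_eq limit_map_def R_minus_eq_kernel[symmetric] by auto
  also have "\<dots> = limit_map \<kappa> ` {x \<in> lift_L \<kappa>. theta \<kappa> x = 0}"
  proof (rule equalityI)
    show "limit_map \<kappa> ` {x \<in> lift_L \<kappa>. module_act (mu \<kappa>) (1, 0, 0, 0, 0) x = 0}
        \<subseteq> limit_map \<kappa> ` {x \<in> lift_L \<kappa>. theta \<kappa> x = 0}"
      by (rule image_mono) (auto simp: theta_def Phi_def vec5_zero)
    show "limit_map \<kappa> ` {x \<in> lift_L \<kappa>. theta \<kappa> x = 0}
        \<subseteq> limit_map \<kappa> ` {x \<in> lift_L \<kappa>. module_act (mu \<kappa>) (1, 0, 0, 0, 0) x = 0}"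
    proof
      fix y assume "y \<in> limit_map \<kappa> ` {x \<in> lift_L \<kappa>. theta \<kappa> x = 0}"
      then obtain x where x: "y = limit_map \<kappa> x" "x \<in> lift_L \<kappa>" "theta \<kappa> x = 0" by blast
      obtain v where v: "v \<in> int_vec" "Phi \<kappa> x = scale fls_X v"
        using int_vec_eq_X_scale[OF Phi_lift_L(1)[OF assms x(2)]] x(3) unfolding theta_def .
      \<comment> \<open>Subtracting a multiple of \<open>h\<close> moves \<open>x\<close> into \<open>R\<^sub>-\<close> without changing its limit.\<close>
      define x' where "x' = x - const fls_X * lattice_elem \<kappa> v"
      have L: "lattice_elem \<kappa> v \<in> lift_L \<kappa>" by (rule lattice_elem_lift_L[OF assms v(1)])
      have x': "x' \<in> lift_L \<kappa>" unfolding x'_def using x(2) L by (intro lift_L_closed series_ring_basic)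
      have "Phi \<kappa> x' = 0"
        unfolding x'_def Phi_linear Phi_lattice_elem[OF assms] v(2) by simp
      then have "module_act (mu \<kappa>) (1, 0, 0, 0, 0) x' = 0"
        using Phi_lift_L(2)[OF assms x'] by (simp add: vec5_zero)
      moreover have "limit_map \<kappa> x = limit_map \<kappa> x'"
        by (rule iffD2[OF limit_map_eq_iff[OF x(2) x']], rule bexI[OF _ L])
          (simp add: x'_def SU_ideal_closed(1))
      ultimately show "y \<in> limit_map \<kappa> ` {x \<in> lift_L \<kappa>. module_act (mu \<kappa>) (1, 0, 0, 0, 0) x = 0}"
        using x(1) x' by blast
    qed
  qed
  also have "\<dots> = limit_map \<kappa> ` lift_J \<kappa> (limit_ideal \<kappa>)" by (simp only: lift_J_eq[OF assms])
  also have "\<dots> = limit_ideal \<kappa>"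
    using right_idealD(1)[OF right_ideal_limit_ideal[OF assms]] unfolding lift_J_def carrier_E_kappa by blast
  finally show ?thesis .
qed

end
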